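(* Assume Assumptions 1, 2, 3 and 4 (stated in the context) hold for the family $\mathcal{P}$, and let $\pi$ denote Algorithm 1. Then there exists a constant $C$ such that for every $P\in\mathcal{P}$ and all sufficiently large $n$, $$\mathrm{Regret}_n(\pi,P)\le C(\log n)^2 .$$
   Context: Setting and notation. Fix an integer $m\ge 1$ (number of resource types). A distribution sequence is $P=\{P_n\}_{n\ge1}$, where for each $n\in\mathbb{N}_+$, $P_n$ is the joint law of random pairs $(u_{j,n},a_{j,n})\in\mathbb{R}_+\times\mathbb{R}_+^m$, $j=1,\dots,n$ (reward and resource consumption of the $j$-th of $n$ sequentially arriving orders); $\mathcal{P}$ is a family of distribution sequences. $\mathbb{E}$ and $\mathbb{P}$ refer to $P_n$. $x^+=\max\{x,0\}$; $\mathbf{1}\{\cdot\}$ is an indicator; vector inequalities are entrywise. Assumption 1: there is $d_0\in\mathbb{R}^m$ with all entries positive such that the initial resource endowment is $b_{0,n}=nd_0$. Assumption 2 (single sample): a random sample $\{(\tilde u_{j,n},\tilde a_{j,n})\}_{j=1}^n$ is available at the beginning, independent of $\{(u_{j,n},a_{j,n})\}_{j=1}^n$ and equal to it in distribution. Assumption 3: there exist positive reals $\alpha,\underline a,\lambda,\bar L,\bar u,\bar\mu,\underline\mu$ and a set $\Xi\subseteq[0,\alpha]^m$ such that for every $P\in\mathcal{P}$: (a) for every $n$ the pairs $(u_{j,n},a_{j,n})$, $j=1,\dots,n$, are independent; (b) $\Xi$ is the support of every $a_{j,n}$, every entry of $\mathbb{E}[a_{j,n}]$ exceeds $\underline a$,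 and the smallest eigenvalue of $\mathbb{E}[a_{j,n}a_{j,n}^T]$ exceeds $\lambda$, for all $j,n$; (c) there is a positive continuously differentiable $v:[0,1]\times[0,\alpha]^m\to[0,\bar\mu]$ with $\|\nabla v\|_2\le\bar L$ such that for all $j,n$ the restriction of $v(j/n,\cdot)$ to $\Xi$ is the probability mass function or the probability density function of $a_{j,n}$; (d) there is a continuously differentiable $f:[0,1]\times[0,\alpha]^m\times[0,\bar u]\to[\underline\mu,\bar\mu]$, $(t,a,u)\mapsto f(t,a,u)$, with $\|\nabla f\|_2\le\bar L$, such that for all $a\in\Xi$ and all $j,n$, $f(j/n,a,\cdot)$ is the conditional density of $u_{j,n}$ given $a_{j,n}=a$. Limit problem: for $t\in[0,1]$ let $(u_t,a_t)$ be a random pair such that $a_t$ has mass/density function $v(t,\cdot)$ on $\Xi$ and, given $a_t=a$, $u_t$ has density $f(t,a,\cdot)$ (so $(u_{j/n},a_{j/n})$ and $(u_{j,n},a_{j,n})$ are equal in distribution). Let $g^*_\infty(p,d)=d^Tp+\int_0^1\mathbb{E}[(u_s-a_s^Tp)^+]\,ds$. Assumption 4: there exists $\epsilon_{\mathcal P}>0$ such that for every $P\in\mathcal{P}$ there is $p^*\in\arg\min_{p\ge0}g^*_\infty(p,d_0)$ with $(\inf_{a\in\Xi}a^Tp^*,\sup_{a\in\Xi}a^Tp^* )\subseteq(\epsilon_{\mathcal P},\bar u-\epsilon_{\mathcal P})$. Algorithm 1: input $d_0$ and the sample of Assumption 2. Set $b_{0,n}=nd_0$. For $j=1,\dots,n$: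 let $p^\pi_{j-1,n}\in\arg\min_{p\ge0}\big\{b_{j-1,n}^Tp+\sum_{k=j}^n(\tilde u_{k,n}-\tilde a_{k,n}^Tp)^+\big\}$; accept order $j$ with $x^\pi_{j,n}=\mathbf 1\{u_{j,n}>a_{j,n}^Tp^\pi_{j-1,n}\}\mathbf 1\{b_{j-1,n}\ge a_{j,n}\}$; update $b_{j,n}=b_{j-1,n}-a_{j,n}x^\pi_{j,n}$. Its total reward is $R_n(\pi)=\sum_{j=1}^n u_{j,n}x^\pi_{j,n}$. Regret: let $R^{off}_n$ be the optimal value of the linear program $\max\sum_{j=1}^nu_{j,n}x_{j}$ s.t. $\sum_{j=1}^na_{j,n}x_j\le b_{0,n}$, $0\le x_j\le1$. Then $\mathrm{Regret}_n(\pi,P)=\mathbb{E}_{P_n}[R^{off}_n-R_n(\pi)]$. *)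

theory Defs
  imports "HOL-Probability.Probability"
begin

text \<open>
  Resource types are indexed by the finite type \<open>'m\<close>; the order on \<open>real ^ 'm\<close> is entrywise.
  An order is a pair (reward, consumption). A distribution sequence assigns to each
  \<open>n \<ge> 1\<close> a law on paths indexed by \<open>{1..n}\<close>; its value at 0 is irrelevant.
\<close>

type_synonym 'm order = "real \<times> (real ^ 'm)"
type_synonym 'm path = "nat \<Rightarrow> 'm order"
type_synonym 'm dist_seq = "nat \<Rightarrow> 'm path measure"

definition path_space :: "nat \<Rightarrow> ('m::finite) path measure" where
  "path_space n = PiM {1..n} (\<lambda>_. borel)"

definition nonneg_paths :: "nat \<Rightarrow> ('m::finite) path set" where
  "nonneg_paths n = {1..n} \<rightarrow>\<^sub>E {(u, a). 0 \<le> u \<and> 0 \<le> a}"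

definition distribution_sequence :: "('m::finite) dist_seq \<Rightarrow> bool" where
  "distribution_sequence P \<longleftrightarrow>
     (\<forall>n\<ge>1. prob_space (P n) \<and> sets (P n) = sets (path_space n) \<and>
            (AE \<omega> in P n. \<omega> \<in> nonneg_paths n))"

definition measure_support :: "'a::topological_space measure \<Rightarrow> 'a set" where
  "measure_support M = {x. \<forall>U. open U \<longrightarrow> x \<in> U \<longrightarrow> emeasure M U > 0}"

definition eigenvalues :: "real ^ 'm ^ 'm \<Rightarrow> real set" where
  "eigenvalues A = {l. \<exists>x. x \<noteq> 0 \<and> A *v x = l *\<^sub>R x}"

definition second_moment_matrix :: "'w measure \<Rightarrow> ('w \<Rightarrow> real ^ 'm) \<Rightarrow> real ^ 'm ^ 'm" where
  "second_moment_matrix M X = (\<chi> i k. \<integral>w. X w $ i * X w $ k \<partial>M)"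

text \<open>Continuous differentiability on a set, one-sided at the boundary, with bounded gradient.\<close>

definition C1_gradient_bounded :: "'a::euclidean_space set \<Rightarrow> real \<Rightarrow> ('a \<Rightarrow> real) \<Rightarrow> bool" where
  "C1_gradient_bounded S L h \<longleftrightarrow>
     (\<exists>grad. continuous_on S grad \<and>
        (\<forall>x\<in>S. (h has_derivative (\<lambda>y. grad x \<bullet> y)) (at x within S) \<and> norm (grad x) \<le> L))"

text \<open>
  Reference measures on \<open>\<Xi>\<close>: a function on \<open>\<Xi>\<close> is a mass function relative to the first and a
  probability density function relative to the second. Both are measures on the Borel sets
  of the whole space.
\<close>

definition counting_on :: "(real ^ 'm) set \<Rightarrow> (real ^ 'm::finite) measure" where
  "counting_on \<Xi> = distr (count_space \<Xi>) borel (\<lambda>a. a)"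

definition lebesgue_on_support :: "(real ^ 'm) set \<Rightarrow> (real ^ 'm::finite) measure" where
  "lebesgue_on_support \<Xi> = density lborel (indicator \<Xi>)"

text \<open>Law of a consumption vector with mass or density function \<open>v (t, \<cdot>)\<close> on \<open>\<Xi>\<close>.\<close>

definition consumption_law ::
  "(real ^ 'm) measure \<Rightarrow> (real ^ 'm) set \<Rightarrow> (real \<times> (real ^ 'm::finite) \<Rightarrow> real) \<Rightarrow> real
     \<Rightarrow> (real ^ 'm) measure" where
  "consumption_law \<nu> \<Xi> v t = density \<nu> (\<lambda>a. ennreal (v (t, a)) * indicator \<Xi> a)"

text \<open>
  Law of a pair (consumption, reward) whose consumption has law \<open>Q\<close> and whose reward, given
  consumption \<open>a\<close> in \<open>\<Xi>\<close>, has Lebesgue density \<open>f (t, a, \<cdot>)\<close> on \<open>[0, ub]\<close>.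
\<close>

definition pair_law ::
  "(real ^ 'm) measure \<Rightarrow> (real ^ 'm) set \<Rightarrow> real \<Rightarrow> (real \<times> (real ^ 'm::finite) \<times> real \<Rightarrow> real)
     \<Rightarrow> real \<Rightarrow> ((real ^ 'm) \<times> real) measure" where
  "pair_law Q \<Xi> ub f t =
     density (Q \<Otimes>\<^sub>M lborel)
       (\<lambda>(a, u). ennreal (f (t, a, u)) * indicator \<Xi> a * indicator {0..ub} u)"

definition regular_family ::
  "('m::finite) dist_seq set \<Rightarrow> real \<Rightarrow> real \<Rightarrow> real \<Rightarrow> real \<Rightarrow> real \<Rightarrow> real \<Rightarrow> real
     \<Rightarrow> (real ^ 'm) set \<Rightarrow> (real ^ 'm) measure
     \<Rightarrow> ('m dist_seq \<Rightarrow> real \<times> (real ^ 'm) \<Rightarrow> real)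
     \<Rightarrow> ('m dist_seq \<Rightarrow> real \<times> (real ^ 'm) \<times> real \<Rightarrow> real) \<Rightarrow> bool" where
  "regular_family \<P> \<alpha> a_lo lam L ub mu_hi mu_lo \<Xi> \<nu> v f \<longleftrightarrow>
     0 < \<alpha> \<and> 0 < a_lo \<and> 0 < lam \<and> 0 < L \<and> 0 < ub \<and> 0 < mu_hi \<and> 0 < mu_lo \<and>
     \<Xi> \<subseteq> {0..vec \<alpha>} \<and> (\<nu> = counting_on \<Xi> \<or> \<nu> = lebesgue_on_support \<Xi>) \<and>
     (\<forall>P\<in>\<P>.
        (\<forall>n\<ge>1. prob_space.indep_vars (P n) (\<lambda>_. borel) (\<lambda>j \<omega>. \<omega> j) {1..n}) \<and>
        (\<forall>n\<ge>1. \<forall>j\<in>{1..n}.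
            measure_support (distr (P n) borel (\<lambda>\<omega>. snd (\<omega> j))) = \<Xi> \<and>
            (\<forall>i. (\<integral>\<omega>. snd (\<omega> j) $ i \<partial>P n) > a_lo) \<and>
            Min (eigenvalues (second_moment_matrix (P n) (\<lambda>\<omega>. snd (\<omega> j)))) > lam) \<and>
        C1_gradient_bounded ({0..1} \<times> {0..vec \<alpha>}) L (v P) \<and>
        (\<forall>x \<in> {0..1} \<times> {0..vec \<alpha>}. 0 < v P x \<and> v P x \<le> mu_hi) \<and>
        (\<forall>n\<ge>1. \<forall>j\<in>{1..n}.
            distr (P n) borel (\<lambda>\<omega>. snd (\<omega> j)) = consumption_law \<nu> \<Xi> (v P) (real j / real n)) \<and>
        C1_gradient_bounded ({0..1} \<times> {0..vec \<alpha>} \<times> {0..ub}) L (f P) \<and>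
        (\<forall>x \<in> {0..1} \<times> {0..vec \<alpha>} \<times> {0..ub}. mu_lo \<le> f P x \<and> f P x \<le> mu_hi) \<and>
        (\<forall>n\<ge>1. \<forall>j\<in>{1..n}.
            (\<forall>a\<in>\<Xi>. (LBINT u:{0..ub}. f P (real j / real n, a, u)) = 1) \<and>
            distr (P n) (borel \<Otimes>\<^sub>M borel) (\<lambda>\<omega>. (snd (\<omega> j), fst (\<omega> j))) =
              pair_law (distr (P n) borel (\<lambda>\<omega>. snd (\<omega> j))) \<Xi> ub (f P) (real j / real n)))"

definition limit_dual ::
  "(real ^ 'm) measure \<Rightarrow> (real ^ 'm) set \<Rightarrow> real
     \<Rightarrow> (real \<times> (real ^ 'm::finite) \<Rightarrow> real) \<Rightarrow> (real \<times> (real ^ 'm) \<times> real \<Rightarrow> real)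
     \<Rightarrow> real ^ 'm \<Rightarrow> real ^ 'm \<Rightarrow> real" where
  "limit_dual \<nu> \<Xi> ub v f p d =
     d \<bullet> p + (LBINT s:{0..1}.
       (\<integral>(a, u). max 0 (u - a \<bullet> p) \<partial>pair_law (consumption_law \<nu> \<Xi> v s) \<Xi> ub f s))"

definition interior_limit_price ::
  "(real ^ 'm) measure \<Rightarrow> (real ^ 'm) set \<Rightarrow> real
     \<Rightarrow> (real \<times> (real ^ 'm::finite) \<Rightarrow> real) \<Rightarrow> (real \<times> (real ^ 'm) \<times> real \<Rightarrow> real)
     \<Rightarrow> real ^ 'm \<Rightarrow> real \<Rightarrow> bool" where
  "interior_limit_price \<nu> \<Xi> ub v f d0 \<epsilon> \<longleftrightarrow>
     (\<exists>p. is_arg_min (\<lambda>q. limit_dual \<nu> \<Xi> ub v f q d0) (\<lambda>q. 0 \<le> q) p \<and>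
          {(INF a\<in>\<Xi>. a \<bullet> p) <..< (SUP a\<in>\<Xi>. a \<bullet> p)} \<subseteq> {\<epsilon> <..< ub - \<epsilon>})"

text \<open>
  A price rule \<open>pr\<close> resolves the choice among minimisers: \<open>pr n j \<omega> s\<close> is the price set after
  \<open>j\<close> of \<open>n\<close> orders, where \<open>\<omega>\<close> carries the orders \<open>1..j\<close> seen so far and \<open>s\<close> is the sample.
\<close>

type_synonym 'm price_rule = "nat \<Rightarrow> nat \<Rightarrow> 'm path \<Rightarrow> 'm path \<Rightarrow> real ^ 'm"

definition price :: "('m::finite) price_rule \<Rightarrow> nat \<Rightarrow> nat \<Rightarrow> 'm path \<Rightarrow> 'm path \<Rightarrow> real ^ 'm" where
  "price pr n j \<omega> s = pr n j (restrict \<omega> {1..j}) s"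

definition decision :: "real ^ ('m::finite) \<Rightarrow> real ^ 'm \<Rightarrow> 'm order \<Rightarrow> real" where
  "decision q b = (\<lambda>(u, a). of_bool (u > a \<bullet> q) * of_bool (b \<ge> a))"

primrec budget ::
  "real ^ ('m::finite) \<Rightarrow> 'm price_rule \<Rightarrow> nat \<Rightarrow> 'm path \<Rightarrow> 'm path \<Rightarrow> nat \<Rightarrow> real ^ 'm" where
  "budget d0 pr n \<omega> s 0 = real n *\<^sub>R d0"
| "budget d0 pr n \<omega> s (Suc j) =
     budget d0 pr n \<omega> s j
       - decision (price pr n j \<omega> s) (budget d0 pr n \<omega> s j) (\<omega> (Suc j)) *\<^sub>R snd (\<omega> (Suc j))"

definition sample_dual ::
  "real ^ ('m::finite) \<Rightarrow> nat \<Rightarrow> nat \<Rightarrow> 'm path \<Rightarrow> real ^ 'm \<Rightarrow> real" where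
  "sample_dual b n j s q =
     b \<bullet> q + (\<Sum>k\<in>{j+1..n}. max 0 (fst (s k) - snd (s k) \<bullet> q))"

definition single_sample_algorithm :: "real ^ ('m::finite) \<Rightarrow> 'm price_rule \<Rightarrow> bool" where
  "single_sample_algorithm d0 pr \<longleftrightarrow>
     (\<forall>n\<ge>1. \<forall>j<n.
        (\<lambda>(h, s). pr n j h s) \<in> path_space j \<Otimes>\<^sub>M path_space n \<rightarrow>\<^sub>M borel \<and>
        (\<forall>\<omega> \<in> nonneg_paths n. \<forall>s \<in> nonneg_paths n.
           is_arg_min (sample_dual (budget d0 pr n \<omega> s j) n j s) (\<lambda>q. 0 \<le> q)
             (price pr n j \<omega> s)))"

definition algorithm_reward ::
  "real ^ ('m::finite) \<Rightarrow> 'm price_rule \<Rightarrow> nat \<Rightarrow> 'm path \<Rightarrow> 'm path \<Rightarrow> real" where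
  "algorithm_reward d0 pr n \<omega> s =
     (\<Sum>j\<in>{1..n}. fst (\<omega> j) *
        decision (price pr n (j - 1) \<omega> s) (budget d0 pr n \<omega> s (j - 1)) (\<omega> j))"

definition offline_reward :: "real ^ ('m::finite) \<Rightarrow> nat \<Rightarrow> 'm path \<Rightarrow> real" where
  "offline_reward d0 n \<omega> =
     Sup {(\<Sum>j\<in>{1..n}. fst (\<omega> j) * x j) | x :: nat \<Rightarrow> real.
            (\<Sum>j\<in>{1..n}. x j *\<^sub>R snd (\<omega> j)) \<le> real n *\<^sub>R d0 \<and>
            (\<forall>j\<in>{1..n}. 0 \<le> x j \<and> x j \<le> 1)}"

text \<open>
  The orders and the sample are independent and identically distributed, so their joint law is
  \<open>P n \<Otimes>\<^sub>M P n\<close>.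
\<close>

definition regret :: "real ^ ('m::finite) \<Rightarrow> 'm price_rule \<Rightarrow> nat \<Rightarrow> 'm dist_seq \<Rightarrow> real" where
  "regret d0 pr n P =
     (\<integral>(\<omega>, s). offline_reward d0 n \<omega> - algorithm_reward d0 pr n \<omega> s \<partial>(P n \<Otimes>\<^sub>M P n))"

end

theory Submission
  imports Defs
begin

text \<open>
  Write \<open>s\<^sub>k(p) = E (u\<^sub>k - a\<^sub>k \<bullet> p)\<^sup>+\<close> and let \<open>W\<^sub>j(b)\<close> be the minimum over prices \<open>p\<close> of the fluid dual
  \<open>G\<^sub>j(b, p) = b \<bullet> p + \<Sum>\<^sub>k\<^sub>>\<^sub>j s\<^sub>k(p)\<close>, where \<open>p\<close> ranges over a set on which every \<open>s\<^sub>k\<close> is uniformly strongly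
  convex. Let \<open>N\<close> be the number of orders left. Strong convexity makes \<open>W\<^sub>j\<close> smooth from below in \<open>b\<close>,
  so accepting at a price \<open>q\<close> loses in expectation at most \<open>O(|q - p|\<^sup>2 + 1 / N)\<close> of the fluid value,
  where \<open>p\<close> is the minimiser of the fluid dual. Since the same sample is used at all times, a bound on
  \<open>|q - p|\<close> is needed that is uniform over budgets; Hoeffding's inequality on a grid gives
  \<open>|q - p|\<^sup>2 = O(log n / N)\<close>, and summing over \<open>N\<close> yields the factor \<open>(log n)\<^sup>2\<close>.

  This works as long as the gap \<open>G\<^sub>j(b, p*) - W\<^sub>j(b)\<close> at the limit price \<open>p*\<close> is at most \<open>c N\<close>: strong
  convexity then keeps the minimiser near \<open>p*\<close>, and no resource is about to run out. Since
  \<open>G\<^sub>j(b, p*)\<close> plus the collected reward does not increase in expectation, the gap at the first violation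
  is \<open>O((log n)\<^sup>2)\<close> in expectation, hence so is the remaining time and the reward lost there.
  The offline optimum is bounded by weak duality at \<open>p*\<close>.
\<close>

subsection \<open>Surplus of a single order\<close>

text \<open>Given the sample \<open>s\<close>, the orders keep their product law, so
  \<open>s\<close> enters only through one deterministic inequality on deviations, and Fubini joins
  the two halves. That inequality bounds the difference of the deviations at two prices by a
  multiple of their distance. Without this scaling the squared price error would only be of order
  sqrt(ln n / N), which is far too large after summation. Neither the stopping time nor the gap at
  that time is estimated separately. The potential is 1 + A times (reward + \<open>fluid\<close>)
  minus A times (reward + \<open>dual\<close> at \<open>pstar\<close>): while the process runs, the
  first part is almost a submartingale and the second a supermartingale. With A = \<open>ub\<close>
  / \<open>c\<close> the gap at a violation outweighs the value still to come, so one drift estimate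
  gives the regret. Prices must stay where rewards have positive density, which requires a margin of
  a \<bullet> \<open>pstar\<close> below \<open>ub\<close>. The interval condition gives it only if
  a \<bullet> \<open>pstar\<close> varies over the support; if it is constant, the margin comes from
  the budget, whose value at a minimising price cannot exceed the expected expenditure.\<close>

definition surplus :: "('m::finite) order measure \<Rightarrow> real ^ 'm \<Rightarrow> real" where
  "surplus \<mu> p = (\<integral>y. max 0 (fst y - snd y \<bullet> p) \<partial>\<mu>)"

definition consumption :: "('m::finite) order measure \<Rightarrow> real ^ 'm \<Rightarrow> real ^ 'm" where
  "consumption \<mu> p = (\<integral>y. of_bool (fst y > snd y \<bullet> p) *\<^sub>R snd y \<partial>\<mu>)"

text \<open>The Bregman divergence of \<open>surplus\<close> between \<open>q\<close> and
  \<open>p\<close>, with \<open>- consumption \<mu> p\<close> as subgradient at \<open>p\<close>.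
  Equivalently: with resources valued at \<open>q\<close>, the expected loss from accepting by the
  threshold of \<open>p\<close>.\<close>

definition divergence :: "('m::finite) order measure \<Rightarrow> real ^ 'm \<Rightarrow> real ^ 'm \<Rightarrow> real" where
  "divergence \<mu> q p =
     (\<integral>y. max 0 (fst y - snd y \<bullet> q) - of_bool (fst y > snd y \<bullet> p) * (fst y - snd y \<bullet> q) \<partial>\<mu>)"

lemma norm_le_of_box:
  fixes a :: "real ^ 'm::finite"
  assumes "0 \<le> a" "a \<le> vec \<alpha>"
  shows "norm a \<le> \<alpha> * CARD('m)"
proof -
  have "norm a \<le> (\<Sum>i\<in>UNIV. \<bar>a $ i\<bar>)" by (rule norm_le_l1_cart)
  also have "\<dots> \<le> (\<Sum>i\<in>(UNIV::'m set). \<alpha>)"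
    using assms by (intro sum_mono) (simp add: less_eq_vec_def)
  finally show ?thesis by (simp add: mult.commute)
qed

lemma inner_nonneg_vec:
  fixes a p :: "real ^ 'm::finite"
  assumes "0 \<le> a" "0 \<le> p"
  shows "0 \<le> a \<bullet> p"
  using assms by (auto simp: inner_vec_def less_eq_vec_def intro!: sum_nonneg)

lemma measurable_fst_borel [measurable]:
  "(fst :: ('a::second_countable_topology \<times> 'b::second_countable_topology) \<Rightarrow> 'a) \<in> borel_measurable borel"
  by (intro borel_measurable_continuous_onI continuous_intros)

lemma measurable_snd_borel [measurable]:
  "(snd :: ('a::second_countable_topology \<times> 'b::second_countable_topology) \<Rightarrow> 'b) \<in> borel_measurable borel"
  by (intro borel_measurable_continuous_onI continuous_intros)

locale order_law = prob_space \<mu> for \<mu> :: "('m::finite) order measure" +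
  fixes \<alpha> M ub :: real
  assumes sets_eq [measurable_cong, simp]: "sets \<mu> = sets borel"
    and AE_order: "AE y in \<mu>. 0 \<le> fst y \<and> fst y \<le> ub \<and> 0 \<le> snd y \<and> snd y \<le> vec \<alpha> \<and> norm (snd y) \<le> M"
begin

lemma AE_norm: "AE y in \<mu>. norm (snd y) \<le> M"
  using AE_order by eventually_elim simp

lemma M_nonneg: "0 \<le> M"
proof -
  have "AE y in \<mu>. 0 \<le> M"
    using AE_norm by eventually_elim (meson norm_ge_zero order_trans)
  then show ?thesis using AE_const by simp
qed

lemma ub_nonneg: "0 \<le> ub"
proof -
  have "AE y in \<mu>. 0 \<le> ub"
    using AE_order by eventually_elim auto
  then show ?thesis using AE_const by simp
qed

lemma integrable_reward [simp]: "integrable \<mu> fst"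
proof (rule integrable_const_bound[where B = ub])
  show "AE x in \<mu>. norm (fst x) \<le> ub" using AE_order by eventually_elim auto
qed measurable

lemma integrable_resource [simp]: "integrable \<mu> snd"
  by (rule integrable_const_bound[where B = M]) (use AE_norm in \<open>auto\<close>)

lemma integrable_gain [simp]: "integrable \<mu> (\<lambda>y. fst y - snd y \<bullet> q)"
  by simp

lemma integrable_pos_gain [simp]: "integrable \<mu> (\<lambda>y. max 0 (fst y - snd y \<bullet> q))"
  by (rule Bochner_Integration.integrable_bound[OF integrable_gain[of q]]) (auto)

lemma integrable_accept [simp]:
  "integrable \<mu> (\<lambda>y. of_bool (fst y > snd y \<bullet> p) * (fst y - snd y \<bullet> q))"
  by (rule Bochner_Integration.integrable_bound[OF integrable_gain[of q]]) (auto)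

lemma integrable_accept_resource [simp]:
  "integrable \<mu> (\<lambda>y. of_bool (fst y > snd y \<bullet> p) *\<^sub>R snd y)"
  by (rule Bochner_Integration.integrable_bound[OF integrable_resource]) (auto)

lemma integrable_accept_cost [simp]:
  "integrable \<mu> (\<lambda>y. of_bool (fst y > snd y \<bullet> p) * (snd y \<bullet> q))"
proof (rule Bochner_Integration.integrable_bound)
  show "integrable \<mu> (\<lambda>y. snd y \<bullet> q)" by simp
qed auto

text \<open>Holds pointwise before integration, because the positive part at \<open>p\<close> is the
  acceptance indicator times \<open>fst y - snd y \<bullet> p\<close>. The expansion is an exact
  identity rather than a Taylor estimate.\<close>

lemma surplus_expand:
  "surplus \<mu> q = surplus \<mu> p + consumption \<mu> p \<bullet> (p - q) + divergence \<mu> q p"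
proof -
  have "consumption \<mu> p \<bullet> (p - q) = (\<integral>y. (of_bool (fst y > snd y \<bullet> p) *\<^sub>R snd y) \<bullet> (p - q) \<partial>\<mu>)"
    unfolding consumption_def by (subst integral_inner_left[symmetric]) auto
  then have "surplus \<mu> p + consumption \<mu> p \<bullet> (p - q) + divergence \<mu> q p
    = (\<integral>y. max 0 (fst y - snd y \<bullet> p) + (of_bool (fst y > snd y \<bullet> p) *\<^sub>R snd y) \<bullet> (p - q)
        + (max 0 (fst y - snd y \<bullet> q) - of_bool (fst y > snd y \<bullet> p) * (fst y - snd y \<bullet> q)) \<partial>\<mu>)"
    unfolding surplus_def divergence_def
    by (subst Bochner_Integration.integral_add; simp)+
  also have "\<dots> = surplus \<mu> q"
    unfolding surplus_def
    by (intro Bochner_Integration.integral_cong) (auto simp: algebra_simps max_def)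
  finally show ?thesis by simp
qed

lemma integral_accept:
  "(\<integral>y. of_bool (fst y > snd y \<bullet> p) * (fst y - snd y \<bullet> q) \<partial>\<mu>) = surplus \<mu> q - divergence \<mu> q p"
  unfolding surplus_def divergence_def by (subst Bochner_Integration.integral_diff) auto

lemma divergence_nonneg: "0 \<le> divergence \<mu> q p"
  unfolding divergence_def by (intro Bochner_Integration.integral_nonneg) (auto)

lemma surplus_le:
  assumes "0 \<le> p" shows "surplus \<mu> p \<le> ub"
proof -
  have "surplus \<mu> p \<le> (\<integral>y. ub \<partial>\<mu>)"
    unfolding surplus_def
  proof (intro integral_mono_AE)
    show "AE y in \<mu>. max 0 (fst y - snd y \<bullet> p) \<le> ub"
      using AE_order
      by eventually_elim (use assms ub_nonneg inner_nonneg_vec in \<open>fastforce\<close>)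
  qed auto
  then show ?thesis by (simp add: prob_space)
qed

lemma pos_gain_lipschitz:
  assumes "norm (a :: real ^ 'm) \<le> M"
  shows "\<bar>max 0 (u - a \<bullet> p) - max 0 (u - a \<bullet> q)\<bar> \<le> M * norm (p - q)"
proof -
  have "\<bar>max 0 (u - a \<bullet> p) - max 0 (u - a \<bullet> q)\<bar> \<le> \<bar>a \<bullet> (p - q)\<bar>"
    by (auto simp: inner_diff_right)
  also have "\<dots> \<le> norm a * norm (p - q)" by (rule Cauchy_Schwarz_ineq2)
  also have "\<dots> \<le> M * norm (p - q)" by (intro mult_right_mono assms) auto
  finally show ?thesis .
qed

lemma surplus_lipschitz: "\<bar>surplus \<mu> p - surplus \<mu> q\<bar> \<le> M * norm (p - q)"
proof -
  have "surplus \<mu> p - surplus \<mu> q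
      = (\<integral>y. max 0 (fst y - snd y \<bullet> p) - max 0 (fst y - snd y \<bullet> q) \<partial>\<mu>)"
    unfolding surplus_def by simp
  also have "\<bar>\<dots>\<bar> \<le> (\<integral>y. \<bar>max 0 (fst y - snd y \<bullet> p) - max 0 (fst y - snd y \<bullet> q)\<bar> \<partial>\<mu>)"
    by (rule integral_abs_bound)
  also have "\<dots> \<le> (\<integral>y. M * norm (p - q) \<partial>\<mu>)"
  proof (intro integral_mono_AE)
    show "AE y in \<mu>. \<bar>max 0 (fst y - snd y \<bullet> p) - max 0 (fst y - snd y \<bullet> q)\<bar> \<le> M * norm (p - q)"
      using AE_norm by eventually_elim (rule pos_gain_lipschitz)
  qed auto
  finally show ?thesis by (simp add: prob_space)
qed

lemma norm_consumption_le: "norm (consumption \<mu> p) \<le> M"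
proof -
  have "norm (consumption \<mu> p) \<le> (\<integral>y. norm (of_bool (fst y > snd y \<bullet> p) *\<^sub>R snd y) \<partial>\<mu>)"
    unfolding consumption_def by (rule integral_norm_bound)
  also have "\<dots> \<le> (\<integral>y. M \<partial>\<mu>)"
  proof (intro integral_mono_AE)
    show "AE y in \<mu>. norm (of_bool (fst y > snd y \<bullet> p) *\<^sub>R snd y) \<le> M"
      using AE_norm by eventually_elim (use M_nonneg in auto)
  qed (use integrable_norm[OF integrable_accept_resource] in auto)
  finally show ?thesis by (simp add: prob_space)
qed

end

subsection \<open>The fluid dual problem\<close>

text \<open>The bounds are stated for every index \<open>k\<close>, which avoids range conditions.
  \<open>divergence_upper\<close> covers all nonnegative prices because it is applied to the price
  of the algorithm, of which only nonnegativity is used there; the lower bounds are confined to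
  \<open>B\<close>.\<close>

locale order_sequence =
  fixes n :: nat and \<mu> :: "nat \<Rightarrow> ('m::finite) order measure"
    and \<alpha> M ub \<kappa> C1 c2 R :: real and B :: "(real ^ 'm) set"
  assumes law: "\<And>k. order_law (\<mu> k) \<alpha> M ub"
    and convex_B: "convex B" and closed_B: "closed B" and zero_B: "0 \<in> B"
    and nonneg_B: "\<And>p. p \<in> B \<Longrightarrow> 0 \<le> p"
    and norm_B: "\<And>p. p \<in> B \<Longrightarrow> norm p \<le> R"
    and divergence_lower:
      "\<And>k p q. p \<in> B \<Longrightarrow> q \<in> B \<Longrightarrow> \<kappa> * (norm (q - p))\<^sup>2 \<le> divergence (\<mu> k) q p"
    and divergence_upper:
      "\<And>k p q. 0 \<le> p \<Longrightarrow> 0 \<le> q \<Longrightarrow> divergence (\<mu> k) q p \<le> C1 * (norm (q - p))\<^sup>2"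
    and consumption_lower: "\<And>k p i. p \<in> B \<Longrightarrow> c2 \<le> consumption (\<mu> k) p $ i"
    and kappa_pos: "0 < \<kappa>" and C1_pos: "0 < C1" and c2_pos: "0 < c2" and alpha_pos: "0 < \<alpha>"
begin

definition total :: "nat \<Rightarrow> real ^ 'm \<Rightarrow> real" where
  "total j p = (\<Sum>k\<in>{j+1..n}. surplus (\<mu> k) p)"

definition dual :: "nat \<Rightarrow> real ^ 'm \<Rightarrow> real ^ 'm \<Rightarrow> real" where
  "dual j b p = b \<bullet> p + total j p"

text \<open>Taking the infimum over the compact convex set \<open>B\<close> makes it attained at a
  point around which the dual grows quadratically.\<close>

definition fluid :: "nat \<Rightarrow> real ^ 'm \<Rightarrow> real" where
  "fluid j b = (INF p\<in>B. dual j b p)"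

lemma ub_nonneg: "0 \<le> ub" using order_law.ub_nonneg[OF law] .

lemma M_nonneg: "0 \<le> M" using order_law.M_nonneg[OF law] .

lemma R_nonneg: "0 \<le> R" using norm_B[OF zero_B] by simp

lemma total_Suc:
  assumes "j < n" shows "total j p = surplus (\<mu> (Suc j)) p + total (Suc j) p"
proof -
  have "{j+1..n} = insert (Suc j) {Suc j + 1..n}" using assms by auto
  then show ?thesis by (simp add: total_def)
qed

lemma total_le:
  assumes "0 \<le> p" shows "total j p \<le> ub * real (n - j)"
proof -
  have "total j p \<le> (\<Sum>k\<in>{j+1..n}. ub)"
    unfolding total_def by (intro sum_mono order_law.surplus_le[OF law] assms)
  then show ?thesis by (simp add: mult.commute)
qed

lemma total_lipschitz: "\<bar>total j p - total j q\<bar> \<le> real (n - j) * M * norm (p - q)"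
proof -
  have "\<bar>total j p - total j q\<bar> \<le> (\<Sum>k\<in>{j+1..n}. \<bar>surplus (\<mu> k) p - surplus (\<mu> k) q\<bar>)"
    unfolding total_def sum_subtractf[symmetric] by (rule sum_abs)
  also have "\<dots> \<le> (\<Sum>k\<in>{j+1..n}. M * norm (p - q))"
    by (intro sum_mono order_law.surplus_lipschitz[OF law])
  finally show ?thesis by simp
qed

lemma dual_continuous: "continuous_on S (dual j b)"
proof -
  have "(real (n - j) * M)-lipschitz_on S (total j)"
    by (rule lipschitz_onI) (use total_lipschitz M_nonneg in \<open>auto simp: dist_norm\<close>)
  then have "continuous_on S (total j)" by (rule lipschitz_on_continuous_on)
  then show ?thesis unfolding dual_def by (intro continuous_intros) auto
qed

lemma compact_B: "compact B"
  unfolding compact_eq_bounded_closed bounded_iff using closed_B norm_B by blast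

lemma dual_bdd_below: "bdd_below (dual j b ` B)"
  by (intro bounded_imp_bdd_below compact_imp_bounded compact_continuous_image
      dual_continuous compact_B)

lemma fluid_le: "p \<in> B \<Longrightarrow> fluid j b \<le> dual j b p"
  unfolding fluid_def by (intro cINF_lower dual_bdd_below)

lemma fluid_ge: "(\<And>p. p \<in> B \<Longrightarrow> x \<le> dual j b p) \<Longrightarrow> x \<le> fluid j b"
  unfolding fluid_def using zero_B by (intro cINF_greatest) auto

lemma fluid_attained:
  obtains p where "p \<in> B" "fluid j b = dual j b p"
proof -
  obtain p where p: "p \<in> B" "\<forall>q\<in>B. dual j b p \<le> dual j b q"
    using continuous_attains_inf[OF compact_B _ dual_continuous] zero_B by blast
  then have "fluid j b = dual j b p"
    by (intro antisym fluid_le fluid_ge) auto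
  with p that show ?thesis by blast
qed

lemma fluid_le_time: "fluid j b \<le> ub * real (n - j)"
  using fluid_le[OF zero_B, of j b] total_le[of 0 j] by (simp add: dual_def)

lemma fluid_lipschitz: "\<bar>fluid j b - fluid j b'\<bar> \<le> R * norm (b - b')"
proof -
  have *: "fluid j b \<le> fluid j b' + R * norm (b - b')" for b b'
  proof -
    obtain p where p: "p \<in> B" "fluid j b' = dual j b' p" by (rule fluid_attained)
    have "(b - b') \<bullet> p \<le> norm (b - b') * norm p" by (rule norm_cauchy_schwarz)
    also have "\<dots> \<le> norm (b - b') * R" by (intro mult_left_mono norm_B p) auto
    finally have "dual j b p \<le> dual j b' p + R * norm (b - b')"
      by (simp add: dual_def inner_diff_left mult.commute)
    with fluid_le[OF p(1), of j b] p(2) show ?thesis by simp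
  qed
  show ?thesis using *[of b b'] *[of b' b] by (simp add: norm_minus_commute)
qed

lemma fluid_continuous: "continuous_on S (fluid j)"
proof -
  have "R-lipschitz_on S (fluid j)"
    by (rule lipschitz_onI) (use fluid_lipschitz R_nonneg in \<open>auto simp: dist_norm\<close>)
  then show ?thesis by (rule lipschitz_on_continuous_on)
qed

lemma borel_measurable_fluid [measurable]: "fluid j \<in> borel_measurable borel"
  by (intro borel_measurable_continuous_onI fluid_continuous)

lemma total_expand:
  "total j q = total j p + (\<Sum>k\<in>{j+1..n}. consumption (\<mu> k) p) \<bullet> (p - q)
     + (\<Sum>k\<in>{j+1..n}. divergence (\<mu> k) q p)"
  unfolding total_def inner_sum_left sum.distrib[symmetric]
  by (intro sum.cong order_law.surplus_expand[OF law] refl)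

text \<open>
  The divergence is quadratically small near the minimiser, so the linear part of the expansion
  must be nonnegative in every feasible direction.
\<close>

lemma dual_ge_divergence:
  assumes p: "p \<in> B" "fluid j b = dual j b p" and q: "q \<in> B"
  shows "dual j b p + (\<Sum>k\<in>{j+1..n}. divergence (\<mu> k) q p) \<le> dual j b q"
proof -
  define l where "l = (b - (\<Sum>k\<in>{j+1..n}. consumption (\<mu> k) p)) \<bullet> (q - p)"
  define Q where "Q = real (n - j) * C1 * (norm (q - p))\<^sup>2"
  have exp: "dual j b q' = dual j b p
      + (b - (\<Sum>k\<in>{j+1..n}. consumption (\<mu> k) p)) \<bullet> (q' - p)
      + (\<Sum>k\<in>{j+1..n}. divergence (\<mu> k) q' p)" for q'
    unfolding dual_def using total_expand[of j q' p] by (simp add: inner_diff_left inner_diff_right)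
  have "0 \<le> l + t * Q" if t: "0 < t" "t \<le> 1" for t
  proof -
    let ?q = "p + t *\<^sub>R (q - p)"
    have "?q = (1 - t) *\<^sub>R p + t *\<^sub>R q" by (simp add: algebra_simps)
    then have qB: "?q \<in> B" using convexD_alt[OF convex_B p(1) q, of t] t by simp
    have "(\<Sum>k\<in>{j+1..n}. divergence (\<mu> k) ?q p) \<le> (\<Sum>k\<in>{j+1..n}. C1 * (norm (?q - p))\<^sup>2)"
      by (intro sum_mono divergence_upper nonneg_B p qB)
    also have "\<dots> = t\<^sup>2 * Q" using t by (simp add: Q_def power_mult_distrib)
    finally have div: "(\<Sum>k\<in>{j+1..n}. divergence (\<mu> k) ?q p) \<le> t\<^sup>2 * Q" .
    have "(b - (\<Sum>k\<in>{j+1..n}. consumption (\<mu> k) p)) \<bullet> (?q - p) = t * l"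
      unfolding l_def by simp
    with exp[of ?q] div fluid_le[OF qB, of j b] p(2) have "0 \<le> t * l + t\<^sup>2 * Q" by linarith
    then have "0 \<le> t * (l + t * Q)" by (simp add: ring_distribs power2_eq_square)
    then show ?thesis using t by (simp add: zero_le_mult_iff)
  qed note step = this
  have "((\<lambda>t. l + t * Q) \<longlongrightarrow> l + 0 * Q) (at_right 0)" by (intro tendsto_intros)
  moreover have "\<forall>\<^sub>F t in at_right 0. 0 \<le> l + t * Q"
    unfolding eventually_at_right_field using step by (intro exI[of _ 1]) auto
  ultimately have "0 \<le> l + 0 * Q"
    by (rule tendsto_lowerbound) simp
  then show ?thesis using exp[of q] l_def by linarith
qed

lemma dual_ge_quadratic:
  assumes p: "p \<in> B" "fluid j b = dual j b p" and q: "q \<in> B"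
  shows "dual j b p + \<kappa> * real (n - j) * (norm (q - p))\<^sup>2 \<le> dual j b q"
proof -
  have "(\<Sum>k\<in>{j+1..n}. \<kappa> * (norm (q - p))\<^sup>2) \<le> (\<Sum>k\<in>{j+1..n}. divergence (\<mu> k) q p)"
    by (intro sum_mono divergence_lower p q)
  with dual_ge_divergence[OF assms] show ?thesis by (simp add: mult_ac)
qed

text \<open>
  Strong convexity of the dual makes the fluid value smooth from below in the budget: consuming
  \<open>c\<close> instead of the expected amount costs the price of the difference plus a quadratic term.
\<close>

lemma fluid_step:
  assumes j: "Suc j < n" and p: "p \<in> B" "fluid j b = dual j b p" and c: "norm c \<le> M"
  shows "fluid j b - c \<bullet> p - surplus (\<mu> (Suc j)) p - M\<^sup>2 / (\<kappa> * real (n - Suc j))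
    \<le> fluid (Suc j) (b - c)"
proof (rule fluid_ge)
  fix q assume q: "q \<in> B"
  define r where "r = norm (q - p)"
  define N where "N = real (n - Suc j)"
  have N: "0 < N" using j by (simp add: N_def)
  let ?mu = "\<mu> (Suc j)"
  have "\<bar>(c - consumption ?mu p) \<bullet> (p - q)\<bar> \<le> norm (c - consumption ?mu p) * norm (p - q)"
    by (rule Cauchy_Schwarz_ineq2)
  also have "\<dots> \<le> (2 * M) * norm (p - q)"
    using norm_triangle_ineq4[of c "consumption ?mu p"] c
      order_law.norm_consumption_le[OF law, of "Suc j" p]
    by (intro mult_right_mono) auto
  finally have lin: "- (2 * M * r) \<le> (c - consumption ?mu p) \<bullet> (p - q)"
    by (simp add: r_def norm_minus_commute)
  \<comment> \<open>Completing the square: the quadratic growth contributed by the \<open>N\<close>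
    later orders absorbs the linear term at the cost
    \<open>M\<^sup>2 / (\<kappa> * N)\<close>.\<close>
  have "0 \<le> (\<kappa> * N * r - M)\<^sup>2 / (\<kappa> * N)" using kappa_pos N by simp
  also have "\<dots> = \<kappa> * N * r\<^sup>2 - 2 * M * r + M\<^sup>2 / (\<kappa> * N)"
    using kappa_pos N by (simp add: power2_diff field_simps power2_eq_square)
  finally have sq: "- (M\<^sup>2 / (\<kappa> * N)) \<le> \<kappa> * N * r\<^sup>2 - 2 * M * r" by simp
  have "(\<Sum>k\<in>{Suc j+1..n}. \<kappa> * r\<^sup>2) \<le> (\<Sum>k\<in>{Suc j+1..n}. divergence (\<mu> k) q p)"
    unfolding r_def by (intro sum_mono divergence_lower p q)
  then have div: "\<kappa> * N * r\<^sup>2 \<le> (\<Sum>k\<in>{Suc j+1..n}. divergence (\<mu> k) q p)"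
    by (simp add: N_def mult_ac)
  have "{j+1..n} = insert (Suc j) {Suc j+1..n}" using j by auto
  then have split: "(\<Sum>k\<in>{j+1..n}. divergence (\<mu> k) q p)
      = divergence ?mu q p + (\<Sum>k\<in>{Suc j+1..n}. divergence (\<mu> k) q p)" by simp
  \<comment> \<open>The divergence of order \<open>Suc j\<close> enters twice, in the growth of
    \<open>dual j b\<close> and in the expansion of its surplus at \<open>q\<close>, and cancels.
    This is why the growth is used with the individual divergences and not only with the quadratic
    bound.\<close>
  have "dual (Suc j) (b - c) q = dual j b q - c \<bullet> q - surplus ?mu q"
    using total_Suc[of j q] j by (simp add: dual_def inner_diff_left)
  moreover have "surplus ?mu q = surplus ?mu p + consumption ?mu p \<bullet> (p - q) + divergence ?mu q p"
    by (rule order_law.surplus_expand[OF law])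
  ultimately show "fluid j b - c \<bullet> p - surplus ?mu p - M\<^sup>2 / (\<kappa> * real (n - Suc j))
      \<le> dual (Suc j) (b - c) q"
    using dual_ge_divergence[OF p q] split lin sq div p(2)
    unfolding N_def[symmetric] by (simp add: inner_diff_left inner_diff_right)
qed

end

subsection \<open>The algorithm on a fixed sample\<close>

lemma borel_measurable_vec_nth' [measurable (raw)]:
  fixes f :: "'a \<Rightarrow> real ^ 'm::finite"
  assumes "f \<in> borel_measurable M"
  shows "(\<lambda>x. f x $ i) \<in> borel_measurable M"
  using measurable_compose[OF assms borel_measurable_nth[of i]] .

lemma pred_vec_le [measurable (raw)]:
  fixes f g :: "'a \<Rightarrow> real ^ 'm::finite"
  assumes [measurable]: "f \<in> borel_measurable M" "g \<in> borel_measurable M"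
  shows "Measurable.pred M (\<lambda>x. f x \<le> g x)"
  unfolding less_eq_vec_def by measurable

lemma borel_measurable_decision [measurable (raw)]:
  fixes q b :: "'a \<Rightarrow> real ^ 'm::finite"
  assumes [measurable]: "q \<in> borel_measurable M" "b \<in> borel_measurable M" "y \<in> borel_measurable M"
  shows "(\<lambda>x. decision (q x) (b x) (y x)) \<in> borel_measurable M"
  unfolding decision_def case_prod_beta by measurable

lemma decision_eq_accept:
  assumes "snd y \<le> a" "a \<le> b"
  shows "decision q b y = of_bool (fst y > snd y \<bullet> q)"
  using assms by (auto simp: decision_def case_prod_beta)

lemma decision_bounds: "0 \<le> decision q b y" "decision q b y \<le> 1"
  by (auto simp: decision_def case_prod_beta)

lemma price_cong:
  assumes "\<And>k. k \<in> {1..j} \<Longrightarrow> \<omega> k = \<omega>' k"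
  shows "price pr n j \<omega> s = price pr n j \<omega>' s"
proof -
  have "restrict \<omega> {1..j} = restrict \<omega>' {1..j}" using assms by auto
  then show ?thesis by (simp add: price_def)
qed

lemma budget_cong:
  "(\<And>k. k \<in> {1..j} \<Longrightarrow> \<omega> k = \<omega>' k) \<Longrightarrow> budget d0 pr n \<omega> s j = budget d0 pr n \<omega>' s j"
proof (induction j)
  case (Suc j)
  then have "budget d0 pr n \<omega> s j = budget d0 pr n \<omega>' s j" "price pr n j \<omega> s = price pr n j \<omega>' s"
    by (auto intro!: price_cong)
  with Suc show ?case by simp
qed simp

lemma offline_reward_le:
  fixes p :: "real ^ 'm::finite"
  assumes "0 \<le> p" "0 \<le> d0"
  shows "offline_reward d0 n \<omega>
    \<le> (real n *\<^sub>R d0) \<bullet> p + (\<Sum>k\<in>{1..n}. max 0 (fst (\<omega> k) - snd (\<omega> k) \<bullet> p))"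
  unfolding offline_reward_def
proof (rule cSup_least)
  have "0 \<le> real n *\<^sub>R d0" using assms(2) by (simp add: less_eq_vec_def)
  then show "{(\<Sum>j\<in>{1..n}. fst (\<omega> j) * x j) | x :: nat \<Rightarrow> real.
            (\<Sum>j\<in>{1..n}. x j *\<^sub>R snd (\<omega> j)) \<le> real n *\<^sub>R d0 \<and>
            (\<forall>j\<in>{1..n}. 0 \<le> x j \<and> x j \<le> 1)} \<noteq> {}"
    by (auto intro!: exI[of _ "\<lambda>_. 0"])
next
  fix z assume "z \<in> {(\<Sum>j\<in>{1..n}. fst (\<omega> j) * x j) | x :: nat \<Rightarrow> real.
            (\<Sum>j\<in>{1..n}. x j *\<^sub>R snd (\<omega> j)) \<le> real n *\<^sub>R d0 \<and>
            (\<forall>j\<in>{1..n}. 0 \<le> x j \<and> x j \<le> 1)}"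
  then obtain x :: "nat \<Rightarrow> real" where z: "z = (\<Sum>j\<in>{1..n}. fst (\<omega> j) * x j)"
    and feas: "(\<Sum>j\<in>{1..n}. x j *\<^sub>R snd (\<omega> j)) \<le> real n *\<^sub>R d0"
    and x: "\<And>j. j \<in> {1..n} \<Longrightarrow> 0 \<le> x j \<and> x j \<le> 1" by auto
  have "0 \<le> (real n *\<^sub>R d0 - (\<Sum>j\<in>{1..n}. x j *\<^sub>R snd (\<omega> j))) \<bullet> p"
    using feas assms(1) by (intro inner_nonneg_vec) auto
  then have cost: "(\<Sum>j\<in>{1..n}. x j * (snd (\<omega> j) \<bullet> p)) \<le> (real n *\<^sub>R d0) \<bullet> p"
    by (simp add: inner_diff_left inner_sum_left)
  have "z = (\<Sum>j\<in>{1..n}. x j * (snd (\<omega> j) \<bullet> p))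
      + (\<Sum>j\<in>{1..n}. x j * (fst (\<omega> j) - snd (\<omega> j) \<bullet> p))"
    unfolding z sum.distrib[symmetric] by (intro sum.cong) (auto simp: algebra_simps)
  also have "(\<Sum>j\<in>{1..n}. x j * (fst (\<omega> j) - snd (\<omega> j) \<bullet> p))
      \<le> (\<Sum>j\<in>{1..n}. max 0 (fst (\<omega> j) - snd (\<omega> j) \<bullet> p))"
  proof (intro sum_mono)
    fix j assume "j \<in> {1..n}"
    then have "x j * (fst (\<omega> j) - snd (\<omega> j) \<bullet> p) \<le> x j * max 0 (fst (\<omega> j) - snd (\<omega> j) \<bullet> p)"
      using x by (intro mult_left_mono) auto
    also have "\<dots> \<le> 1 * max 0 (fst (\<omega> j) - snd (\<omega> j) \<bullet> p)"
      using x \<open>j \<in> {1..n}\<close> by (intro mult_right_mono) auto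
    finally show "x j * (fst (\<omega> j) - snd (\<omega> j) \<bullet> p) \<le> max 0 (fst (\<omega> j) - snd (\<omega> j) \<bullet> p)" by simp
  qed
  finally show "z \<le> (real n *\<^sub>R d0) \<bullet> p + (\<Sum>k\<in>{1..n}. max 0 (fst (\<omega> k) - snd (\<omega> k) \<bullet> p))"
    using cost by linarith
qed

context order_sequence
begin

abbreviation P :: "'m path measure" where "P \<equiv> PiM {1..n} \<mu>"

definition good_order :: "'m order \<Rightarrow> bool" where
  "good_order y \<longleftrightarrow> 0 \<le> fst y \<and> fst y \<le> ub \<and> 0 \<le> snd y \<and> snd y \<le> vec \<alpha> \<and> norm (snd y) \<le> M"

lemma prob_space_law: "prob_space (\<mu> k)"
  using law[of k] by (simp add: order_law_def)

lemma sets_P: "sets P = sets (path_space n)"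
  unfolding path_space_def by (intro sets_PiM_cong order_law.sets_eq[OF law] refl)

lemma measurable_P: "borel_measurable P = borel_measurable (path_space n)"
  by (intro measurable_cong_sets sets_P refl)

lemma prob_space_PiM_law: "prob_space (PiM I \<mu>)"
  by (intro prob_space_PiM prob_space_law)

lemma measurable_order [measurable]:
  "k \<in> {1..n} \<Longrightarrow> (\<lambda>\<omega>. \<omega> k) \<in> borel_measurable (path_space n)"
  unfolding path_space_def by (rule measurable_component_singleton)

lemma AE_good_orders:
  assumes "finite I" shows "AE \<omega> in PiM I \<mu>. \<forall>k\<in>I. good_order (\<omega> k)"
proof (rule AE_finite_allI[OF assms])
  fix k assume "k \<in> I"
  show "AE \<omega> in PiM I \<mu>. good_order (\<omega> k)"
    using AE_PiM_component[OF prob_space_law \<open>k \<in> I\<close>, where P = good_order]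
      order_law.AE_order[OF law, of k] unfolding good_order_def by simp
qed

lemma integral_dual_sample:
  "integrable P (\<lambda>\<omega>. \<Sum>k\<in>{1..n}. max 0 (fst (\<omega> k) - snd (\<omega> k) \<bullet> p))"
  "(\<integral>\<omega>. (\<Sum>k\<in>{1..n}. max 0 (fst (\<omega> k) - snd (\<omega> k) \<bullet> p)) \<partial>P) = total 0 p"
proof -
  let ?g = "\<lambda>y :: 'm order. max 0 (fst y - snd y \<bullet> p)"
  have comp: "distr P (\<mu> k) (\<lambda>\<omega>. \<omega> k) = \<mu> k" if "k \<in> {1..n}" for k
    by (rule distr_PiM_component[OF prob_space_law that])
  have gm: "?g \<in> borel_measurable (\<mu> k)" for k
    unfolding measurable_cong_sets[OF order_law.sets_eq[OF law] refl] by measurable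
  have mk: "(\<lambda>\<omega>. \<omega> k) \<in> measurable P (\<mu> k)" if "k \<in> {1..n}" for k
    by (rule measurable_component_singleton[OF that])
  have int: "integrable P (\<lambda>\<omega>. ?g (\<omega> k))" if "k \<in> {1..n}" for k
    using order_law.integrable_pos_gain[OF law, of k p] integrable_distr_eq[OF mk[OF that] gm]
    unfolding comp[OF that] by simp
  then show "integrable P (\<lambda>\<omega>. \<Sum>k\<in>{1..n}. ?g (\<omega> k))"
    by (rule Bochner_Integration.integrable_sum)
  have "(\<integral>\<omega>. ?g (\<omega> k) \<partial>P) = surplus (\<mu> k) p" if "k \<in> {1..n}" for k
    using integral_distr[OF mk[OF that] gm] unfolding comp[OF that] surplus_def by simp
  then show "(\<integral>\<omega>. (\<Sum>k\<in>{1..n}. ?g (\<omega> k)) \<partial>P) = total 0 p"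
    unfolding total_def using int by (subst Bochner_Integration.integral_sum) auto
qed

end

text \<open>The sample \<open>s\<close> is frozen and only the orders are random.
  \<open>sample_deviation\<close> is the event on samples under which the regret is controlled;
  \<open>C0\<close> is the price of using a limit minimiser \<open>pstar\<close> for finitely many
  orders; \<open>room\<close> provides a neighbourhood, within the nonnegative prices, in which
  prices can be moved.\<close>

locale play = order_sequence n \<mu> \<alpha> M ub \<kappa> C1 c2 R B
  for n and \<mu> :: "nat \<Rightarrow> ('m::finite) order measure" and \<alpha> M ub \<kappa> C1 c2 R B +
  fixes d0 :: "real ^ 'm" and pr :: "'m price_rule" and s :: "'m path"
    and pstar :: "real ^ 'm" and \<delta> C0 E1 E2 :: real
  assumes n_ge: "3 \<le> n"
    and d0_nonneg: "0 \<le> d0"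
    and delta_pos: "0 < \<delta>"
    and E1_nonneg: "0 \<le> E1" and E2_nonneg: "0 \<le> E2"
    and pstar_B: "pstar \<in> B"
    and room: "\<And>q. 0 \<le> q \<Longrightarrow> norm (q - pstar) \<le> 2 * \<delta> \<Longrightarrow> q \<in> B"
    and near_optimal: "\<And>q. q \<in> B \<Longrightarrow> dual 0 (real n *\<^sub>R d0) pstar \<le> dual 0 (real n *\<^sub>R d0) q + C0"
    and price_argmin: "\<And>j \<omega>. j < n \<Longrightarrow> \<omega> \<in> nonneg_paths n \<Longrightarrow>
      is_arg_min (sample_dual (budget d0 pr n \<omega> s j) n j s) (\<lambda>q. 0 \<le> q) (price pr n j \<omega> s)"
    and price_measurable: "\<And>j. j < n \<Longrightarrow> (\<lambda>\<omega>. price pr n j \<omega> s) \<in> borel_measurable (path_space n)"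
    and sample_deviation: "\<And>j p q. j < n \<Longrightarrow> p \<in> B \<Longrightarrow> q \<in> B \<Longrightarrow>
      \<bar>((\<Sum>k\<in>{j+1..n}. max 0 (fst (s k) - snd (s k) \<bullet> p)) - total j p)
       - ((\<Sum>k\<in>{j+1..n}. max 0 (fst (s k) - snd (s k) \<bullet> q)) - total j q)\<bar>
      \<le> E1 * sqrt (real (n - j) * ln (real n)) * norm (p - q) + E2"
begin

text \<open>Chosen so that \<open>\<kappa> * E4 - E1 = E2 + \<kappa>\<close> and
  \<open>1 \<le> E4\<close>: at distance \<open>E4 * sqrt (ln n / N)\<close> the growth of the dual
  then exceeds the sampling error.\<close>

definition E4 :: real where "E4 = (E1 + E2 + \<kappa>) / \<kappa>"
text \<open>While \<open>N \<ge> K * ln n\<close>, the first entry keeps the price error within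
  \<open>\<delta>\<close>, the term \<open>2 * \<alpha> / c2\<close> protects the budget in
  \<open>alive_budget\<close>, and the summand 2 guarantees that two orders remain.\<close>

definition K :: real where "K = max (E4\<^sup>2 / \<delta>\<^sup>2) (2 * \<alpha> / c2 + 2)"
text \<open>The first entry keeps the fluid minimiser within \<open>\<delta>\<close> of
  \<open>pstar\<close>, the second keeps every resource in stock.\<close>

definition c :: real where "c = min (\<kappa> * \<delta>\<^sup>2) (c2 * \<delta> / 2)"
definition A :: real where "A = ub / c"

abbreviation b :: "nat \<Rightarrow> 'm path \<Rightarrow> real ^ 'm" where "b j \<omega> \<equiv> budget d0 pr n \<omega> s j"

definition gap :: "nat \<Rightarrow> 'm path \<Rightarrow> real" where
  "gap j \<omega> = dual j (b j \<omega>) pstar - fluid j (b j \<omega>)"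

definition alive :: "nat \<Rightarrow> 'm path \<Rightarrow> bool" where
  "alive j \<omega> \<longleftrightarrow> gap j \<omega> < c * real (n - j) \<and> K * ln (real n) \<le> real (n - j)"

definition running :: "nat \<Rightarrow> 'm path \<Rightarrow> bool" where
  "running j \<omega> \<longleftrightarrow> (\<forall>i\<in>{..j}. alive i \<omega>)"

definition reward :: "nat \<Rightarrow> 'm path \<Rightarrow> real" where
  "reward j \<omega> = (\<Sum>k\<in>{1..j}. fst (\<omega> k) * decision (price pr n (k - 1) \<omega> s) (b (k - 1) \<omega>) (\<omega> k))"

text \<open>Two readings matter: \<open>reward + fluid - A * gap\<close>, used at the stopping time,
  and \<open>(1 + A) * (reward + fluid) - A * (reward + dual)\<close> with the dual at
  \<open>pstar\<close>, used for the drift.\<close>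

definition potential :: "nat \<Rightarrow> 'm path \<Rightarrow> real" where
  "potential j \<omega> = reward j \<omega> + (1 + A) * fluid j (b j \<omega>) - A * dual j (b j \<omega>) pstar"

text \<open>The first term is the loss from the squared price error, the second the smoothness loss
  of \<open>fluid_step\<close>.\<close>

definition step_loss :: "nat \<Rightarrow> real" where
  "step_loss j = C1 * E4\<^sup>2 * ln (real n) / real (n - j) + M\<^sup>2 / (\<kappa> * real (n - Suc j))"

lemma ln_n: "1 \<le> ln (real n)"
proof -
  have "exp (1::real) \<le> 3" by (rule exp_le)
  also have "\<dots> \<le> real n" using n_ge by simp
  finally show ?thesis using n_ge by (simp add: ln_ge_iff)
qed

lemma c_pos: "0 < c" unfolding c_def using kappa_pos delta_pos c2_pos by simp
lemma A_nonneg: "0 \<le> A" unfolding A_def using ub_nonneg c_pos by simp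
lemma E4_pos: "1 \<le> E4" unfolding E4_def using kappa_pos E1_nonneg E2_nonneg by (simp add: field_simps)
lemma K_ge: "2 \<le> K" unfolding K_def using alpha_pos c2_pos by (simp add: le_max_iff_disj)

lemma step_loss_nonneg: "0 \<le> step_loss j"
  unfolding step_loss_def using C1_pos ln_n kappa_pos by (intro add_nonneg_nonneg) auto

lemma gap_nonneg: "0 \<le> gap j \<omega>"
  unfolding gap_def using fluid_le[OF pstar_B] by simp

lemma alive_time: "alive j \<omega> \<Longrightarrow> Suc j < n"
proof -
  assume "alive j \<omega>"
  then have "K * ln (real n) \<le> real (n - j)" by (simp add: alive_def)
  moreover have "2 * 1 \<le> K * ln (real n)" using K_ge ln_n by (intro mult_mono) auto
  ultimately have "2 \<le> real (n - j)" by simp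
  then show ?thesis by linarith
qed

text \<open>Quadratic growth makes the gap at least \<open>\<kappa> * N * |p - pstar|^2\<close>,
  while being alive caps it by \<open>\<kappa> * \<delta>^2 * N\<close>.\<close>

lemma alive_minimiser_near:
  assumes "alive j \<omega>" and p: "p \<in> B" "fluid j (b j \<omega>) = dual j (b j \<omega>) p"
  shows "norm (p - pstar) \<le> \<delta>"
proof -
  have N: "0 < real (n - j)" using alive_time[OF assms(1)] by simp
  have "\<kappa> * real (n - j) * (norm (pstar - p))\<^sup>2 \<le> gap j \<omega>"
    using dual_ge_quadratic[OF p pstar_B] by (simp add: gap_def p(2))
  also have "\<dots> \<le> \<kappa> * \<delta>\<^sup>2 * real (n - j)"
    using assms(1) N by (auto simp: alive_def c_def intro: order_trans less_imp_le mult_right_mono)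
  finally have "(norm (pstar - p))\<^sup>2 \<le> \<delta>\<^sup>2" using N kappa_pos by simp
  then show ?thesis using delta_pos by (simp add: norm_minus_commute)
qed

text \<open>Raising the price of a scarce resource by \<open>\<delta>\<close> would lower the dual:
  expected consumption saves at least \<open>c2 * \<delta> * N\<close>, while the budget term grows
  by at most \<open>\<alpha> * \<delta>\<close>. So the gap would be at least
  \<open>(c2 * N - \<alpha>) * \<delta>\<close>, which is too large for an alive state. Hence no
  order is refused for lack of stock.\<close>

lemma alive_budget:
  assumes "alive j \<omega>"
  shows "vec \<alpha> \<le> b j \<omega>"
  unfolding less_eq_vec_def
proof (rule allI, rule ccontr)
  fix i assume "\<not> vec \<alpha> $ i \<le> b j \<omega> $ i"
  then have small: "b j \<omega> $ i < \<alpha>" by simp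
  let ?q = "pstar + \<delta> *\<^sub>R axis i 1"
  define N where "N = real (n - j)"
  have "0 \<le> (axis i 1 :: real ^ 'm)" by (simp add: less_eq_vec_def axis_def)
  then have q: "?q \<in> B"
    using delta_pos nonneg_B[OF pstar_B]
    by (intro room add_nonneg_nonneg scaleR_nonneg_nonneg) (auto simp: norm_axis_1)
  have "N * (c2 * \<delta>) = (\<Sum>k\<in>{j+1..n}. c2 * \<delta>)" by (simp add: N_def)
  \<comment> \<open>Consumption is taken at the raised price: by convexity it bounds the whole
    decrease of the surplus from below.\<close>
  also have "\<dots> \<le> (\<Sum>k\<in>{j+1..n}. consumption (\<mu> k) ?q $ i * \<delta>)"
    using delta_pos by (intro sum_mono mult_right_mono consumption_lower q) auto
  also have "\<dots> = (\<Sum>k\<in>{j+1..n}. consumption (\<mu> k) ?q) \<bullet> (?q - pstar)"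
    by (simp add: inner_axis sum_distrib_left mult.commute)
  also have "\<dots> \<le> total j pstar - total j ?q"
  proof -
    have "0 \<le> (\<Sum>k\<in>{j+1..n}. divergence (\<mu> k) pstar ?q)"
      by (intro sum_nonneg order_law.divergence_nonneg[OF law])
    then show ?thesis using total_expand[of j pstar ?q] by linarith
  qed
  also have "\<dots> = dual j (b j \<omega>) pstar - dual j (b j \<omega>) ?q + b j \<omega> $ i * \<delta>"
    by (simp add: dual_def inner_add_right inner_axis)
  also have "\<dots> \<le> gap j \<omega> + \<alpha> * \<delta>"
    using fluid_le[OF q, of j "b j \<omega>"] mult_right_mono[of "b j \<omega> $ i" \<alpha> \<delta>] small delta_pos
    unfolding gap_def by linarith
  finally have 1: "N * (c2 * \<delta>) \<le> gap j \<omega> + \<alpha> * \<delta>" .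
  have 2: "gap j \<omega> < c2 * \<delta> / 2 * N"
    using assms alive_time[OF assms] unfolding alive_def c_def N_def
    by (smt (verit, best) min.cobounded2 mult_right_mono of_nat_0_le_iff)
  have "2 * \<alpha> / c2 * 1 \<le> K * ln (real n)"
    using K_ge ln_n alpha_pos c2_pos by (intro mult_mono) (auto simp: K_def)
  also have "\<dots> \<le> N" using assms by (simp add: alive_def N_def)
  finally have "2 * \<alpha> \<le> c2 * N" using c2_pos by (simp add: field_simps)
  then have "2 * \<alpha> * \<delta> \<le> c2 * N * \<delta>" using delta_pos by simp
  with 1 2 show False by (simp add: field_simps)
qed

text \<open>The price may be far away and outside \<open>B\<close>, so the comparison is made at the
  point \<open>p'\<close> of the segment at distance exactly \<open>\<rho>\<close> from
  \<open>p\<close>. There \<open>room\<close> applies since \<open>\<rho> \<le> \<delta>\<close>,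
  and by convexity the sample dual is still no larger than at \<open>p\<close>. The fluid dual,
  however, has grown by \<open>\<kappa> * N * \<rho>^2\<close>, more than the deviation bound
  allows.\<close>

lemma alive_price_near:
  assumes alive: "alive j \<omega>" and p: "p \<in> B" "fluid j (b j \<omega>) = dual j (b j \<omega>) p"
    and \<omega>: "\<omega> \<in> nonneg_paths n"
  shows "(norm (p - price pr n j \<omega> s))\<^sup>2 \<le> E4\<^sup>2 * ln (real n) / real (n - j)"
proof (rule ccontr)
  define q where "q = price pr n j \<omega> s"
  define N where "N = real (n - j)"
  define \<rho> where "\<rho> = E4 * sqrt (ln (real n) / N)"
  define t where "t = \<rho> / norm (q - p)"
  define p' where "p' = (1 - t) *\<^sub>R p + t *\<^sub>R q"
  define S where "S = (\<lambda>p. \<Sum>k\<in>{j+1..n}. max 0 (fst (s k) - snd (s k) \<bullet> p))"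
  have j: "j < n" using alive_time[OF alive] by simp
  then have N: "0 < N" by (simp add: N_def)
  have \<rho>: "0 < \<rho>" unfolding \<rho>_def using E4_pos ln_n N by simp
  have \<rho>2: "\<rho>\<^sup>2 = E4\<^sup>2 * ln (real n) / N"
    unfolding \<rho>_def using ln_n N by (simp add: power_mult_distrib)
  assume "\<not> ?thesis"
  then have "\<rho>\<^sup>2 < (norm (q - p))\<^sup>2"
    unfolding \<rho>2 by (simp add: q_def N_def norm_minus_commute)
  then have far: "\<rho> < norm (q - p)" by (rule power_less_imp_less_base) simp
  then have "0 < norm (q - p)" using \<rho> by linarith
  then have t: "0 < t" "t < 1" using \<rho> far by (simp_all add: t_def)
  have arg: "is_arg_min (sample_dual (b j \<omega>) n j s) (\<lambda>q. 0 \<le> q) q"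
    unfolding q_def by (rule price_argmin[OF j \<omega>])
  then have q: "0 \<le> q" "sample_dual (b j \<omega>) n j s q \<le> sample_dual (b j \<omega>) n j s p"
    using nonneg_B[OF p(1)] by (auto simp: is_arg_min_linorder)
  have "p' - p = t *\<^sub>R (q - p)" by (simp add: p'_def algebra_simps)
  then have dist: "norm (p' - p) = \<rho>"
    using \<open>0 < norm (q - p)\<close> \<rho> by (simp add: t_def)
  have "E4\<^sup>2 / \<delta>\<^sup>2 * ln (real n) \<le> K * ln (real n)"
    using ln_n by (intro mult_right_mono) (auto simp: K_def)
  also have "\<dots> \<le> N" using alive by (simp add: alive_def N_def)
  finally have "\<rho>\<^sup>2 \<le> \<delta>\<^sup>2" unfolding \<rho>2 using N delta_pos by (simp add: field_simps)
  then have "\<rho> \<le> \<delta>" using delta_pos by (simp add: power2_le_iff_abs_le)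
  then have "norm (p' - pstar) \<le> 2 * \<delta>"
    using norm_triangle_ineq[of "p' - p" "p - pstar"] dist alive_minimiser_near[OF alive p] by simp
  moreover have "0 \<le> p'"
    unfolding p'_def using t q nonneg_B[OF p(1)] by (intro add_nonneg_nonneg scaleR_nonneg_nonneg) auto
  ultimately have p': "p' \<in> B" by (intro room)
  have "S p' \<le> (\<Sum>k\<in>{j+1..n}. (1 - t) * max 0 (fst (s k) - snd (s k) \<bullet> p)
      + t * max 0 (fst (s k) - snd (s k) \<bullet> q))"
    unfolding S_def
  proof (intro sum_mono)
    fix k
    have "fst (s k) - snd (s k) \<bullet> p'
        = (1 - t) * (fst (s k) - snd (s k) \<bullet> p) + t * (fst (s k) - snd (s k) \<bullet> q)"
      unfolding p'_def by (simp add: inner_add_right algebra_simps)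
    also have "\<dots> \<le> (1 - t) * max 0 (fst (s k) - snd (s k) \<bullet> p)
        + t * max 0 (fst (s k) - snd (s k) \<bullet> q)"
      using t by (intro add_mono mult_left_mono) auto
    finally show "max 0 (fst (s k) - snd (s k) \<bullet> p') \<le> (1 - t) * max 0 (fst (s k) - snd (s k) \<bullet> p)
        + t * max 0 (fst (s k) - snd (s k) \<bullet> q)"
      using t by simp
  qed
  also have "\<dots> = (1 - t) * S p + t * S q"
    unfolding S_def by (simp add: sum.distrib sum_distrib_left)
  finally have "b j \<omega> \<bullet> p' + S p' \<le> (1 - t) * (b j \<omega> \<bullet> p + S p) + t * (b j \<omega> \<bullet> q + S q)"
    unfolding p'_def by (simp add: inner_add_right algebra_simps)
  also have "\<dots> \<le> (1 - t) * (b j \<omega> \<bullet> p + S p) + t * (b j \<omega> \<bullet> p + S p)"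
    using t q by (intro add_left_mono mult_left_mono) (auto simp: sample_dual_def S_def)
  finally have "b j \<omega> \<bullet> p' + S p' \<le> b j \<omega> \<bullet> p + S p" by (simp add: algebra_simps)
  moreover have "\<bar>(S p' - total j p') - (S p - total j p)\<bar>
      \<le> E1 * sqrt (N * ln (real n)) * \<rho> + E2"
    using sample_deviation[OF j p' p(1)] unfolding S_def N_def dist .
  moreover have "dual j (b j \<omega>) p + \<kappa> * N * \<rho>\<^sup>2 \<le> dual j (b j \<omega>) p'"
    using dual_ge_quadratic[OF p p'] unfolding dist N_def .
  ultimately have "\<kappa> * N * \<rho>\<^sup>2 \<le> E1 * (sqrt (N * ln (real n)) * \<rho>) + E2"
    unfolding dual_def by (simp add: mult.assoc)
  moreover have "sqrt (N * ln (real n)) * \<rho> = E4 * ln (real n)"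
  proof -
    have "sqrt (N * ln (real n)) * sqrt (ln (real n) / N) = sqrt ((ln (real n))\<^sup>2)"
      using N by (simp add: real_sqrt_mult[symmetric] power2_eq_square)
    then show ?thesis using ln_n unfolding \<rho>_def by simp
  qed
  moreover have "\<kappa> * N * \<rho>\<^sup>2 = \<kappa> * E4\<^sup>2 * ln (real n)" unfolding \<rho>2 using N by simp
  ultimately have "\<kappa> * E4\<^sup>2 * ln (real n) \<le> E1 * (E4 * ln (real n)) + E2" by simp
  then have "E4 * (\<kappa> * E4 - E1) * ln (real n) \<le> E2"
    by (simp add: algebra_simps power2_eq_square)
  moreover have "\<kappa> * E4 - E1 = E2 + \<kappa>" using kappa_pos by (simp add: E4_def)
  moreover have "1 * (E2 + \<kappa>) * 1 \<le> E4 * (E2 + \<kappa>) * ln (real n)"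
    using E4_pos E2_nonneg kappa_pos ln_n by (intro mult_mono) auto
  ultimately show False using kappa_pos by simp
qed


section \<open>Measurability and integrability of the play\<close>

lemma measurable_budget: "j \<le> n \<Longrightarrow> b j \<in> borel_measurable (path_space n)"
proof (induction j)
  case (Suc j)
  then have [measurable]: "b j \<in> borel_measurable (path_space n)"
    "(\<lambda>\<omega>. price pr n j \<omega> s) \<in> borel_measurable (path_space n)"
    "(\<lambda>\<omega>. \<omega> (Suc j)) \<in> borel_measurable (path_space n)"
    by (auto intro!: price_measurable measurable_order)
  show ?case by simp
qed simp

lemma measurable_reward: "j \<le> n \<Longrightarrow> reward j \<in> borel_measurable (path_space n)"
  unfolding reward_def
proof (intro borel_measurable_sum)
  fix k assume "j \<le> n" "k \<in> {1..j}"
  then have [measurable]: "b (k - 1) \<in> borel_measurable (path_space n)"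
    "(\<lambda>\<omega>. price pr n (k - 1) \<omega> s) \<in> borel_measurable (path_space n)"
    "(\<lambda>\<omega>. \<omega> k) \<in> borel_measurable (path_space n)"
    by (auto intro!: measurable_budget price_measurable measurable_order)
  show "(\<lambda>\<omega>. fst (\<omega> k) * decision (price pr n (k - 1) \<omega> s) (b (k - 1) \<omega>) (\<omega> k))
      \<in> borel_measurable (path_space n)"
    by measurable
qed

lemma measurable_potential: 
  assumes "j \<le> n" shows "potential j \<in> borel_measurable (path_space n)"
proof -
  note [measurable] = measurable_budget[OF assms] measurable_reward[OF assms]
  show ?thesis unfolding potential_def dual_def by measurable
qed

lemma pred_alive:
  assumes "j \<le> n" shows "Measurable.pred (path_space n) (alive j)"
proof -
  note [measurable] = measurable_budget[OF assms]
  show ?thesis unfolding alive_def gap_def dual_def by measurable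
qed

lemma pred_running:
  assumes "j \<le> n" shows "Measurable.pred (path_space n) (running j)"
  unfolding running_def using assms by (intro pred_intros_finite pred_alive) auto

lemma norm_budget_le:
  assumes "\<And>k. k \<in> {1..n} \<Longrightarrow> good_order (\<omega> k)" "j \<le> n"
  shows "norm (b j \<omega>) \<le> real n * norm d0 + real j * M"
  using assms(2)
proof (induction j)
  case (Suc j)
  let ?d = "decision (price pr n j \<omega> s) (b j \<omega>) (\<omega> (Suc j))"
  have "norm (b (Suc j) \<omega>) \<le> norm (b j \<omega>) + norm (?d *\<^sub>R snd (\<omega> (Suc j)))"
    unfolding budget.simps by (rule norm_triangle_ineq4)
  also have "norm (?d *\<^sub>R snd (\<omega> (Suc j))) \<le> 1 * M"
    unfolding norm_scaleR using assms(1)[of "Suc j"] Suc.prems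
    by (intro mult_mono) (auto simp: decision_bounds good_order_def)
  finally show ?case using Suc by (simp add: algebra_simps)
qed simp

lemma reward_bounds:
  assumes "\<And>k. k \<in> {1..n} \<Longrightarrow> good_order (\<omega> k)" "j \<le> n"
  shows "0 \<le> reward j \<omega>" "reward j \<omega> \<le> reward n \<omega>" "reward j \<omega> \<le> real n * ub"
proof -
  let ?r = "\<lambda>k. fst (\<omega> k) * decision (price pr n (k - 1) \<omega> s) (b (k - 1) \<omega>) (\<omega> k)"
  have r: "0 \<le> ?r k" "?r k \<le> ub * 1" if "k \<in> {1..n}" for k
    using assms(1)[OF that] ub_nonneg
    by (auto simp: good_order_def decision_bounds intro!: mult_nonneg_nonneg mult_mono simp del: mult_1_right)
  show "0 \<le> reward j \<omega>" unfolding reward_def using r assms(2) by (intro sum_nonneg) auto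
  show "reward j \<omega> \<le> reward n \<omega>" unfolding reward_def using r assms(2) by (intro sum_mono2) auto
  also have "reward n \<omega> \<le> (\<Sum>k\<in>{1..n}. ub * 1)" unfolding reward_def using r by (intro sum_mono) auto
  finally show "reward j \<omega> \<le> real n * ub" by simp
qed

lemma potential_bounded:
  assumes j: "j \<le> n"
  obtains D where "AE \<omega> in P. norm (potential j \<omega>) \<le> D"
proof
  let ?b = "real n * norm d0 + real j * M"
  let ?D = "real n * ub + (1 + A) * (\<bar>fluid j 0\<bar> + R * ?b) + A * (?b * norm pstar + \<bar>total j pstar\<bar>)"
  show "AE \<omega> in P. norm (potential j \<omega>) \<le> ?D"
    using AE_good_orders[of "{1..n}", OF finite_atLeastAtMost]
  proof eventually_elim
    fix \<omega> assume good: "\<forall>k\<in>{1..n}. good_order (\<omega> k)"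
    have b: "norm (b j \<omega>) \<le> ?b" using norm_budget_le[of \<omega> j] good j by blast
    have r: "\<bar>reward j \<omega>\<bar> \<le> real n * ub" using reward_bounds[of \<omega> j] good j by fastforce
    have "R * norm (b j \<omega> - 0) \<le> R * ?b" using b R_nonneg by (intro mult_left_mono) auto
    then have f: "\<bar>fluid j (b j \<omega>)\<bar> \<le> \<bar>fluid j 0\<bar> + R * ?b"
      using fluid_lipschitz[of j "b j \<omega>" 0] by linarith
    have "\<bar>b j \<omega> \<bullet> pstar\<bar> \<le> norm (b j \<omega>) * norm pstar" by (rule Cauchy_Schwarz_ineq2)
    also have "\<dots> \<le> ?b * norm pstar" using b by (intro mult_right_mono) auto
    finally have d: "\<bar>dual j (b j \<omega>) pstar\<bar> \<le> ?b * norm pstar + \<bar>total j pstar\<bar>"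
      unfolding dual_def by linarith
    have "\<bar>(1 + A) * fluid j (b j \<omega>)\<bar> \<le> (1 + A) * (\<bar>fluid j 0\<bar> + R * ?b)"
      unfolding abs_mult using f A_nonneg by (intro mult_mono) auto
    moreover have "\<bar>A * dual j (b j \<omega>) pstar\<bar> \<le> A * (?b * norm pstar + \<bar>total j pstar\<bar>)"
      unfolding abs_mult using d A_nonneg by (intro mult_mono) auto
    ultimately show "norm (potential j \<omega>) \<le> ?D" using r unfolding potential_def by simp
  qed
qed

lemma integrable_potential:
  assumes "j \<le> n" shows "integrable P (potential j)"
proof -
  interpret P: prob_space P by (rule prob_space_PiM_law)
  obtain D where "AE \<omega> in P. norm (potential j \<omega>) \<le> D" by (rule potential_bounded[OF assms])
  then show ?thesis
    by (rule P.integrable_const_bound) (simp only: measurable_P measurable_potential[OF assms])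
qed

lemma integrable_step:
  assumes j: "j < n"
  shows "integrable P (\<lambda>\<omega>. of_bool (running j \<omega>) * (potential (Suc j) \<omega> - potential j \<omega>))"
proof (rule Bochner_Integration.integrable_bound)
  show "integrable P (\<lambda>\<omega>. potential (Suc j) \<omega> - potential j \<omega>)"
    using j by (intro Bochner_Integration.integrable_diff integrable_potential) auto
  have [measurable]: "Measurable.pred (path_space n) (running j)"
    "potential j \<in> borel_measurable (path_space n)" "potential (Suc j) \<in> borel_measurable (path_space n)"
    using j by (auto intro!: pred_running measurable_potential)
  show "(\<lambda>\<omega>. of_bool (running j \<omega>) * (potential (Suc j) \<omega> - potential j \<omega>)) \<in> borel_measurable P"
    unfolding measurable_P by measurable
qed auto

end

subsection \<open>Drift of the potential and regret on a fixed sample\<close>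

text \<open>A function that is not integrable has integral 0, which respects a nonpositive lower
  bound. This and the next lemma spare the drift argument an integrability check for sections and
  inner integrals.\<close>

lemma (in prob_space) integral_ge_nonpos_const:
  fixes f :: "'a \<Rightarrow> real"
  assumes "c \<le> 0" "AE x in M. c \<le> f x"
  shows "c \<le> integral\<^sup>L M f"
proof (cases "integrable M f")
  case True
  then show ?thesis using integral_ge_const assms(2) by blast
next
  case False
  then show ?thesis using assms(1) by (simp add: not_integrable_integral_eq)
qed

lemma (in prob_space) integral_ge_nonpos:
  fixes f g :: "'a \<Rightarrow> real"
  assumes "integrable M g" "integral\<^sup>L M g \<le> 0" "AE x in M. g x \<le> f x"
  shows "integral\<^sup>L M g \<le> integral\<^sup>L M f"
proof (cases "integrable M f")
  case True
  then show ?thesis using assms integral_mono_AE by blast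
next
  case False
  then show ?thesis using assms(2) by (simp add: not_integrable_integral_eq)
qed

lemma harm_le_ln:
  assumes "0 < n" shows "(harm n :: real) \<le> ln (real n) + 1"
proof -
  have "harm (Suc (n - 1)) - ln (real (Suc (n - 1))) \<le> harm (Suc 0) - ln (real (Suc 0))"
    by (rule decseqD[OF decseq_harm_diff_ln]) simp
  then show ?thesis using assms by (simp add: harm_def)
qed

context play
begin

lemma running_cong:
  assumes "\<And>k. k \<in> {1..j} \<Longrightarrow> \<omega> k = \<omega>' k"
  shows "running j \<omega> = running j \<omega>'"
proof -
  have "b i \<omega> = b i \<omega>'" if "i \<le> j" for i
    using assms that by (intro budget_cong) auto
  then show ?thesis by (simp add: running_def alive_def gap_def)
qed

lemma reward_Suc:
  "reward (Suc j) \<omega> = reward j \<omega>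
    + fst (\<omega> (Suc j)) * decision (price pr n j \<omega> s) (b j \<omega>) (\<omega> (Suc j))"
  by (simp add: reward_def)

text \<open>Order \<open>Suc j\<close> is averaged with all other orders frozen, the later ones
  included. Budget, price and \<open>running\<close> at time \<open>j\<close> see only the first
  \<open>j\<close> orders, so in a product measure this replaces conditioning on the past, and
  Fubini in one coordinate suffices afterwards.\<close>

lemma conditional_drift:
  assumes j: "j < n" and x: "\<forall>k\<in>{1..n} - {Suc j}. good_order (x k)"
    and ext: "x \<in> extensional ({1..n} - {Suc j})"
  shows "- ((1 + A) * step_loss j)
    \<le> (\<integral>y. of_bool (running j (x(Suc j := y)))
        * (potential (Suc j) (x(Suc j := y)) - potential j (x(Suc j := y))) \<partial>\<mu> (Suc j))"
proof -
  interpret o: order_law "\<mu> (Suc j)" \<alpha> M ub by (rule law)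
  \<comment> \<open>The missing order is filled by a placeholder; \<open>(0, 0)\<close> keeps the
    path in \<open>nonneg_paths n\<close>, where the price is known to be a minimiser.\<close>
  define \<omega> where "\<omega> = x(Suc j := (0, 0))"
  let ?\<mu> = "\<mu> (Suc j)"
  have run: "running j (x(Suc j := y)) = running j \<omega>" for y
    unfolding \<omega>_def by (rule running_cong) auto
  have bud: "b j (x(Suc j := y)) = b j \<omega>" for y
    unfolding \<omega>_def by (rule budget_cong) auto
  have pri: "price pr n j (x(Suc j := y)) s = price pr n j \<omega> s" for y
    unfolding \<omega>_def by (rule price_cong) auto
  show ?thesis
  proof (cases "running j \<omega>")
    case False
    then show ?thesis unfolding run using step_loss_nonneg[of j] A_nonneg by simp
  next
    case True
    then have alive: "alive j \<omega>" by (simp add: running_def)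
    have \<omega>: "\<omega> \<in> nonneg_paths n"
      using x ext j by (auto simp: \<omega>_def nonneg_paths_def PiE_iff extensional_def good_order_def
          case_prod_beta mem_Times_iff)
    obtain p where p: "p \<in> B" "fluid j (b j \<omega>) = dual j (b j \<omega>) p" by (rule fluid_attained)
    define q where "q = price pr n j \<omega> s"
    define e where "e = M\<^sup>2 / (\<kappa> * real (n - Suc j))"
    define accept :: "'m order \<Rightarrow> real" where "accept = (\<lambda>y. of_bool (fst y > snd y \<bullet> q))"
    \<comment> \<open>A lower bound for the increment with a computable mean: the second part is
      centred, and the first has mean \<open>- (1 + A) * (divergence ?\<mu> p q + e)\<close>, since
      accepting at \<open>q\<close> what should be judged at \<open>p\<close> costs exactly the
      divergence.\<close>
    define H where "H = (\<lambda>y. (1 + A) * (accept y * (fst y - snd y \<bullet> p) - surplus ?\<mu> p - e)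
      - A * (max 0 (fst y - snd y \<bullet> pstar) - surplus ?\<mu> pstar))"
    have Sj: "Suc j < n" by (rule alive_time[OF alive])
    have drift: "H y \<le> potential (Suc j) (x(Suc j := y)) - potential j (x(Suc j := y))"
      if y: "good_order y" for y
    proof -
      have dec: "decision q (b j \<omega>) y = accept y"
        unfolding accept_def using y alive_budget[OF alive]
        by (intro decision_eq_accept) (auto simp: good_order_def)
      let ?c = "accept y *\<^sub>R snd y"
      have c: "norm ?c \<le> M" using y M_nonneg by (auto simp: accept_def good_order_def)
      have bS: "b (Suc j) (x(Suc j := y)) = b j \<omega> - ?c"
        by (simp add: bud pri q_def[symmetric] dec)
      have rS: "reward (Suc j) (x(Suc j := y)) = reward j (x(Suc j := y)) + fst y * accept y"
        unfolding reward_Suc bud pri q_def[symmetric] by (simp add: dec)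
      have f: "fluid j (b j \<omega>) - ?c \<bullet> p - surplus ?\<mu> p - e \<le> fluid (Suc j) (b j \<omega> - ?c)"
        unfolding e_def by (rule fluid_step[OF Sj p c])
      have d: "dual (Suc j) (b j \<omega> - ?c) pstar
          = dual j (b j \<omega>) pstar - accept y * (snd y \<bullet> pstar) - surplus ?\<mu> pstar"
        using total_Suc[OF j, of pstar] by (simp add: dual_def inner_diff_left)
      have pot: "potential (Suc j) (x(Suc j := y)) - potential j (x(Suc j := y))
          = fst y * accept y + (1 + A) * (fluid (Suc j) (b j \<omega> - ?c) - fluid j (b j \<omega>))
            + A * (accept y * (snd y \<bullet> pstar) + surplus ?\<mu> pstar)"
        unfolding potential_def rS bS bud d by (simp add: algebra_simps)
      have 1: "(1 + A) * (- (?c \<bullet> p) - surplus ?\<mu> p - e)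
          \<le> (1 + A) * (fluid (Suc j) (b j \<omega> - ?c) - fluid j (b j \<omega>))"
        using f A_nonneg by (intro mult_left_mono) auto
      have "accept y * (fst y - snd y \<bullet> pstar) \<le> max 0 (fst y - snd y \<bullet> pstar)"
        by (auto simp: accept_def)
      then have 2: "A * (accept y * (fst y - snd y \<bullet> pstar)) \<le> A * max 0 (fst y - snd y \<bullet> pstar)"
        using A_nonneg by (rule mult_left_mono)
      have "H y = fst y * accept y + (1 + A) * (- (?c \<bullet> p) - surplus ?\<mu> p - e)
          + A * (accept y * (snd y \<bullet> pstar) + surplus ?\<mu> pstar)
          + (A * (accept y * (fst y - snd y \<bullet> pstar)) - A * max 0 (fst y - snd y \<bullet> pstar))"
        unfolding H_def by (simp add: algebra_simps)
      with 1 2 pot show ?thesis by linarith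
    qed
    have intacc: "integrable ?\<mu> (\<lambda>y. accept y * (fst y - snd y \<bullet> p))"
      unfolding accept_def by (rule o.integrable_accept)
    have Hint: "integrable ?\<mu> H"
      unfolding H_def using intacc by simp
    have "integral\<^sup>L ?\<mu> H
        = (1 + A) * ((\<integral>y. accept y * (fst y - snd y \<bullet> p) \<partial>?\<mu>) - surplus ?\<mu> p - e)
          - A * ((\<integral>y. max 0 (fst y - snd y \<bullet> pstar) \<partial>?\<mu>) - surplus ?\<mu> pstar)"
      unfolding H_def using intacc by (simp add: o.prob_space)
    also have "\<dots> = - ((1 + A) * (divergence ?\<mu> p q + e))"
      unfolding accept_def o.integral_accept
      unfolding surplus_def[of ?\<mu> pstar] by (simp add: algebra_simps)
    finally have H: "integral\<^sup>L ?\<mu> H = - ((1 + A) * (divergence ?\<mu> p q + e))" .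
    have "e \<ge> 0" unfolding e_def using kappa_pos by simp
    then have "(1 + A) * (divergence ?\<mu> p q + e) \<ge> 0"
      using o.divergence_nonneg A_nonneg by (intro mult_nonneg_nonneg) auto
    then have "integral\<^sup>L ?\<mu> H \<le> 0" unfolding H by simp
    then have "integral\<^sup>L ?\<mu> H \<le> (\<integral>y. of_bool (running j (x(Suc j := y)))
        * (potential (Suc j) (x(Suc j := y)) - potential j (x(Suc j := y))) \<partial>?\<mu>)"
    proof (rule o.integral_ge_nonpos[OF Hint])
      show "AE y in ?\<mu>. H y \<le> of_bool (running j (x(Suc j := y)))
        * (potential (Suc j) (x(Suc j := y)) - potential j (x(Suc j := y)))"
        using o.AE_order
      proof eventually_elim
        case (elim y)
        then have "good_order y" by (simp add: good_order_def)
        from drift[OF this] show ?case unfolding run using True by simp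
      qed
    qed
    moreover have "divergence ?\<mu> p q + e \<le> step_loss j"
    proof -
      have "0 \<le> q" using price_argmin[OF j \<omega>] by (simp add: is_arg_min_def q_def)
      then have "divergence ?\<mu> p q \<le> C1 * (norm (p - q))\<^sup>2"
        by (rule divergence_upper[OF _ nonneg_B[OF p(1)]])
      also have "\<dots> \<le> C1 * (E4\<^sup>2 * ln (real n) / real (n - j))"
        unfolding q_def using C1_pos by (intro mult_left_mono alive_price_near[OF alive p \<omega>]) auto
      finally show ?thesis by (simp add: step_loss_def e_def)
    qed
    then have "(1 + A) * (divergence ?\<mu> p q + e) \<le> (1 + A) * step_loss j"
      using A_nonneg by (intro mult_left_mono) auto
    ultimately show ?thesis unfolding H by simp
  qed
qed

lemma expected_drift:
  assumes j: "j < n"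
  shows "- ((1 + A) * step_loss j)
    \<le> (\<integral>\<omega>. of_bool (running j \<omega>) * (potential (Suc j) \<omega> - potential j \<omega>) \<partial>P)"
proof -
  let ?I = "{1..n} - {Suc j}"
  interpret product_sigma_finite \<mu>
    unfolding product_sigma_finite_def
    using prob_space_law prob_space_imp_sigma_finite by blast
  interpret I: prob_space "PiM ?I \<mu>" by (rule prob_space_PiM_law)
  have ins: "{1..n} = insert (Suc j) ?I" using j by auto
  let ?h = "\<lambda>\<omega>. of_bool (running j \<omega>) * (potential (Suc j) \<omega> - potential j \<omega>)"
  have h: "integrable (PiM (insert (Suc j) ?I) \<mu>) ?h"
    using integrable_step[OF j] unfolding ins[symmetric] .
  have "- ((1 + A) * step_loss j) \<le> (\<integral>x. (\<integral>y. ?h (x(Suc j := y)) \<partial>\<mu> (Suc j)) \<partial>PiM ?I \<mu>)"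
  proof (rule I.integral_ge_nonpos_const)
    have "0 \<le> (1 + A) * step_loss j" using step_loss_nonneg A_nonneg by simp
    then show "- ((1 + A) * step_loss j) \<le> 0" by simp
    show "AE x in PiM ?I \<mu>. - ((1 + A) * step_loss j) \<le> (\<integral>y. ?h (x(Suc j := y)) \<partial>\<mu> (Suc j))"
      using AE_good_orders[of ?I, OF finite_Diff[OF finite_atLeastAtMost]] AE_space
    proof eventually_elim
      case (elim x)
      then show ?case by (intro conditional_drift[OF j]) (auto simp: space_PiM PiE_def)
    qed
  qed
  also have "\<dots> = integral\<^sup>L (PiM (insert (Suc j) ?I) \<mu>) ?h"
    by (rule product_integral_insert[symmetric, OF _ _ h]) auto
  finally show ?thesis unfolding ins[symmetric] .
qed

section \<open>Optional stopping at the first violation\<close>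

definition exit_time :: "'m path \<Rightarrow> nat" where
  "exit_time \<omega> = (LEAST j. \<not> alive j \<omega>)"

text \<open>Time \<open>n\<close> is never alive, since being alive requires two remaining orders;
  so the least violating time exists and is at most \<open>n\<close>.\<close>

lemma not_alive_exit: "\<not> alive (exit_time \<omega>) \<omega>"
  unfolding exit_time_def by (rule LeastI[of _ n]) (use alive_time[of n \<omega>] in auto)

lemma exit_time_le: "exit_time \<omega> \<le> n"
  unfolding exit_time_def by (rule Least_le) (use alive_time[of n \<omega>] in auto)

lemma running_iff: "running j \<omega> \<longleftrightarrow> j < exit_time \<omega>"
proof
  assume "running j \<omega>"
  then show "j < exit_time \<omega>"
    using not_alive_exit[of \<omega>] by (auto simp: running_def not_less[symmetric])
next
  assume "j < exit_time \<omega>"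
  then show "running j \<omega>"
    unfolding running_def exit_time_def by (meson atMost_iff le_less_trans not_less_Least)
qed

text \<open>Optional stopping in discrete form: the indicators extend the telescoping sum to the
  fixed range \<open>j < n\<close>, so that expectations can be taken term by term.\<close>

lemma stopped_potential:
  "potential (exit_time \<omega>) \<omega> = potential 0 \<omega>
    + (\<Sum>j<n. of_bool (running j \<omega>) * (potential (Suc j) \<omega> - potential j \<omega>))"
proof -
  have "(\<Sum>j<n. of_bool (running j \<omega>) * (potential (Suc j) \<omega> - potential j \<omega>))
      = (\<Sum>j<exit_time \<omega>. potential (Suc j) \<omega> - potential j \<omega>)"
    using exit_time_le[of \<omega>] by (intro sum.mono_neutral_cong_right) (auto simp: running_iff)
  also have "\<dots> = potential (exit_time \<omega>) \<omega> - potential 0 \<omega>"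
    by (rule sum_lessThan_telescope)
  finally show ?thesis by simp
qed

text \<open>
  The process stops either because little time is left, or because the gap is at least
  \<open>c\<close> times the remaining time; the weight \<open>A\<close> is chosen so that the gap then pays for
  the value that is still to be collected.
\<close>

lemma stopped_potential_le:
  assumes "\<And>k. k \<in> {1..n} \<Longrightarrow> good_order (\<omega> k)"
  shows "potential (exit_time \<omega>) \<omega> \<le> reward n \<omega> + ub * K * ln (real n)"
proof -
  define j where "j = exit_time \<omega>"
  have pot: "potential j \<omega> = reward j \<omega> + fluid j (b j \<omega>) - A * gap j \<omega>"
    unfolding potential_def gap_def by (simp add: algebra_simps)
  have r: "reward j \<omega> \<le> reward n \<omega>"
    unfolding j_def by (rule reward_bounds(2)[OF assms exit_time_le])
  have v: "fluid j (b j \<omega>) \<le> ub * real (n - j)" by (rule fluid_le_time)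
  have Ag: "0 \<le> A * gap j \<omega>" using A_nonneg gap_nonneg by simp
  from not_alive_exit[of \<omega>] consider "real (n - j) < K * ln (real n)" | "c * real (n - j) \<le> gap j \<omega>"
    unfolding alive_def j_def[symmetric] by linarith
  then show ?thesis
  proof cases
    case 1
    then have "ub * real (n - j) \<le> ub * (K * ln (real n))"
      using ub_nonneg by (intro mult_left_mono) auto
    then show ?thesis using pot r v Ag unfolding j_def by (simp add: mult.assoc)
  next
    case 2
    then have "A * (c * real (n - j)) \<le> A * gap j \<omega>" using A_nonneg by (rule mult_left_mono)
    then have "ub * real (n - j) \<le> A * gap j \<omega>" using c_pos by (simp add: A_def)
    moreover have "0 \<le> ub * K * ln (real n)" using ub_nonneg K_ge ln_n by simp
    ultimately show ?thesis using pot r v unfolding j_def by linarith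
  qed
qed

lemma sum_step_loss: "(\<Sum>j<n. step_loss j) \<le> 2 * (C1 * E4\<^sup>2 + M\<^sup>2 / \<kappa>) * (ln (real n))\<^sup>2"
proof -
  define l where "l = ln (real n)"
  have l: "1 \<le> l" unfolding l_def by (rule ln_n)
  have h: "(\<Sum>j<n. 1 / real (n - j)) = harm n"
  proof -
    have "(\<Sum>j<n. 1 / real (n - j)) = (\<Sum>k<n. 1 / real (Suc k))"
      by (rule sum.reindex_bij_witness[of _ "\<lambda>k. n - Suc k" "\<lambda>j. n - Suc j"]) (auto simp: Suc_diff_Suc)
    also have "\<dots> = harm n"
      unfolding harm_def by (rule sum.reindex_bij_witness[of _ "\<lambda>k. k - 1" Suc]) (auto simp: inverse_eq_divide)
    finally show ?thesis .
  qed
  \<comment> \<open>The term with \<open>j = n - 1\<close> is 1 / 0 = 0, so the shifted sum is the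
    harmonic sum without its last term.\<close>
  have h': "(\<Sum>j<n. 1 / real (n - Suc j)) \<le> harm n"
  proof -
    have "(\<Sum>j<n. 1 / real (n - Suc j)) = (\<Sum>k<n. 1 / real k)"
      by (rule sum.nat_diff_reindex)
    also have "\<dots> \<le> (\<Sum>k\<in>insert 0 {1..n}. 1 / real k)" by (intro sum_mono2) auto
    also have "\<dots> = harm n" by (simp add: harm_def inverse_eq_divide)
    finally show ?thesis .
  qed
  have hl: "harm n \<le> 2 * l" using harm_le_ln[of n] n_ge l by (simp add: l_def)
  have "(\<Sum>j<n. step_loss j) = C1 * E4\<^sup>2 * l * (\<Sum>j<n. 1 / real (n - j))
      + M\<^sup>2 / \<kappa> * (\<Sum>j<n. 1 / real (n - Suc j))"
    unfolding step_loss_def sum.distrib sum_distrib_left l_def by simp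
  also have "\<dots> \<le> C1 * E4\<^sup>2 * l * (2 * l) + M\<^sup>2 / \<kappa> * (2 * l)"
    using h h' hl C1_pos l kappa_pos by (intro add_mono mult_left_mono) auto
  also have "M\<^sup>2 / \<kappa> * (2 * l) \<le> M\<^sup>2 / \<kappa> * (2 * (l * l))"
    using l kappa_pos by (intro mult_left_mono) auto
  finally show ?thesis unfolding l_def[symmetric] by (simp add: algebra_simps power2_eq_square)
qed

text \<open>The summands account for the initial gap, the accumulated step losses, and the value of
  the last \<open>K * ln n\<close> orders.\<close>

definition regret_bound :: real where
  "regret_bound = (1 + A) * C0 + 2 * (1 + A) * (C1 * E4\<^sup>2 + M\<^sup>2 / \<kappa>) + ub * K"

lemma C0_nonneg: "0 \<le> C0" using near_optimal[OF pstar_B] by simp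

lemma regret_given_sample:
  "(\<integral>\<omega>. offline_reward d0 n \<omega> - algorithm_reward d0 pr n \<omega> s \<partial>P) \<le> regret_bound * (ln (real n))\<^sup>2"
proof -
  interpret P: prob_space P by (rule prob_space_PiM_law)
  let ?l = "ln (real n)"
  let ?Z = "real n *\<^sub>R d0"
  let ?h = "\<lambda>j \<omega>. of_bool (running j \<omega>) * (potential (Suc j) \<omega> - potential j \<omega>)"
  let ?S = "\<lambda>\<omega>. \<Sum>k\<in>{1..n}. max 0 (fst (\<omega> k) - snd (\<omega> k) \<bullet> pstar)"
  define pot0 where "pot0 = (1 + A) * fluid 0 ?Z - A * dual 0 ?Z pstar"
  have pot0: "potential 0 \<omega> = pot0" for \<omega>
    by (simp add: potential_def reward_def pot0_def)
  define V where "V = (\<lambda>\<omega>. \<Sum>j<n. ?h j \<omega>)"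
  define W where "W = ?S"
  \<comment> \<open>An integrable pathwise majorant of the regret: weak duality bounds the offline
    optimum by \<open>?Z \<bullet> pstar + W\<close>, and the stopped potential bounds the collected
    reward below by \<open>pot0 + V - ub * K * ?l\<close>. The constant parts combine in expectation
    to \<open>1 + A\<close> times the initial gap.\<close>
  define U where "U = (\<lambda>\<omega>. ?Z \<bullet> pstar + W \<omega> - pot0 - V \<omega> + ub * K * ?l)"
  have intV: "integrable P V"
    unfolding V_def by (intro Bochner_Integration.integrable_sum integrable_step) simp
  have intW: "integrable P W"
    unfolding W_def by (rule integral_dual_sample(1))
  have intU: "integrable P U" unfolding U_def using intV intW
    by (intro Bochner_Integration.integrable_add Bochner_Integration.integrable_diff P.integrable_const)
  have V: "integral\<^sup>L P V = (\<Sum>j<n. integral\<^sup>L P (?h j))"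
    unfolding V_def by (intro Bochner_Integration.integral_sum integrable_step) simp
  have W: "integral\<^sup>L P W = total 0 pstar"
    unfolding W_def by (rule integral_dual_sample(2))
  have "integral\<^sup>L P U = ?Z \<bullet> pstar + integral\<^sup>L P W - pot0 - integral\<^sup>L P V + ub * K * ?l"
    unfolding U_def using intV intW by (simp add: P.prob_space del: One_nat_def)
  also have "\<dots> = ?Z \<bullet> pstar + total 0 pstar - pot0 - (\<Sum>j<n. integral\<^sup>L P (?h j)) + ub * K * ?l"
    unfolding V W ..
  also have "\<dots> \<le> ?Z \<bullet> pstar + total 0 pstar - pot0 + (\<Sum>j<n. (1 + A) * step_loss j) + ub * K * ?l"
  proof -
    have "(\<Sum>j<n. - ((1 + A) * step_loss j)) \<le> (\<Sum>j<n. integral\<^sup>L P (?h j))"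
      using expected_drift by (intro sum_mono) auto
    then show ?thesis by (simp add: sum_negf)
  qed
  also have "\<dots> = (1 + A) * (dual 0 ?Z pstar - fluid 0 ?Z) + (1 + A) * (\<Sum>j<n. step_loss j) + ub * K * ?l"
    unfolding pot0_def dual_def by (simp add: algebra_simps sum_distrib_left)
  also have "\<dots> \<le> (1 + A) * C0 + (1 + A) * (2 * (C1 * E4\<^sup>2 + M\<^sup>2 / \<kappa>) * ?l\<^sup>2) + ub * K * ?l"
  proof -
    have "dual 0 ?Z pstar - C0 \<le> fluid 0 ?Z" by (rule fluid_ge) (use near_optimal in force)
    then show ?thesis using A_nonneg sum_step_loss by (intro add_mono mult_left_mono order_refl) auto
  qed
  also have "\<dots> \<le> regret_bound * ?l\<^sup>2"
  proof -
    have l2: "1 \<le> ?l\<^sup>2" "?l \<le> ?l\<^sup>2" using ln_n by (simp_all add: self_le_power)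
    have "(1 + A) * C0 * 1 \<le> (1 + A) * C0 * ?l\<^sup>2" using A_nonneg C0_nonneg l2 by (intro mult_left_mono) auto
    moreover have "ub * K * ?l \<le> ub * K * ?l\<^sup>2" using ub_nonneg K_ge l2 by (intro mult_left_mono) auto
    ultimately show ?thesis unfolding regret_bound_def by (simp add: algebra_simps add_divide_distrib)
  qed
  finally have U: "integral\<^sup>L P U \<le> regret_bound * ?l\<^sup>2" .
  show ?thesis
  \<comment> \<open>If the regret is not integrable, its integral is 0 by convention and the
    nonnegative bound holds; thus measurability of the offline optimum never has to be
    settled.\<close>
  proof (cases "integrable P (\<lambda>\<omega>. offline_reward d0 n \<omega> - algorithm_reward d0 pr n \<omega> s)")
    case True
    have "(\<integral>\<omega>. offline_reward d0 n \<omega> - algorithm_reward d0 pr n \<omega> s \<partial>P) \<le> integral\<^sup>L P U"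
    proof (rule integral_mono_AE[OF True intU])
      show "AE \<omega> in P. offline_reward d0 n \<omega> - algorithm_reward d0 pr n \<omega> s \<le> U \<omega>"
        using AE_good_orders[of "{1..n}", OF finite_atLeastAtMost]
      proof eventually_elim
        case (elim \<omega>)
        have "potential (exit_time \<omega>) \<omega> \<le> reward n \<omega> + ub * K * ?l"
          using elim by (intro stopped_potential_le) auto
        moreover have "offline_reward d0 n \<omega> \<le> ?Z \<bullet> pstar + ?S \<omega>"
          by (rule offline_reward_le[OF nonneg_B[OF pstar_B] d0_nonneg])
        moreover have "algorithm_reward d0 pr n \<omega> s = reward n \<omega>"
          by (simp add: algorithm_reward_def reward_def)
        ultimately show ?case
          unfolding U_def V_def W_def using stopped_potential[of \<omega>] pot0[of \<omega>] by linarith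
      qed
    qed
    then show ?thesis using U by simp
  next
    case False
    have "0 \<le> regret_bound"
      unfolding regret_bound_def
      using A_nonneg C0_nonneg C1_pos kappa_pos ub_nonneg K_ge by simp
    then show ?thesis using False by (simp add: not_integrable_integral_eq)
  qed
qed

end

subsection \<open>Uniform concentration of the sample dual\<close>

text \<open>Coordinates are rounded down to multiples of \<open>1 / n\<close>. The result may leave
  \<open>B\<close>; only its distance to \<open>p\<close> and the number of values matter.\<close>

definition grid_round :: "nat \<Rightarrow> real ^ 'm \<Rightarrow> real ^ ('m::finite)" where
  "grid_round n p = (\<chi> i. real (nat \<lfloor>real n * p $ i\<rfloor>) / real n)"

lemma norm_grid_round_le:
  fixes p :: "real ^ 'm::finite"
  assumes "0 < n" "0 \<le> p" shows "norm (p - grid_round n p) \<le> CARD('m) / real n"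
proof -
  have "norm (p - grid_round n p) \<le> (\<Sum>i\<in>UNIV. \<bar>(p - grid_round n p) $ i\<bar>)"
    by (rule norm_le_l1_cart)
  also have "\<dots> \<le> (\<Sum>i\<in>(UNIV :: 'm set). 1 / real n)"
  proof (intro sum_mono)
    fix i
    have "0 \<le> p $ i" using assms by (simp add: less_eq_vec_def)
    define k where "k = real (nat \<lfloor>real n * p $ i\<rfloor>)"
    have k: "k \<le> real n * p $ i" "real n * p $ i \<le> k + 1"
      using \<open>0 \<le> p $ i\<close> by (simp_all add: k_def of_nat_nat)
    have "(p - grid_round n p) $ i = (real n * p $ i - k) / real n"
      using assms(1) by (simp add: grid_round_def k_def diff_divide_distrib del: of_nat_nat)
    then show "\<bar>(p - grid_round n p) $ i\<bar> \<le> 1 / real n"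
      using k by (simp only: abs_divide abs_of_nat) (intro divide_right_mono; simp add: abs_le_iff)
  qed
  finally show ?thesis by simp
qed

lemma card_grid:
  fixes B :: "(real ^ 'm::finite) set"
  assumes "\<And>p. p \<in> B \<Longrightarrow> norm p \<le> R" "0 \<le> R"
  shows "finite (grid_round n ` B)" "real (card (grid_round n ` B)) \<le> (real n * R + 1) ^ CARD('m)"
proof -
  let ?k = "nat \<lfloor>real n * R\<rfloor>"
  let ?F = "(UNIV :: 'm set) \<rightarrow>\<^sub>E {..?k}"
  have sub: "grid_round n ` B \<subseteq> (\<lambda>f. \<chi> i. real (f i) / real n) ` ?F"
  proof
    fix g assume "g \<in> grid_round n ` B"
    then obtain p where p: "p \<in> B" "g = grid_round n p" by auto
    have "(\<lambda>i. nat \<lfloor>real n * p $ i\<rfloor>) \<in> ?F"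
    proof -
      have "p $ i \<le> R" for i
        using assms(1)[OF p(1)] component_le_norm_cart[of p i] by linarith
      then have "nat \<lfloor>real n * p $ i\<rfloor> \<le> ?k" for i
        by (intro nat_mono floor_mono mult_left_mono) auto
      then show ?thesis by (simp add: PiE_def Pi_def)
    qed
    then show "g \<in> (\<lambda>f. \<chi> i. real (f i) / real n) ` ?F"
      unfolding p(2) grid_round_def by (rule rev_image_eqI) simp
  qed
  have fin: "finite ?F" by (intro finite_PiE) auto
  then show "finite (grid_round n ` B)" by (rule finite_surj[OF _ sub])
  have "card (grid_round n ` B) \<le> card ((\<lambda>f. (\<chi> i. real (f i) / real n) :: real ^ 'm) ` ?F)"
    by (intro card_mono sub finite_imageI fin)
  also have "\<dots> \<le> card ?F" by (rule card_image_le[OF fin])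
  also have "\<dots> = (?k + 1) ^ CARD('m)" by (simp add: card_funcsetE)
  finally have "real (card (grid_round n ` B)) \<le> real ((?k + 1) ^ CARD('m))" by (rule of_nat_mono)
  also have "\<dots> \<le> (real n * R + 1) ^ CARD('m)"
    using assms(2) by (auto intro!: power_mono)
  finally show "real (card (grid_round n ` B)) \<le> (real n * R + 1) ^ CARD('m)" .
qed

text \<open>This is \<open>M * sqrt (2 * t)\<close> with \<open>t = 2 * m + 2\<close>: each
  Hoeffding event then has probability at most \<open>2 * n^(-t)\<close>, while a time and two grid
  points can be chosen in \<open>O(n^(2 * m + 1))\<close> ways, which leaves
  \<open>O(1 / n)\<close>.\<close>

definition grid_rate :: "real \<Rightarrow> nat \<Rightarrow> real" where
  "grid_rate M m = M * sqrt (4 * real m + 4)"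

text \<open>Rounding costs: the first term from the change of the distance between the prices, the
  second from the Lipschitz bound on the deviation at both of them.\<close>

definition grid_error :: "real \<Rightarrow> nat \<Rightarrow> real" where
  "grid_error M m = 2 * real m * grid_rate M m + 4 * M * real m"

definition grid_size :: "real \<Rightarrow> nat \<Rightarrow> real" where
  "grid_size R m = 2 * (R + 1) ^ (2 * m)"

context order_sequence
begin

definition sample_total :: "nat \<Rightarrow> 'm path \<Rightarrow> real ^ 'm \<Rightarrow> real" where
  "sample_total j s p = (\<Sum>k\<in>{j+1..n}. max 0 (fst (s k) - snd (s k) \<bullet> p))"

definition deviation :: "nat \<Rightarrow> 'm path \<Rightarrow> real ^ 'm \<Rightarrow> real" where
  "deviation j s p = sample_total j s p - total j p"

lemma M_pos: "0 < M"
proof -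
  have "c2 \<le> consumption (\<mu> 0) 0 $ (undefined :: 'm)" by (rule consumption_lower[OF zero_B])
  also have "\<dots> \<le> norm (consumption (\<mu> 0) 0)" using component_le_norm_cart abs_le_D1 by blast
  also have "\<dots> \<le> M" by (rule order_law.norm_consumption_le[OF law])
  finally show ?thesis using c2_pos by simp
qed

lemma distr_P_component: "k \<in> {1..n} \<Longrightarrow> distr P (\<mu> k) (\<lambda>\<omega>. \<omega> k) = \<mu> k"
  by (rule distr_PiM_component[OF prob_space_law])

lemma indep_vars_coordinates:
  assumes "0 < n" shows "prob_space.indep_vars P \<mu> (\<lambda>k \<omega>. \<omega> k) {1..n}"
proof -
  interpret P: prob_space P by (rule prob_space_PiM_law)
  have "distr P (PiM {1..n} \<mu>) (\<lambda>x. \<lambda>i\<in>{1..n}. x i) = distr P P (\<lambda>x. x)"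
    by (intro distr_cong) (auto simp: space_PiM PiE_def extensional_restrict)
  also have "\<dots> = P" by (rule distr_id)
  also have "P = (\<Pi>\<^sub>M i\<in>{1..n}. distr P (\<mu> i) (\<lambda>\<omega>. \<omega> i))"
    by (intro PiM_cong) (simp_all add: distr_P_component del: One_nat_def)
  finally show ?thesis
    using assms by (subst P.indep_vars_iff_distr_eq_PiM') auto
qed

text \<open>Hoeffding is applied to differences of surpluses at \<open>p\<close> and
  \<open>q\<close>, whose summands are bounded by \<open>M * norm (p - q)\<close>; this makes the
  deviation proportional to the distance of the prices. The threshold is tuned so that the exponent
  becomes \<open>- t * ln n\<close>.\<close>

lemma hoeffding_pair:
  assumes n: "3 \<le> n" and j: "j < n" and pq: "p \<noteq> q" and t: "0 \<le> t"
  shows "measure P {s \<in> space P. M * norm (p - q) * sqrt (2 * t * real (n - j) * ln (real n))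
      \<le> \<bar>deviation j s p - deviation j s q\<bar>} \<le> 2 * real n powr (- t)"
proof -
  interpret P: prob_space P by (rule prob_space_PiM_law)
  define r where "r = M * norm (p - q)"
  define N where "N = real (n - j)"
  define e where "e = r * sqrt (2 * t * N * ln (real n))"
  define X where "X = (\<lambda>k (s :: 'm path). max 0 (fst (s k) - snd (s k) \<bullet> p) - max 0 (fst (s k) - snd (s k) \<bullet> q))"
  have r: "0 < r" unfolding r_def using M_pos pq by simp
  have N: "0 < N" unfolding N_def using j by simp
  have l: "0 \<le> ln (real n)" using n by simp
  have gm: "(\<lambda>y. max 0 (fst y - snd y \<bullet> p)) \<in> borel_measurable (\<mu> k)" for k and p :: "real ^ 'm"
    unfolding measurable_cong_sets[OF order_law.sets_eq[OF law] refl] by measurable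
  have mk: "(\<lambda>\<omega>. \<omega> k) \<in> measurable P (\<mu> k)" if "k \<in> {1..n}" for k
    by (rule measurable_component_singleton[OF that])
  interpret H: Hoeffding_ineq P "{j+1..n}" X "\<lambda>_. - r" "\<lambda>_. r"
    "\<Sum>k\<in>{j+1..n}. P.expectation (X k)"
  proof (unfold_locales)
    have "P.indep_vars \<mu> (\<lambda>k \<omega>. \<omega> k) {j+1..n}"
      using n by (intro P.indep_vars_subset[OF indep_vars_coordinates]) auto
    then show "P.indep_vars (\<lambda>_. borel) X {j+1..n}"
      unfolding X_def
      by (rule P.indep_vars_compose2[where Y = "\<lambda>k y. max 0 (fst y - snd y \<bullet> p) - max 0 (fst y - snd y \<bullet> q)"])
        (intro borel_measurable_diff gm)
    fix k assume k: "k \<in> {j+1..n}"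
    show "AE s in P. X k s \<in> {- r..r}"
      using AE_good_orders[of "{1..n}", OF finite_atLeastAtMost]
    proof eventually_elim
      case (elim s)
      then have "norm (snd (s k)) \<le> M" using k by (auto simp: good_order_def)
      from order_law.pos_gain_lipschitz[OF law this, of "fst (s k)" p q]
      show ?case unfolding X_def r_def by (auto simp: abs_le_iff)
    qed
  qed auto
  have EX: "P.expectation (X k) = surplus (\<mu> k) p - surplus (\<mu> k) q" if "k \<in> {j+1..n}" for k
  proof -
    have k: "k \<in> {1..n}" using that by auto
    have "surplus (\<mu> k) p - surplus (\<mu> k) q
        = (\<integral>y. max 0 (fst y - snd y \<bullet> p) - max 0 (fst y - snd y \<bullet> q) \<partial>\<mu> k)"
      unfolding surplus_def
      by (intro Bochner_Integration.integral_diff[symmetric] order_law.integrable_pos_gain[OF law])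
    also have "\<dots> = (\<integral>y. max 0 (fst y - snd y \<bullet> p) - max 0 (fst y - snd y \<bullet> q) \<partial>distr P (\<mu> k) (\<lambda>\<omega>. \<omega> k))"
      unfolding distr_P_component[OF k] ..
    also have "\<dots> = P.expectation (X k)"
      unfolding X_def by (rule integral_distr[OF mk[OF k] borel_measurable_diff[OF gm gm]])
    finally show ?thesis by simp
  qed
  have dev: "deviation j s p - deviation j s q = (\<Sum>k\<in>{j+1..n}. X k s) - (\<Sum>k\<in>{j+1..n}. P.expectation (X k))" for s
    using EX unfolding deviation_def sample_total_def total_def X_def
    by (simp add: sum_subtractf)
  have "measure P {s \<in> space P. e \<le> \<bar>deviation j s p - deviation j s q\<bar>}
      \<le> 2 * exp (- 2 * e\<^sup>2 / (\<Sum>k\<in>{j+1..n}. (r - - r)\<^sup>2))"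
    unfolding dev
    by (rule H.Hoeffding_ineq_abs_ge) (use r N l t j in \<open>auto simp: e_def\<close>)
  also have "(\<Sum>k\<in>{j+1..n}. (r - - r)\<^sup>2) = N * (4 * r\<^sup>2)"
    by (simp add: N_def power2_eq_square)
  also have "- 2 * e\<^sup>2 / (N * (4 * r\<^sup>2)) = - t * ln (real n)"
    using N r t l by (simp add: e_def power_mult_distrib)
  also have "exp (- t * ln (real n)) = real n powr (- t)" using n by (simp add: powr_def)
  finally show ?thesis unfolding e_def r_def N_def .
qed

definition good_sample :: "'m path \<Rightarrow> bool" where
  "good_sample s \<longleftrightarrow> (\<forall>k\<in>{1..n}. good_order (s k)) \<and>
    (\<forall>j\<in>{..<n}. \<forall>p\<in>grid_round n ` B. \<forall>q\<in>grid_round n ` B. p \<noteq> q \<longrightarrow>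
      \<bar>deviation j s p - deviation j s q\<bar>
        < grid_rate M CARD('m) * sqrt (real (n - j) * ln (real n)) * norm (p - q))"

lemma deviation_lipschitz:
  assumes "\<forall>k\<in>{1..n}. good_order (s k)" 
  shows "\<bar>deviation j s p - deviation j s q\<bar> \<le> 2 * real n * M * norm (p - q)"
proof -
  have "\<bar>sample_total j s p - sample_total j s q\<bar>
      \<le> (\<Sum>k\<in>{j+1..n}. \<bar>max 0 (fst (s k) - snd (s k) \<bullet> p) - max 0 (fst (s k) - snd (s k) \<bullet> q)\<bar>)"
    unfolding sample_total_def sum_subtractf[symmetric] by (rule sum_abs)
  also have "\<dots> \<le> (\<Sum>k\<in>{j+1..n}. M * norm (p - q))"
  proof (intro sum_mono order_law.pos_gain_lipschitz[OF law])
    fix k assume "k \<in> {j+1..n}"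
    then show "norm (snd (s k)) \<le> M" using assms by (auto simp: good_order_def)
  qed
  finally have "\<bar>sample_total j s p - sample_total j s q\<bar> \<le> real (n - j) * M * norm (p - q)" by simp
  then have "\<bar>deviation j s p - deviation j s q\<bar> \<le> 2 * (real (n - j) * M * norm (p - q))"
    using total_lipschitz[of j p q] unfolding deviation_def by linarith
  also have "\<dots> \<le> 2 * (real n * M * norm (p - q))"
    using M_pos by (intro mult_left_mono mult_right_mono) auto
  finally show ?thesis by simp
qed

text \<open>A grid spacing of \<open>1 / n\<close> is fine enough: the deviation has Lipschitz
  constant \<open>2 * n * M\<close>, and \<open>sqrt (N * ln n) \<le> n\<close>, so rounding both
  prices costs only a constant.\<close>

lemma good_sample_deviation:
  assumes n: "3 \<le> n" and s: "good_sample s" and j: "j < n" and p: "p \<in> B" and q: "q \<in> B"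
  shows "\<bar>deviation j s p - deviation j s q\<bar>
    \<le> grid_rate M CARD('m) * sqrt (real (n - j) * ln (real n)) * norm (p - q) + grid_error M CARD('m)"
proof -
  define N where "N = real (n - j)"
  define p' where "p' = grid_round n p"
  define q' where "q' = grid_round n q"
  define m where "m = real CARD('m)"
  have good: "\<forall>k\<in>{1..n}. good_order (s k)" using s by (simp add: good_sample_def)
  have n0: "0 < real n" using n by simp
  have G: "0 \<le> grid_rate M CARD('m)" unfolding grid_rate_def using M_pos by simp
  have pp: "norm (p - p') \<le> m / real n" "norm (q - q') \<le> m / real n"
    unfolding p'_def q'_def m_def using n by (intro norm_grid_round_le nonneg_B p q; simp)+
  have lip: "2 * real n * M * norm x \<le> 2 * M * m" if "norm x \<le> m / real n" for x :: "real ^ 'm"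
  proof -
    have "2 * real n * M * norm x \<le> 2 * real n * M * (m / real n)"
      using that M_pos n0 by (intro mult_left_mono) auto
    then show ?thesis using n0 by simp
  qed
  have "\<bar>deviation j s p' - deviation j s q'\<bar> \<le> grid_rate M CARD('m) * sqrt (N * ln (real n)) * norm (p' - q')"
    using s j p q unfolding good_sample_def p'_def q'_def N_def
    by (cases "grid_round n p = grid_round n q") (auto intro!: less_imp_le)
  also have "\<dots> \<le> grid_rate M CARD('m) * sqrt (N * ln (real n)) * (norm (p - q) + 2 * m / real n)"
  proof (intro mult_left_mono)
    have "norm ((p' - p) + ((p - q) + (q - q'))) \<le> norm (p' - p) + (norm (p - q) + norm (q - q'))"
      by (intro order_trans[OF norm_triangle_ineq] add_left_mono norm_triangle_ineq)
    moreover have "(p' - p) + ((p - q) + (q - q')) = p' - q'" by simp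
    ultimately have "norm (p' - q') \<le> norm (p' - p) + (norm (p - q) + norm (q - q'))" by simp
    then show "norm (p' - q') \<le> norm (p - q) + 2 * m / real n"
      using pp by (simp add: norm_minus_commute)
    show "0 \<le> grid_rate M CARD('m) * sqrt (N * ln (real n))" using G n N_def by simp
  qed
  also have "\<dots> \<le> grid_rate M CARD('m) * sqrt (N * ln (real n)) * norm (p - q) + 2 * m * grid_rate M CARD('m)"
  proof -
    have "N * ln (real n) \<le> real n * real n"
      using n unfolding N_def by (intro mult_mono) (auto intro: less_imp_le[OF ln_less_self])
    then have "sqrt (N * ln (real n)) \<le> sqrt (real n * real n)" by (rule real_sqrt_le_mono)
    then have "sqrt (N * ln (real n)) \<le> real n" by simp
    then have "grid_rate M CARD('m) * sqrt (N * ln (real n)) * (2 * m / real n) \<le> grid_rate M CARD('m) * real n * (2 * m / real n)"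
      using G n0 m_def by (intro mult_right_mono mult_left_mono) auto
    then show ?thesis using n0 by (simp add: algebra_simps)
  qed
  finally have "\<bar>deviation j s p' - deviation j s q'\<bar>
      \<le> grid_rate M CARD('m) * sqrt (N * ln (real n)) * norm (p - q) + 2 * m * grid_rate M CARD('m)" .
  moreover have "\<bar>deviation j s p - deviation j s p'\<bar> \<le> 2 * M * m"
    using deviation_lipschitz[OF good, of j p p'] lip[OF pp(1)] by linarith
  moreover have "\<bar>deviation j s q - deviation j s q'\<bar> \<le> 2 * M * m"
    using deviation_lipschitz[OF good, of j q q'] lip[OF pp(2)] by linarith
  ultimately show ?thesis unfolding grid_error_def N_def[symmetric] m_def[symmetric] by (simp add: algebra_simps)
qed

lemma borel_measurable_deviation:
  "(\<lambda>s. deviation j s p) \<in> borel_measurable P"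
  unfolding measurable_P deviation_def sample_total_def
proof (intro borel_measurable_diff borel_measurable_sum borel_measurable_const)
  fix k assume "k \<in> {j+1..n}"
  then have [measurable]: "(\<lambda>s. s k) \<in> borel_measurable (path_space n)"
    by (intro measurable_order) auto
  show "(\<lambda>s. max 0 (fst (s k) - snd (s k) \<bullet> p)) \<in> borel_measurable (path_space n)" by measurable
qed

text \<open>Union bound over times and pairs of distinct grid points. \<open>Z\<close> is a finite
  union of measurable events, and the null set of samples with irregular orders is left to the
  almost-everywhere statement.\<close>

lemma bad_sample_small:
  assumes n: "3 \<le> n"
  obtains Z where "Z \<in> sets P" "measure P Z \<le> grid_size R CARD('m) / real n"
    "AE s in P. s \<notin> Z \<longrightarrow> good_sample s"
proof -
  interpret P: prob_space P by (rule prob_space_PiM_law)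
  define m where "m = CARD('m)"
  define \<Gamma> where "\<Gamma> = grid_round n ` B"
  define T where "T = {(j, p, q). j < n \<and> p \<in> \<Gamma> \<and> q \<in> \<Gamma> \<and> p \<noteq> q}"
  define Bad where "Bad = (\<lambda>(j, p, q). {s \<in> space P.
      grid_rate M CARD('m) * sqrt (real (n - j) * ln (real n)) * norm (p - q) \<le> \<bar>deviation j s p - deviation j s q\<bar>})"
  define Z where "Z = (\<Union>x\<in>T. Bad x)"
  have fin\<Gamma>: "finite \<Gamma>" unfolding \<Gamma>_def by (rule card_grid(1)[OF norm_B R_nonneg])
  have sub: "T \<subseteq> {..<n} \<times> \<Gamma> \<times> \<Gamma>" by (auto simp: T_def)
  have finT: "finite T" by (rule finite_subset[OF sub]) (simp add: fin\<Gamma>)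
  have "card T \<le> card ({..<n} \<times> \<Gamma> \<times> \<Gamma>)" by (intro card_mono sub) (simp add: fin\<Gamma>)
  then have "real (card T) \<le> real n * (real (card \<Gamma>) * real (card \<Gamma>))"
    by (simp add: card_cartesian_product flip: of_nat_mult)
  also have "\<dots> \<le> real n * ((real n * R + 1) ^ m * (real n * R + 1) ^ m)"
    unfolding m_def \<Gamma>_def using card_grid(2)[OF norm_B R_nonneg, where n = n] R_nonneg
    by (intro mult_left_mono mult_mono) auto
  also have "\<dots> = real n * (real n * R + 1) ^ (2 * m)" by (simp add: power_add[symmetric] mult_2)
  also have "\<dots> \<le> real n * (real n * (R + 1)) ^ (2 * m)"
    using n R_nonneg by (intro mult_left_mono power_mono) (auto simp: algebra_simps)
  also have "\<dots> = real n ^ (2 * m + 1) * (R + 1) ^ (2 * m)" by (simp add: power_mult_distrib)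
  finally have cardT: "real (card T) \<le> real n ^ (2 * m + 1) * (R + 1) ^ (2 * m)" .
  have Bsets: "Bad x \<in> sets P" for x
  proof -
    note [measurable] = borel_measurable_deviation
    show ?thesis unfolding Bad_def by (cases x) (simp del: One_nat_def, measurable)
  qed
  have Zs: "Z \<in> sets P" unfolding Z_def using finT Bsets by blast
  have rate: "grid_rate M CARD('m) * sqrt (real (n - j) * ln (real n)) * norm (p - q)
      = M * norm (p - q) * sqrt (2 * real (2 * m + 2) * real (n - j) * ln (real n))" for j p q
    unfolding grid_rate_def m_def by (simp add: real_sqrt_mult[symmetric] algebra_simps)
  have "measure P Z \<le> (\<Sum>x\<in>T. measure P (Bad x))"
    unfolding Z_def using finT Bsets by (intro P.finite_measure_subadditive_finite) auto
  also have "\<dots> \<le> (\<Sum>x\<in>T. 2 * real n powr (- real (2 * m + 2)))"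
  proof (intro sum_mono)
    fix x assume "x \<in> T"
    then obtain j p q where x: "x = (j, p, q)" "j < n" "p \<noteq> q" by (auto simp: T_def)
    show "measure P (Bad x) \<le> 2 * real n powr (- real (2 * m + 2))"
      unfolding x(1) Bad_def prod.case rate by (rule hoeffding_pair[OF n x(2,3)]) simp
  qed
  also have "\<dots> = real (card T) * (2 / real n ^ (2 * m + 2))"
  proof -
    have "real n powr (- real (2 * m + 2)) = inverse (real n ^ (2 * m + 2))"
      unfolding powr_minus using n by (subst powr_realpow) auto
    then show ?thesis by (simp only: sum_constant) (simp add: divide_inverse)
  qed
  also have "\<dots> \<le> real n ^ (2 * m + 1) * (R + 1) ^ (2 * m) * (2 / real n ^ (2 * m + 2))"
    by (intro mult_right_mono cardT) auto
  also have "\<dots> = grid_size R CARD('m) / real n" using n by (simp add: grid_size_def m_def field_simps)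
  finally have small: "measure P Z \<le> grid_size R CARD('m) / real n" .
  have "AE s in P. s \<notin> Z \<longrightarrow> good_sample s"
    using AE_good_orders[of "{1..n}", OF finite_atLeastAtMost] AE_space
  proof eventually_elim
    case (elim s)
    show ?case
    proof
      assume "s \<notin> Z"
      then have "s \<notin> Bad (j, p, q)" if "j < n" "p \<in> \<Gamma>" "q \<in> \<Gamma>" "p \<noteq> q" for j p q
        using that unfolding Z_def T_def by blast
      then show "good_sample s"
        using elim unfolding good_sample_def Bad_def \<Gamma>_def by (auto simp: not_le)
    qed
  qed
  with Zs small that show ?thesis by blast
qed

end

subsection \<open>Averaging over the sample\<close>

context order_sequence
begin

lemma price_rule_measurable:
  assumes alg: "single_sample_algorithm d0 pr" and j: "j < n" and s: "s \<in> space (path_space n)"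
  shows "(\<lambda>\<omega>. price pr n j \<omega> s) \<in> borel_measurable (path_space n)"
proof -
  have pr: "(\<lambda>(h, s). pr n j h s) \<in> path_space j \<Otimes>\<^sub>M path_space n \<rightarrow>\<^sub>M borel"
    using alg j by (simp add: single_sample_algorithm_def)
  have "(\<lambda>\<omega>. restrict \<omega> {1..j}) \<in> path_space n \<rightarrow>\<^sub>M path_space j"
    unfolding path_space_def using j by (intro measurable_restrict_subset) auto
  then have "(\<lambda>\<omega>. (restrict \<omega> {1..j}, s)) \<in> path_space n \<rightarrow>\<^sub>M path_space j \<Otimes>\<^sub>M path_space n"
    by (rule measurable_Pair[OF _ measurable_const[OF s]])
  from measurable_compose[OF this pr] show ?thesis by (simp add: price_def)
qed

lemma good_orders_nonneg_path:
  assumes "s \<in> space P" "\<forall>k\<in>{1..n}. good_order (s k)"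
  shows "s \<in> nonneg_paths n"
  using assms
  by (auto simp: nonneg_paths_def good_order_def space_PiM PiE_def Pi_def case_prod_beta mem_Times_iff)

lemma regret_any_sample:
  assumes d0: "0 \<le> d0"
  shows "(\<integral>\<omega>. offline_reward d0 n \<omega> - algorithm_reward d0 pr n \<omega> s \<partial>P) \<le> real n * ub"
proof (cases "integrable P (\<lambda>\<omega>. offline_reward d0 n \<omega> - algorithm_reward d0 pr n \<omega> s)")
  case True
  interpret P: prob_space P by (rule prob_space_PiM_law)
  have "(\<integral>\<omega>. offline_reward d0 n \<omega> - algorithm_reward d0 pr n \<omega> s \<partial>P) \<le> (\<integral>\<omega>. real n * ub \<partial>P)"
  proof (rule integral_mono_AE[OF True P.integrable_const])
    show "AE \<omega> in P. offline_reward d0 n \<omega> - algorithm_reward d0 pr n \<omega> s \<le> real n * ub"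
      using AE_good_orders[of "{1..n}", OF finite_atLeastAtMost]
    proof eventually_elim
      case (elim \<omega>)
      have "offline_reward d0 n \<omega> \<le> (\<Sum>k\<in>{1..n}. max 0 (fst (\<omega> k)))"
        using offline_reward_le[OF order_refl d0, of n \<omega>] by simp
      also have "\<dots> \<le> (\<Sum>k\<in>{1..n}. ub)"
        using elim by (intro sum_mono) (auto simp: good_order_def)
      finally have "offline_reward d0 n \<omega> \<le> real n * ub" by simp
      moreover have "0 \<le> algorithm_reward d0 pr n \<omega> s"
        unfolding algorithm_reward_def using elim
        by (intro sum_nonneg mult_nonneg_nonneg decision_bounds) (auto simp: good_order_def)
      ultimately show ?case by simp
    qed
  qed
  then show ?thesis by (simp add: P.prob_space del: One_nat_def)
next
  case False
  then show ?thesis using ub_nonneg by (simp add: not_integrable_integral_eq)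
qed

text \<open>Fubini with the sample outermost. Off \<open>Z\<close> the bound for a fixed sample
  applies; on \<open>Z\<close> at most \<open>n * ub\<close> is lost, with probability
  \<open>O(1 / n)\<close>, so bad samples contribute a constant.\<close>

lemma regret_le:
  fixes PP :: "'m dist_seq"
  defines "E1 \<equiv> grid_rate M CARD('m)" and "E2 \<equiv> grid_error M CARD('m)"
  assumes n: "3 \<le> n" and d0: "0 \<le> d0" and delta: "0 < \<delta>" and pstar: "pstar \<in> B"
    and room: "\<And>q. 0 \<le> q \<Longrightarrow> norm (q - pstar) \<le> 2 * \<delta> \<Longrightarrow> q \<in> B"
    and near: "\<And>q. q \<in> B \<Longrightarrow> dual 0 (real n *\<^sub>R d0) pstar \<le> dual 0 (real n *\<^sub>R d0) q + C0"
    and alg: "single_sample_algorithm d0 pr" and PP: "PP n = P"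
  shows "regret d0 pr n PP
    \<le> (max 0 (play.regret_bound \<alpha> M ub \<kappa> C1 c2 \<delta> C0 E1 E2) + ub * grid_size R CARD('m)) * (ln (real n))\<^sup>2"
proof -
  interpret P: prob_space P by (rule prob_space_PiM_law)
  interpret PP: pair_sigma_finite P P ..
  let ?X = "\<lambda>\<omega> s. offline_reward d0 n \<omega> - algorithm_reward d0 pr n \<omega> s"
  \<comment> \<open>The sign of \<open>regret_bound\<close> is available only inside
    \<open>play\<close>, that is for a good sample; the maximum with 0 makes nonnegativity
    unconditional.\<close>
  define K where "K = max 0 (play.regret_bound \<alpha> M ub \<kappa> C1 c2 \<delta> C0 E1 E2)"
  let ?l = "ln (real n)"
  have E: "0 \<le> E1" "0 \<le> E2"
    unfolding E1_def E2_def grid_rate_def grid_error_def using M_nonneg by auto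
  have play: "play n \<mu> \<alpha> M ub \<kappa> C1 c2 R B d0 pr s pstar \<delta> C0 E1 E2"
    if s: "s \<in> space P" "good_sample s" for s
  proof (unfold_locales, goal_cases)
    case (9 j \<omega>)
    have "s \<in> nonneg_paths n"
      using s good_orders_nonneg_path by (auto simp: good_sample_def)
    then show ?case using alg 9 n by (simp add: single_sample_algorithm_def)
  next
    case (10 j)
    have "s \<in> space (path_space n)" using s(1) sets_eq_imp_space_eq[OF sets_P] by simp
    with 10 show ?case by (intro price_rule_measurable[OF alg])
  next
    case (11 j p q)
    show ?case
      using good_sample_deviation[OF n s(2) 11]
      unfolding deviation_def sample_total_def E1_def E2_def .
  qed (use n d0 delta E pstar room near in auto)
  obtain Z where Z: "Z \<in> sets P" "measure P Z \<le> grid_size R CARD('m) / real n"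
    "AE s in P. s \<notin> Z \<longrightarrow> good_sample s"
    by (rule bad_sample_small[OF n])
  have Kl: "0 \<le> K * ?l\<^sup>2" by (simp add: K_def)
  have l2: "1 \<le> ?l\<^sup>2"
  proof -
    have "exp (1::real) \<le> real n" using exp_le n by linarith
    then show ?thesis using n by (simp add: ln_ge_iff one_le_power)
  qed
  have "regret d0 pr n PP \<le> (K + ub * grid_size R CARD('m)) * ?l\<^sup>2"
  proof (cases "integrable (P \<Otimes>\<^sub>M P) (\<lambda>(\<omega>, s). ?X \<omega> s)")
    case True
    have "regret d0 pr n PP = (\<integral>s. (\<integral>\<omega>. ?X \<omega> s \<partial>P) \<partial>P)"
      unfolding regret_def PP by (rule PP.integral_snd[OF True, symmetric])
    also have "\<dots> \<le> (\<integral>s. K * ?l\<^sup>2 + real n * ub * indicator Z s \<partial>P)"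
    proof (rule integral_mono_AE)
      show "integrable P (\<lambda>s. \<integral>\<omega>. ?X \<omega> s \<partial>P)" by (rule PP.integrable_snd[OF True])
      show "integrable P (\<lambda>s. K * ?l\<^sup>2 + real n * ub * indicator Z s)"
        using Z(1) by (intro Bochner_Integration.integrable_add P.integrable_const
            integrable_mult_right integrable_real_indicator)
          (auto simp: less_top[symmetric] P.emeasure_finite simp del: One_nat_def)
      show "AE s in P. (\<integral>\<omega>. ?X \<omega> s \<partial>P) \<le> K * ?l\<^sup>2 + real n * ub * indicator Z s"
        using Z(3) AE_space
      proof eventually_elim
        case (elim s)
        show ?case
        proof (cases "s \<in> Z")
          case True
          then have "indicator Z s = (1 :: real)" by simp
          then show ?thesis using regret_any_sample[OF d0, of pr s] Kl by simp
        next
          case False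
          then have "(\<integral>\<omega>. ?X \<omega> s \<partial>P) \<le> play.regret_bound \<alpha> M ub \<kappa> C1 c2 \<delta> C0 E1 E2 * ?l\<^sup>2"
            using play.regret_given_sample[OF play[of s]] elim by simp
          also have "\<dots> \<le> K * ?l\<^sup>2" by (intro mult_right_mono) (auto simp: K_def)
          finally show ?thesis using False by simp
        qed
      qed
    qed
    also have "\<dots> = K * ?l\<^sup>2 + real n * ub * measure P Z"
      using Z(1) by (simp add: P.prob_space integrable_real_indicator less_top[symmetric] del: One_nat_def)
    also have "real n * ub * measure P Z \<le> real n * ub * (grid_size R CARD('m) / real n)"
      using Z(2) ub_nonneg by (intro mult_left_mono) auto
    also have "\<dots> = ub * grid_size R CARD('m) * 1" using n by simp
    also have "\<dots> \<le> ub * grid_size R CARD('m) * ?l\<^sup>2"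
      using l2 ub_nonneg R_nonneg by (intro mult_left_mono) (auto simp: grid_size_def)
    finally show ?thesis by (simp add: algebra_simps)
  next
    case False
    have "0 \<le> ub * grid_size R CARD('m) * ?l\<^sup>2"
      using ub_nonneg R_nonneg by (auto simp: grid_size_def)
    then show ?thesis using False Kl unfolding regret_def PP
      by (simp add: not_integrable_integral_eq algebra_simps)
  qed
  then show ?thesis unfolding K_def .
qed

end

subsection \<open>Orders with a conditional reward density\<close>

text \<open>The integrand is the distance of \<open>u\<close> to \<open>y\<close> between the two
  thresholds and 0 elsewhere. Reward densities between \<open>mu_lo\<close> and \<open>mu_hi\<close>
  therefore make the divergence comparable to a square.\<close>

lemma nn_integral_pos_part_gap:
  fixes x y :: real
  shows "(\<integral>\<^sup>+u. ennreal (max 0 (u - y) - of_bool (u > x) * (u - y)) \<partial>lborel) = ennreal ((x - y)\<^sup>2 / 2)"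
proof (cases "y \<le> x")
  case True
  have "(\<integral>\<^sup>+u. ennreal (max 0 (u - y) - of_bool (u > x) * (u - y)) \<partial>lborel)
      = (\<integral>\<^sup>+u. ennreal (u - y) * indicator {y..x} u \<partial>lborel)"
    using True by (intro nn_integral_cong) (auto simp: indicator_def)
  also have "\<dots> = ennreal ((x - y)\<^sup>2 / 2 - (y - y)\<^sup>2 / 2)"
    using True
    by (intro nn_integral_FTC_Icc[where F = "\<lambda>u. (u - y)\<^sup>2 / 2"])
       (auto intro!: derivative_eq_intros)
  finally show ?thesis by simp
next
  case False
  have "(\<integral>\<^sup>+u. ennreal (max 0 (u - y) - of_bool (u > x) * (u - y)) \<partial>lborel)
      = (\<integral>\<^sup>+u. ennreal (y - u) * indicator {x..y} u \<partial>lborel)"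
  \<comment> \<open>The two integrands differ at \<open>u = x\<close>, where the strict acceptance
    rule rejects.\<close>
  proof (intro nn_integral_cong_AE)
    show "AE u in lborel. ennreal (max 0 (u - y) - of_bool (u > x) * (u - y))
        = ennreal (y - u) * indicator {x..y} u"
      using AE_lborel_singleton[of x]
      by eventually_elim (use False in \<open>auto simp: indicator_def\<close>)
  qed
  also have "\<dots> = ennreal (- (y - y)\<^sup>2 / 2 - - (y - x)\<^sup>2 / 2)"
    using False
    by (intro nn_integral_FTC_Icc[where F = "\<lambda>u. - (y - u)\<^sup>2 / 2"])
       (auto intro!: derivative_eq_intros simp: field_simps)
  finally show ?thesis by (simp add: power2_commute)
qed

locale conditional_density = prob_space \<mu> for \<mu> :: "('m::finite) order measure" +
  fixes \<Xi> :: "(real ^ 'm) set" and \<alpha> ub mu_lo mu_hi :: real and \<phi> :: "real ^ 'm \<Rightarrow> real \<Rightarrow> real"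
  assumes sets_eq [measurable_cong, simp]: "sets \<mu> = sets borel"
    and Xi_meas [measurable]: "\<Xi> \<in> sets borel" and Xi_box: "\<Xi> \<subseteq> {0..vec \<alpha>}"
    and density_meas [measurable]:
      "(\<lambda>(a, u). ennreal (\<phi> a u) * indicator \<Xi> a * indicator {0..ub} u) \<in> borel_measurable (borel \<Otimes>\<^sub>M borel)"
    and density_lower: "\<And>a u. a \<in> \<Xi> \<Longrightarrow> u \<in> {0..ub} \<Longrightarrow> mu_lo \<le> \<phi> a u"
    and density_upper: "\<And>a u. a \<in> \<Xi> \<Longrightarrow> u \<in> {0..ub} \<Longrightarrow> \<phi> a u \<le> mu_hi"
    and mu_lo_pos: "0 < mu_lo" and mu_hi_pos: "0 < mu_hi"
    and law: "distr \<mu> (borel \<Otimes>\<^sub>M borel) (\<lambda>y. (snd y, fst y)) =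
      density (distr \<mu> borel snd \<Otimes>\<^sub>M lborel)
        (\<lambda>(a, u). ennreal (\<phi> a u) * indicator \<Xi> a * indicator {0..ub} u)"
begin

text \<open>Disintegration: the reward is integrated out with its conditional density. The outer
  integral can stay over \<open>\<mu>\<close> since it sees only \<open>snd y\<close>.\<close>

lemma nn_integral_order:
  assumes [measurable]: "h \<in> borel_measurable borel"
  shows "(\<integral>\<^sup>+y. h y \<partial>\<mu>)
    = (\<integral>\<^sup>+y. (\<integral>\<^sup>+u. ennreal (\<phi> (snd y) u) * indicator \<Xi> (snd y) * indicator {0..ub} u * h (u, snd y) \<partial>lborel) \<partial>\<mu>)"
proof -
  let ?Q = "distr \<mu> borel snd"
  let ?D = "\<lambda>(a, u). ennreal (\<phi> a u) * indicator \<Xi> a * indicator {0..ub} u"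
  have [measurable]: "(\<lambda>z :: (real ^ 'm) \<times> real. h (snd z, fst z)) \<in> borel_measurable (borel \<Otimes>\<^sub>M borel)"
    by (rule measurable_compose[of _ _ borel]) (auto simp: borel_prod)
  have D [measurable]: "?D \<in> borel_measurable (?Q \<Otimes>\<^sub>M lborel)"
    by (subst measurable_cong_sets[of _ "borel \<Otimes>\<^sub>M borel" borel borel]) 
       (auto intro!: sets_pair_measure_cong density_meas)
  have hQ [measurable]: "(\<lambda>z. h (snd z, fst z)) \<in> borel_measurable (?Q \<Otimes>\<^sub>M lborel)"
    by (subst measurable_cong_sets[of _ "borel \<Otimes>\<^sub>M borel" borel borel])
       (auto intro!: sets_pair_measure_cong)
  have m: "(\<lambda>z. ?D z * h (snd z, fst z)) \<in> borel_measurable (borel \<Otimes>\<^sub>M lborel)"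
    by (subst measurable_cong_sets[of _ "borel \<Otimes>\<^sub>M borel" borel borel])
       (auto intro!: sets_pair_measure_cong borel_measurable_times_ennreal density_meas)
  have "(\<integral>\<^sup>+y. h y \<partial>\<mu>) = (\<integral>\<^sup>+z. h (snd z, fst z) \<partial>distr \<mu> (borel \<Otimes>\<^sub>M borel) (\<lambda>y. (snd y, fst y)))"
    by (subst nn_integral_distr) auto
  also have "\<dots> = (\<integral>\<^sup>+z. ?D z * h (snd z, fst z) \<partial>(?Q \<Otimes>\<^sub>M lborel))"
    unfolding law by (rule nn_integral_density[OF D hQ])
  also have "\<dots> = (\<integral>\<^sup>+a. (\<integral>\<^sup>+u. ?D (a, u) * h (snd (a, u), fst (a, u)) \<partial>lborel) \<partial>?Q)"
    by (rule lborel.nn_integral_fst[symmetric]) measurable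
  also have "\<dots> = (\<integral>\<^sup>+y. (\<integral>\<^sup>+u. ?D (snd y, u) * h (u, snd y) \<partial>lborel) \<partial>\<mu>)"
    using lborel.borel_measurable_nn_integral_fst[OF m] by (subst nn_integral_distr) auto
  finally show ?thesis by simp
qed

lemma AE_support: "AE y in \<mu>. snd y \<in> \<Xi> \<and> 0 \<le> fst y \<and> fst y \<le> ub"
proof -
  let ?N = "{y :: 'm order. \<not> (snd y \<in> \<Xi> \<and> 0 \<le> fst y \<and> fst y \<le> ub)}"
  have [measurable]: "?N \<in> sets borel" by measurable
  have "emeasure \<mu> ?N = (\<integral>\<^sup>+y. indicator ?N y \<partial>\<mu>)" by simp
  also have "\<dots> = (\<integral>\<^sup>+y. (\<integral>\<^sup>+u. ennreal (\<phi> (snd y) u) * indicator \<Xi> (snd y) * indicator {0..ub} u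
      * indicator ?N (u, snd y) \<partial>lborel) \<partial>\<mu>)"
    by (rule nn_integral_order) measurable
  also have "\<dots> = (\<integral>\<^sup>+y. 0 \<partial>\<mu>)"
  proof (intro nn_integral_cong)
    fix y :: "'m order"
    have "(\<lambda>u. ennreal (\<phi> (snd y) u) * indicator \<Xi> (snd y) * indicator {0..ub} u
      * indicator ?N (u, snd y)) = (\<lambda>_. 0)" by (auto simp: indicator_def)
    then show "(\<integral>\<^sup>+u. ennreal (\<phi> (snd y) u) * indicator \<Xi> (snd y) * indicator {0..ub} u
      * indicator ?N (u, snd y) \<partial>lborel) = 0" by simp
  qed
  finally have "emeasure \<mu> ?N = 0" by simp
  then have "?N \<in> null_sets \<mu>" by (intro null_setsI) auto
  from AE_not_in[OF this] show ?thesis by simp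
qed

sublocale order_law \<mu> \<alpha> "\<alpha> * CARD('m)" ub
proof
  show "AE y in \<mu>. 0 \<le> fst y \<and> fst y \<le> ub \<and> 0 \<le> snd y \<and> snd y \<le> vec \<alpha> \<and> norm (snd y) \<le> \<alpha> * CARD('m)"
    using AE_support
  proof eventually_elim
    case (elim y)
    then have "snd y \<in> {0..vec \<alpha>}" using Xi_box by auto
    with elim norm_le_of_box[of "snd y" \<alpha>] show ?case by auto
  qed
qed simp

abbreviation quad :: "real ^ 'm \<Rightarrow> real" where
  "quad w \<equiv> (\<integral>y. (snd y \<bullet> w)\<^sup>2 \<partial>\<mu>)"

lemma AE_inner_bound: "AE y in \<mu>. \<bar>snd y \<bullet> w\<bar> \<le> \<alpha> * CARD('m) * norm w"
  using AE_norm
proof eventually_elim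
  case (elim y)
  have "\<bar>snd y \<bullet> w\<bar> \<le> norm (snd y) * norm w" by (rule Cauchy_Schwarz_ineq2)
  also have "\<dots> \<le> \<alpha> * CARD('m) * norm w" using elim by (intro mult_right_mono) auto
  finally show ?case .
qed

lemma AE_inner_square_bound: "AE y in \<mu>. (snd y \<bullet> w)\<^sup>2 \<le> (\<alpha> * CARD('m) * norm w)\<^sup>2"
  using AE_inner_bound[of w] 
proof eventually_elim
  case (elim y)
  then show ?case by (metis abs_ge_zero power2_abs power_mono)
qed

lemma integrable_square [simp]: "integrable \<mu> (\<lambda>y. (snd y \<bullet> w)\<^sup>2)"
  by (rule integrable_const_bound[where B = "(\<alpha> * CARD('m) * norm w)\<^sup>2"])
     (use AE_inner_square_bound in auto)

lemma quad_le: "quad w \<le> (\<alpha> * CARD('m) * norm w)\<^sup>2"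
proof -
  have "quad w \<le> (\<integral>y. (\<alpha> * CARD('m) * norm w)\<^sup>2 \<partial>\<mu>)"
    by (intro integral_mono_AE AE_inner_square_bound) auto
  then show ?thesis by (simp add: prob_space)
qed

lemma ennreal_divergence:
  "ennreal (divergence \<mu> q p) = (\<integral>\<^sup>+y. (\<integral>\<^sup>+u. ennreal (\<phi> (snd y) u) * indicator \<Xi> (snd y)
    * indicator {0..ub} u
    * ennreal (max 0 (u - snd y \<bullet> q) - of_bool (u > snd y \<bullet> p) * (u - snd y \<bullet> q)) \<partial>lborel) \<partial>\<mu>)"
proof -
  have "ennreal (divergence \<mu> q p) = (\<integral>\<^sup>+y. ennreal (max 0 (fst y - snd y \<bullet> q)
      - of_bool (fst y > snd y \<bullet> p) * (fst y - snd y \<bullet> q)) \<partial>\<mu>)"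
    unfolding divergence_def
    by (intro nn_integral_eq_integral[symmetric] Bochner_Integration.integrable_diff
        integrable_pos_gain integrable_accept) auto
  also have "\<dots> = (\<integral>\<^sup>+y. (\<integral>\<^sup>+u. ennreal (\<phi> (snd y) u) * indicator \<Xi> (snd y)
    * indicator {0..ub} u
    * ennreal (max 0 (fst (u, snd y) - snd (u, snd y) \<bullet> q)
      - of_bool (fst (u, snd y) > snd (u, snd y) \<bullet> p) * (fst (u, snd y) - snd (u, snd y) \<bullet> q)) \<partial>lborel) \<partial>\<mu>)"
    by (rule nn_integral_order) measurable
  finally show ?thesis by simp
qed

lemma divergence_le: "divergence \<mu> q p \<le> mu_hi / 2 * quad (p - q)"
proof -
  have "ennreal (divergence \<mu> q p) \<le> (\<integral>\<^sup>+y. ennreal (mu_hi / 2 * (snd y \<bullet> (p - q))\<^sup>2) \<partial>\<mu>)"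
    unfolding ennreal_divergence
  proof (intro nn_integral_mono)
    fix y :: "'m order"
    let ?g = "\<lambda>u. ennreal (max 0 (u - snd y \<bullet> q) - of_bool (u > snd y \<bullet> p) * (u - snd y \<bullet> q))"
    have "(\<integral>\<^sup>+u. ennreal (\<phi> (snd y) u) * indicator \<Xi> (snd y) * indicator {0..ub} u * ?g u \<partial>lborel)
        \<le> (\<integral>\<^sup>+u. ennreal mu_hi * ?g u \<partial>lborel)"
      using density_upper
      by (intro nn_integral_mono mult_right_mono) (auto simp: indicator_def intro!: ennreal_leI)
    also have "\<dots> = ennreal mu_hi * (\<integral>\<^sup>+u. ?g u \<partial>lborel)" by (rule nn_integral_cmult) measurable
    also have "\<dots> = ennreal (mu_hi / 2 * (snd y \<bullet> (p - q))\<^sup>2)"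
      unfolding nn_integral_pos_part_gap using mu_hi_pos
      by (simp add: ennreal_mult[symmetric] inner_diff_right)
    finally show "(\<integral>\<^sup>+u. ennreal (\<phi> (snd y) u) * indicator \<Xi> (snd y) * indicator {0..ub} u * ?g u \<partial>lborel)
        \<le> ennreal (mu_hi / 2 * (snd y \<bullet> (p - q))\<^sup>2)" .
  qed
  also have "\<dots> = ennreal (\<integral>y. mu_hi / 2 * (snd y \<bullet> (p - q))\<^sup>2 \<partial>\<mu>)"
    using mu_hi_pos by (intro nn_integral_eq_integral) auto
  finally show ?thesis using mu_hi_pos by (simp add: ennreal_le_iff)
qed

lemma divergence_upper_norm:
  "divergence \<mu> q p \<le> mu_hi / 2 * (\<alpha> * CARD('m))\<^sup>2 * (norm (q - p))\<^sup>2"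
proof -
  have "mu_hi / 2 * quad (p - q) \<le> mu_hi / 2 * (\<alpha> * CARD('m) * norm (p - q))\<^sup>2"
    using quad_le mu_hi_pos by (intro mult_left_mono) auto
  with divergence_le[of q p] show ?thesis
    by (simp add: power_mult_distrib norm_minus_commute mult.assoc)
qed

text \<open>With both thresholds inside the reward range, the whole interval between them carries
  density at least \<open>mu_lo\<close>.\<close>

lemma divergence_ge:
  assumes p: "\<And>a. a \<in> \<Xi> \<Longrightarrow> 0 \<le> a \<bullet> p \<and> a \<bullet> p \<le> ub" and q: "\<And>a. a \<in> \<Xi> \<Longrightarrow> 0 \<le> a \<bullet> q \<and> a \<bullet> q \<le> ub"
  shows "mu_lo / 2 * quad (p - q) \<le> divergence \<mu> q p"
proof -
  have "ennreal (mu_lo / 2 * quad (p - q)) = ennreal (\<integral>y. mu_lo / 2 * (snd y \<bullet> (p - q))\<^sup>2 \<partial>\<mu>)"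
    by simp
  also have "\<dots> = (\<integral>\<^sup>+y. ennreal (mu_lo / 2 * (snd y \<bullet> (p - q))\<^sup>2) \<partial>\<mu>)"
    using mu_lo_pos by (intro nn_integral_eq_integral[symmetric]) auto
  also have "\<dots> \<le> ennreal (divergence \<mu> q p)"
    unfolding ennreal_divergence
  proof (intro nn_integral_mono_AE)
    show "AE y in \<mu>. ennreal (mu_lo / 2 * (snd y \<bullet> (p - q))\<^sup>2)
      \<le> (\<integral>\<^sup>+u. ennreal (\<phi> (snd y) u) * indicator \<Xi> (snd y) * indicator {0..ub} u
          * ennreal (max 0 (u - snd y \<bullet> q) - of_bool (u > snd y \<bullet> p) * (u - snd y \<bullet> q)) \<partial>lborel)"
      using AE_support
    proof eventually_elim
      case (elim y)
      let ?g = "\<lambda>u. ennreal (max 0 (u - snd y \<bullet> q) - of_bool (u > snd y \<bullet> p) * (u - snd y \<bullet> q))"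
      have "ennreal (mu_lo / 2 * (snd y \<bullet> (p - q))\<^sup>2) = ennreal mu_lo * (\<integral>\<^sup>+u. ?g u \<partial>lborel)"
        unfolding nn_integral_pos_part_gap using mu_lo_pos
        by (simp add: ennreal_mult[symmetric] inner_diff_right)
      also have "\<dots> = (\<integral>\<^sup>+u. ennreal mu_lo * ?g u \<partial>lborel)"
        by (rule nn_integral_cmult[symmetric]) measurable
      also have "\<dots> \<le> (\<integral>\<^sup>+u. ennreal (\<phi> (snd y) u) * indicator \<Xi> (snd y) * indicator {0..ub} u * ?g u \<partial>lborel)"
      proof (intro nn_integral_mono)
        fix u
        show "ennreal mu_lo * ?g u
          \<le> ennreal (\<phi> (snd y) u) * indicator \<Xi> (snd y) * indicator {0..ub} u * ?g u"
        proof (cases "u \<in> {0..ub}")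
          case True
          then show ?thesis
            using elim density_lower by (intro mult_right_mono) (auto intro!: ennreal_leI)
        next
          case False
          \<comment> \<open>Outside the reward range \<open>u\<close> lies on the same side of both
            thresholds, so the two decisions agree.\<close>
          then have "?g u = 0" using p[of "snd y"] q[of "snd y"] elim by auto
          then show ?thesis by simp
        qed
      qed
      finally show ?case .
    qed
  qed
  finally show ?thesis using divergence_nonneg by (simp add: ennreal_le_iff)
qed

lemma consumption_nth: "consumption \<mu> p $ i = (\<integral>y. of_bool (fst y > snd y \<bullet> p) * snd y $ i \<partial>\<mu>)"
proof -
  have "consumption \<mu> p $ i = consumption \<mu> p \<bullet> axis i 1" by (simp add: inner_axis)
  also have "\<dots> = (\<integral>y. (of_bool (fst y > snd y \<bullet> p) *\<^sub>R snd y) \<bullet> axis i 1 \<partial>\<mu>)"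
    unfolding consumption_def by (rule integral_inner_left[symmetric]) simp
  finally show ?thesis by (simp add: inner_axis)
qed

text \<open>For every consumption vector \<open>a\<close> the accepted rewards fill an interval of
  length at least \<open>e\<close>, with density at least \<open>mu_lo\<close>.\<close>

lemma consumption_ge:
  assumes p: "\<And>a. a \<in> \<Xi> \<Longrightarrow> 0 \<le> a \<bullet> p \<and> a \<bullet> p \<le> ub - e" and e: "0 \<le> e"
  shows "mu_lo * e * (\<integral>y. snd y $ i \<partial>\<mu>) \<le> consumption \<mu> p $ i"
proof -
  have box: "0 \<le> a $ i" if "a \<in> \<Xi>" for a using that Xi_box by (auto simp: less_eq_vec_def)
  have [measurable]: "(\<lambda>y :: 'm order. snd y $ i) \<in> borel_measurable borel" by measurable
  have int1: "integrable \<mu> (\<lambda>y. snd y $ i)"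
    using integrable_inner_left[OF integrable_resource, of "axis i 1"] by (simp add: inner_axis)
  have int2: "integrable \<mu> (\<lambda>y. of_bool (fst y > snd y \<bullet> p) * snd y $ i)"
    by (rule Bochner_Integration.integrable_bound[OF int1]) auto
  have AEpos: "AE y in \<mu>. 0 \<le> snd y $ i" using AE_support by eventually_elim (use box in auto)
  have "ennreal (mu_lo * e * (\<integral>y. snd y $ i \<partial>\<mu>)) = ennreal (\<integral>y. mu_lo * e * (snd y $ i) \<partial>\<mu>)" by simp
  also have "\<dots> = (\<integral>\<^sup>+y. ennreal (mu_lo * e * (snd y $ i)) \<partial>\<mu>)"
    using mu_lo_pos e int1 AEpos by (intro nn_integral_eq_integral[symmetric]) auto
  also have "\<dots> \<le> (\<integral>\<^sup>+y. (\<integral>\<^sup>+u. ennreal (\<phi> (snd y) u) * indicator \<Xi> (snd y) * indicator {0..ub} u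
      * ennreal (of_bool (fst (u, snd y) > snd (u, snd y) \<bullet> p) * snd (u, snd y) $ i) \<partial>lborel) \<partial>\<mu>)"
  proof (intro nn_integral_mono_AE)
    show "AE y in \<mu>. ennreal (mu_lo * e * (snd y $ i))
      \<le> (\<integral>\<^sup>+u. ennreal (\<phi> (snd y) u) * indicator \<Xi> (snd y) * indicator {0..ub} u
        * ennreal (of_bool (fst (u, snd y) > snd (u, snd y) \<bullet> p) * snd (u, snd y) $ i) \<partial>lborel)"
      using AE_support
    proof eventually_elim
      case (elim y)
      define x where "x = snd y \<bullet> p"
      have x: "0 \<le> x" "x \<le> ub - e" using p elim by (auto simp: x_def)
      have "ennreal (mu_lo * e * (snd y $ i)) \<le> ennreal (mu_lo * (snd y $ i)) * ennreal (ub - x)"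
        using x e mu_lo_pos box[of "snd y"] elim
        by (subst ennreal_mult[symmetric]) (auto intro!: ennreal_leI mult_mono simp: mult.assoc mult.commute mult.left_commute)
      also have "ennreal (ub - x) = emeasure lborel {x<..ub}" using x e by simp
      also have "ennreal (mu_lo * (snd y $ i)) * emeasure lborel {x<..ub}
          = (\<integral>\<^sup>+u. ennreal (mu_lo * (snd y $ i)) * indicator {x<..ub} u \<partial>lborel)"
        by (rule nn_integral_cmult_indicator[symmetric]) simp
      also have "\<dots> \<le> (\<integral>\<^sup>+u. ennreal (\<phi> (snd y) u) * indicator \<Xi> (snd y) * indicator {0..ub} u
          * ennreal (of_bool (fst (u, snd y) > snd (u, snd y) \<bullet> p) * snd (u, snd y) $ i) \<partial>lborel)"
      proof (intro nn_integral_mono)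
        fix u
        show "ennreal (mu_lo * (snd y $ i)) * indicator {x<..ub} u
          \<le> ennreal (\<phi> (snd y) u) * indicator \<Xi> (snd y) * indicator {0..ub} u
          * ennreal (of_bool (fst (u, snd y) > snd (u, snd y) \<bullet> p) * snd (u, snd y) $ i)"
        proof (cases "u \<in> {x<..ub}")
          case True
          then have "ennreal mu_lo * ennreal (snd y $ i) \<le> ennreal (\<phi> (snd y) u) * ennreal (snd y $ i)"
            using elim x density_lower by (intro mult_right_mono ennreal_leI) auto
          then show ?thesis using True x elim mu_lo_pos box[of "snd y"]
            by (simp add: x_def ennreal_mult)
        qed simp
      qed
      finally show ?case .
    qed
  qed
  also have "\<dots> = (\<integral>\<^sup>+y. ennreal (of_bool (fst y > snd y \<bullet> p) * snd y $ i) \<partial>\<mu>)"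
    by (rule nn_integral_order[symmetric]) measurable
  also have "\<dots> = ennreal (consumption \<mu> p $ i)"
    unfolding consumption_nth using int2 AEpos by (intro nn_integral_eq_integral) auto
  finally have *: "ennreal (mu_lo * e * (\<integral>y. snd y $ i \<partial>\<mu>)) \<le> ennreal (consumption \<mu> p $ i)" .
  have "0 \<le> consumption \<mu> p $ i"
    unfolding consumption_nth using AEpos by (intro integral_nonneg_AE) auto
  with * show ?thesis by (simp add: ennreal_le_iff)
qed

text \<open>If all orders cost the same amount \<open>c\<close>, the expenditure is \<open>c\<close>
  times the acceptance probability, and accepted rewards lie between \<open>c\<close> and
  \<open>ub\<close>. Serves the degenerate case of \<open>interior_price\<close>.\<close>

lemma expenditure_le:
  assumes p: "\<And>a. a \<in> \<Xi> \<Longrightarrow> a \<bullet> p = c" and c: "0 \<le> c"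
  shows "consumption \<mu> p \<bullet> p \<le> c * (mu_hi * max 0 (ub - c))"
proof -
  let ?A = "{y :: 'm order. fst y > snd y \<bullet> p}"
  have [measurable]: "?A \<in> sets borel" by measurable
  have "consumption \<mu> p \<bullet> p = (\<integral>y. of_bool (fst y > snd y \<bullet> p) * (snd y \<bullet> p) \<partial>\<mu>)"
    unfolding consumption_def by (subst integral_inner_left[symmetric]) auto
  also have "\<dots> = (\<integral>y. c * indicator ?A y \<partial>\<mu>)"
  proof (intro integral_cong_AE)
    show "AE y in \<mu>. of_bool (fst y > snd y \<bullet> p) * (snd y \<bullet> p) = c * indicator ?A y"
      using AE_support by eventually_elim (use p in \<open>auto simp: indicator_def\<close>)
  qed measurable
  also have "\<dots> = c * measure \<mu> ?A" by simp
  also have "\<dots> \<le> c * (mu_hi * max 0 (ub - c))"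
  proof (intro mult_left_mono c)
    have "emeasure \<mu> ?A = (\<integral>\<^sup>+y. indicator ?A y \<partial>\<mu>)" by simp
    also have "\<dots> = (\<integral>\<^sup>+y. (\<integral>\<^sup>+u. ennreal (\<phi> (snd y) u) * indicator \<Xi> (snd y) * indicator {0..ub} u
        * indicator ?A (u, snd y) \<partial>lborel) \<partial>\<mu>)"
      by (rule nn_integral_order) measurable
    also have "\<dots> \<le> (\<integral>\<^sup>+y. (\<integral>\<^sup>+u. ennreal mu_hi * indicator {c..max c ub} u \<partial>lborel) \<partial>\<mu>)"
    proof (intro nn_integral_mono)
      fix y :: "'m order" and u
      show "ennreal (\<phi> (snd y) u) * indicator \<Xi> (snd y) * indicator {0..ub} u * indicator ?A (u, snd y)
          \<le> ennreal mu_hi * indicator {c..max c ub} u"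
        using p[of "snd y"] density_upper[of "snd y" u] by (auto simp: indicator_def intro!: ennreal_leI)
    qed
    also have "\<dots> = ennreal mu_hi * ennreal (max c ub - c)"
      by (subst nn_integral_cmult_indicator) (simp_all add: emeasure_space_1)
    also have "max c ub - c = max 0 (ub - c)" by auto
    finally have "ennreal (measure \<mu> ?A) \<le> ennreal (mu_hi * max 0 (ub - c))"
      using mu_hi_pos by (simp add: emeasure_eq_measure ennreal_mult)
    then show "measure \<mu> ?A \<le> mu_hi * max 0 (ub - c)" using mu_hi_pos by (simp add: ennreal_le_iff)
  qed
  finally show ?thesis .
qed

end

subsection \<open>Eigenvalues, gradient bounds and Riemann sums\<close>

lemma symmetric_inner:
  fixes A :: "real ^ 'm ^ 'm"
  assumes "transpose A = A"
  shows "(A *v x) \<bullet> y = x \<bullet> (A *v y)"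
  using dot_lmul_matrix[of x A y] transpose_matrix_vector[of A x] assms by simp

text \<open>Makes \<open>Min\<close> meaningful in the eigenvalue assumption: eigenvectors of
  distinct eigenvalues are orthogonal, hence independent, hence finitely many.\<close>

lemma finite_eigenvalues:
  fixes A :: "real ^ 'm ^ 'm"
  assumes sym: "transpose A = A"
  shows "finite (eigenvalues A)"
proof -
  define g where "g = (\<lambda>l. SOME x. x \<noteq> 0 \<and> A *v x = l *\<^sub>R x)"
  have g: "g l \<noteq> 0" "A *v g l = l *\<^sub>R g l" if "l \<in> eigenvalues A" for l
    using that unfolding eigenvalues_def g_def by (metis (mono_tags, lifting) mem_Collect_eq someI_ex)+
  have orth: "g l \<bullet> g k = 0" if "l \<in> eigenvalues A" "k \<in> eigenvalues A" "l \<noteq> k" for l k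
  proof -
    have "l * (g l \<bullet> g k) = k * (g l \<bullet> g k)"
      using symmetric_inner[OF sym, of "g l" "g k"] g that by simp
    then show ?thesis using that by simp
  qed
  have "inj_on g (eigenvalues A)"
    by (rule inj_onI) (metis orth g(1) inner_eq_zero_iff)
  moreover have "pairwise orthogonal (g ` eigenvalues A)"
    unfolding pairwise_def orthogonal_def using orth by fastforce
  then have "independent (g ` eigenvalues A)"
    by (rule pairwise_orthogonal_independent) (use g(1) in force)
  then have "finite (g ` eigenvalues A)" by (rule independent_imp_finite)
  ultimately show ?thesis using finite_imageD by blast
qed

text \<open>A minimiser \<open>x0\<close> of the quadratic form on the unit sphere is an
  eigenvector: moving along the residual \<open>h\<close> changes the form to first order by
  \<open>2 * t * |h|^2\<close>, which minimality forbids unless \<open>h = 0\<close>. Its value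
  \<open>l\<close> is then an eigenvalue.\<close>

lemma quadratic_form_ge_Min_eigenvalue:
  fixes A :: "real ^ 'm ^ 'm"
  assumes sym: "transpose A = A"
  shows "Min (eigenvalues A) * (norm w)\<^sup>2 \<le> w \<bullet> (A *v w)"
proof -
  define q where "q = (\<lambda>x. x \<bullet> (A *v x))"
  have cont: "continuous_on S q" for S
    unfolding q_def by (intro continuous_on_inner continuous_on_id matrix_vector_mult_linear_continuous_on)
  obtain x0 where x0: "norm x0 = 1" "\<And>x. norm x = 1 \<Longrightarrow> q x0 \<le> q x"
  proof -
    have "axis (undefined :: 'm) (1 :: real) \<in> sphere 0 1" by simp
    then have "sphere (0 :: real ^ 'm) 1 \<noteq> {}" by blast
    then obtain x0 where "x0 \<in> sphere 0 1" "\<forall>x\<in>sphere 0 1. q x0 \<le> q x"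
      using continuous_attains_inf[OF compact_sphere _ cont] by metis
    then show ?thesis by (intro that) auto
  qed
  define l where "l = q x0"
  have low: "l * (norm x)\<^sup>2 \<le> q x" for x
  proof (cases "x = 0")
    case False
    have "q x = (norm x)\<^sup>2 * q (x /\<^sub>R norm x)"
      using False by (simp add: q_def matrix_vector_mult_scaleR power2_eq_square field_simps)
    moreover have "l \<le> q (x /\<^sub>R norm x)"
      unfolding l_def using False by (intro x0(2)) simp
    ultimately show ?thesis
      using mult_left_mono[of l "q (x /\<^sub>R norm x)" "(norm x)\<^sup>2"] by (simp add: mult.commute)
  qed (simp add: q_def)
  define h where "h = A *v x0 - l *\<^sub>R x0"
  have perturb: "0 \<le> 2 * t * (norm h)\<^sup>2 + t\<^sup>2 * (q h - l * (norm h)\<^sup>2)" for t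
  proof -
    have "q (x0 + t *\<^sub>R h) = q x0 + 2 * t * (h \<bullet> (A *v x0)) + t\<^sup>2 * q h"
      using symmetric_inner[OF sym, of h x0]
      by (simp add: q_def matrix_vector_right_distrib matrix_vector_mult_scaleR
          inner_add_left inner_add_right inner_commute power2_eq_square algebra_simps)
    moreover have "(norm (x0 + t *\<^sub>R h))\<^sup>2 = 1 + 2 * t * (h \<bullet> x0) + t\<^sup>2 * (norm h)\<^sup>2"
      using x0(1) unfolding power2_norm_eq_inner norm_eq_1
      by (simp add: inner_add_left inner_add_right inner_commute power2_eq_square algebra_simps)
    moreover have "(norm h)\<^sup>2 = h \<bullet> (A *v x0) - l * (h \<bullet> x0)"
      unfolding power2_norm_eq_inner by (subst (2) h_def) (simp add: inner_diff_right)
    ultimately have "l * (1 + 2 * t * (h \<bullet> x0) + t\<^sup>2 * (norm h)\<^sup>2)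
        \<le> l + 2 * t * (h \<bullet> (A *v x0)) + t\<^sup>2 * q h"
      and "h \<bullet> (A *v x0) = (norm h)\<^sup>2 + l * (h \<bullet> x0)"
      using low[of "x0 + t *\<^sub>R h"] by (simp_all add: l_def)
    then show ?thesis by (simp add: algebra_simps)
  qed
  have "h = 0"
  proof (rule ccontr)
    assume "h \<noteq> 0"
    define c where "c = \<bar>q h - l * (norm h)\<^sup>2\<bar> + 1"
    \<comment> \<open>This choice makes the expression in \<open>perturb\<close> at most
      \<open>- |h|^4 / c\<close>.\<close>
    define t where "t = - (norm h)\<^sup>2 / c"
    have c: "0 < c" "q h - l * (norm h)\<^sup>2 \<le> c" by (auto simp: c_def)
    have "t\<^sup>2 * (q h - l * (norm h)\<^sup>2) \<le> t\<^sup>2 * c" using c by (intro mult_left_mono) auto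
    then have "0 \<le> 2 * t * (norm h)\<^sup>2 + t\<^sup>2 * c" using perturb[of t] by linarith
    also have "\<dots> = - ((norm h)\<^sup>2)\<^sup>2 / c"
      using c by (simp add: t_def power2_eq_square field_simps)
    finally have "((norm h)\<^sup>2)\<^sup>2 / c \<le> 0" by simp
    moreover have "0 < ((norm h)\<^sup>2)\<^sup>2 / c" using c \<open>h \<noteq> 0\<close> by simp
    ultimately show False by linarith
  qed
  then have "l \<in> eigenvalues A"
    using x0(1) unfolding eigenvalues_def h_def by (auto intro!: exI[of _ x0])
  then have "Min (eigenvalues A) \<le> l" using finite_eigenvalues[OF sym] by simp
  then have "Min (eigenvalues A) * (norm w)\<^sup>2 \<le> l * (norm w)\<^sup>2" by (intro mult_right_mono) auto
  with low[of w] show ?thesis by (simp add: q_def)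
qed

lemma closed_measure_support: "closed (measure_support M)"
proof -
  have "- measure_support M = \<Union>{U. open U \<and> emeasure M U = 0}"
    unfolding measure_support_def by (auto simp: zero_less_iff_neq_zero)
  then have "open (- measure_support M)" by auto
  then show ?thesis by (simp add: closed_def)
qed

lemma C1_gradient_bounded_lipschitz:
  assumes "C1_gradient_bounded S L h" "convex S" "x \<in> S" "y \<in> S"
  shows "\<bar>h x - h y\<bar> \<le> L * norm (x - y)"
proof -
  obtain grad where grad: "\<forall>x\<in>S. (h has_derivative (\<lambda>y. grad x \<bullet> y)) (at x within S) \<and> norm (grad x) \<le> L"
    using assms(1) by (auto simp: C1_gradient_bounded_def)
  have "norm (h x - h y) \<le> L * norm (x - y)"
  proof (rule differentiable_bound[OF assms(2)])
    fix x assume "x \<in> S"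
    then show "(h has_derivative (\<lambda>y. grad x \<bullet> y)) (at x within S)" using grad by blast
    have "onorm (\<lambda>y. grad x \<bullet> y) \<le> norm (grad x)"
      by (rule onorm_bound) (auto intro: Cauchy_Schwarz_ineq2)
    then show "onorm (\<lambda>y. grad x \<bullet> y) \<le> L" using grad \<open>x \<in> S\<close> by force
  qed (use assms in auto)
  then show ?thesis by simp
qed

lemma C1_gradient_bounded_continuous:
  assumes "C1_gradient_bounded S L h" shows "continuous_on S h"
  using assms unfolding C1_gradient_bounded_def
  by (meson has_derivative_continuous_on)

text \<open>Each of the \<open>n\<close> cells has error at most \<open>\<Lambda> / n^2\<close>.
  After scaling by \<open>n\<close> the error is bounded independently of \<open>n\<close>, so the
  limit price is optimal for \<open>n\<close> orders up to a constant.\<close>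

lemma riemann_sum_lipschitz:
  fixes J :: "real \<Rightarrow> real"
  assumes lip: "\<And>s t. s \<in> {0..1} \<Longrightarrow> t \<in> {0..1} \<Longrightarrow> \<bar>J s - J t\<bar> \<le> \<Lambda> * \<bar>s - t\<bar>"
    and n: "1 \<le> n" and L: "0 \<le> \<Lambda>"
  shows "\<bar>real n * (LBINT s:{0..1}. J s) - (\<Sum>k\<in>{1..n}. J (real k / real n))\<bar> \<le> \<Lambda>"
proof -
  have "\<Lambda>-lipschitz_on {0..1} J"
    by (rule lipschitz_onI) (use lip L in \<open>auto simp: dist_real_def\<close>)
  then have cont: "continuous_on {0..1} J" by (rule lipschitz_on_continuous_on)
  have n0: "0 < real n" using n by simp
  have "\<bar>integral {0..real m / real n} J - (\<Sum>k\<in>{1..m}. J (real k / real n)) / real n\<bar>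
      \<le> real m * (\<Lambda> / real n * (1 / real n))" if "m \<le> n" for m
    using that
  proof (induction m)
    case (Suc m)
    let ?x = "real m / real n" and ?y = "real (Suc m) / real n"
    have y: "?x \<le> ?y" "?y \<le> 1" "0 \<le> ?x" using Suc.prems n0 by (auto simp: divide_right_mono)
    have xy: "?y - ?x = 1 / real n" by (simp add: diff_divide_distrib[symmetric])
    have sub: "{?x..?y} \<subseteq> {0..1}" using y by (meson atLeastAtMost_iff order_trans subsetI)
    have "{0..?y} \<subseteq> {0..1}" using y(2) by (meson atLeastAtMost_iff order_trans subsetI)
    then have int: "J integrable_on {0..?y}" "J integrable_on {?x..?y}"
      using sub by (blast intro: integrable_continuous_real continuous_on_subset[OF cont])+
    have "integral {0..?y} J = integral {0..?x} J + integral {?x..?y} J"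
      using y int by (intro Henstock_Kurzweil_Integration.integral_combine[symmetric]) auto
    moreover have "integral {?x..?y} (\<lambda>s. J s - J ?y) = integral {?x..?y} J - J ?y / real n"
      using int(2) y xy by (subst integral_diff) (auto simp: divide_inverse)
    moreover have "norm (integral {?x..?y} (\<lambda>s. J s - J ?y)) \<le> (\<Lambda> / real n) * (?y - ?x)"
    proof (rule integral_bound)
      show "continuous_on {?x..?y} (\<lambda>s. J s - J ?y)"
        by (intro continuous_intros continuous_on_subset[OF cont sub])
      fix s assume s: "s \<in> {?x..?y}"
      have "?y \<in> {?x..?y}" using y(1) by simp
      from subsetD[OF sub s] subsetD[OF sub this] have "\<bar>J s - J ?y\<bar> \<le> \<Lambda> * \<bar>s - ?y\<bar>" by (rule lip)
      also have "\<dots> \<le> \<Lambda> * (1 / real n)" using s xy L by (intro mult_left_mono) auto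
      finally show "norm (J s - J ?y) \<le> \<Lambda> / real n" by simp
    qed (use y in simp)
    ultimately have "\<bar>integral {0..?y} J - (\<Sum>k\<in>{1..Suc m}. J (real k / real n)) / real n\<bar>
        \<le> real m * (\<Lambda> / real n * (1 / real n)) + \<Lambda> / real n * (1 / real n)"
      using Suc.IH Suc.prems xy by (simp add: add_divide_distrib del: of_nat_Suc)
    then show ?case by (simp add: distrib_right add_divide_distrib)
  qed simp
  from this[of n] have "\<bar>integral {0..1} J - (\<Sum>k\<in>{1..n}. J (real k / real n)) / real n\<bar> \<le> \<Lambda> / real n"
    using n0 by simp
  then have "real n * \<bar>integral {0..1} J - (\<Sum>k\<in>{1..n}. J (real k / real n)) / real n\<bar> \<le> \<Lambda>"
    using n0 by (simp add: field_simps)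
  moreover have "real n * \<bar>integral {0..1} J - (\<Sum>k\<in>{1..n}. J (real k / real n)) / real n\<bar>
      = \<bar>real n * (integral {0..1} J - (\<Sum>k\<in>{1..n}. J (real k / real n)) / real n)\<bar>"
    by (simp add: abs_mult)
  moreover have "(LBINT s:{0..1}. J s) = integral {0..1} J"
    by (rule set_borel_integral_eq_integral(2)) (rule borel_integrable_atLeastAtMost'[OF cont])
  ultimately show ?thesis using n0 by (simp add: right_diff_distrib)
qed

subsection \<open>The limit problem\<close>

text \<open>Fixes one member of the family. \<open>regular_family\<close> is reused for the
  singleton \<open>{P}\<close>, so that among its data only \<open>v\<close> and \<open>f\<close>
  depend on the member.\<close>

locale regular_sequence =
  fixes P :: "('m::finite) dist_seq" and \<alpha> a_lo lam L ub mu_hi mu_lo :: real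
    and \<Xi> :: "(real ^ 'm) set" and \<nu> :: "(real ^ 'm) measure"
    and v :: "real \<times> (real ^ 'm) \<Rightarrow> real" and f :: "real \<times> (real ^ 'm) \<times> real \<Rightarrow> real"
  assumes distribution: "distribution_sequence P"
    and regular: "regular_family {P} \<alpha> a_lo lam L ub mu_hi mu_lo \<Xi> \<nu> (\<lambda>_. v) (\<lambda>_. f)"
begin

abbreviation box :: "(real ^ 'm) set" where "box \<equiv> {0..vec \<alpha>}"

lemma pos: "0 < \<alpha>" "0 < a_lo" "0 < lam" "0 < L" "0 < ub" "0 < mu_hi" "0 < mu_lo"
  and Xi_box: "\<Xi> \<subseteq> box"
  and nu_cases: "\<nu> = counting_on \<Xi> \<or> \<nu> = lebesgue_on_support \<Xi>"
  using regular by (auto simp: regular_family_def)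

lemma indep: "1 \<le> n \<Longrightarrow> prob_space.indep_vars (P n) (\<lambda>_. borel) (\<lambda>j \<omega>. \<omega> j) {1..n}"
  using regular by (simp add: regular_family_def)

lemma
  assumes "1 \<le> n" "j \<in> {1..n}"
  shows support: "measure_support (distr (P n) borel (\<lambda>\<omega>. snd (\<omega> j))) = \<Xi>"
    and mean: "(\<integral>\<omega>. snd (\<omega> j) $ i \<partial>P n) > a_lo"
    and eigenvalue: "Min (eigenvalues (second_moment_matrix (P n) (\<lambda>\<omega>. snd (\<omega> j)))) > lam"
    and consumption_law: "distr (P n) borel (\<lambda>\<omega>. snd (\<omega> j)) = consumption_law \<nu> \<Xi> v (real j / real n)"
    and pair_law: "distr (P n) (borel \<Otimes>\<^sub>M borel) (\<lambda>\<omega>. (snd (\<omega> j), fst (\<omega> j))) =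
              pair_law (distr (P n) borel (\<lambda>\<omega>. snd (\<omega> j))) \<Xi> ub f (real j / real n)"
  using regular assms unfolding regular_family_def by blast+

lemma C1_v: "C1_gradient_bounded ({0..1} \<times> box) L v"
  and v_bounds: "x \<in> {0..1} \<times> box \<Longrightarrow> 0 < v x \<and> v x \<le> mu_hi"
  and C1_f: "C1_gradient_bounded ({0..1} \<times> box \<times> {0..ub}) L f"
  and f_bounds: "z \<in> {0..1} \<times> box \<times> {0..ub} \<Longrightarrow> mu_lo \<le> f z \<and> f z \<le> mu_hi"
  using regular by (auto simp: regular_family_def)

lemma prob_space_P: "1 \<le> n \<Longrightarrow> prob_space (P n)"
  and sets_P: "1 \<le> n \<Longrightarrow> sets (P n) = sets (path_space n)"
  using distribution by (auto simp: distribution_sequence_def)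

lemma measurable_coordinate:
  "1 \<le> n \<Longrightarrow> j \<in> {1..n} \<Longrightarrow> (\<lambda>\<omega>. \<omega> j) \<in> borel_measurable (P n)"
  unfolding measurable_cong_sets[OF sets_P refl] path_space_def
  by (rule measurable_component_singleton)

lemma closed_Xi: "closed \<Xi>"
  using support[of 1 1] closed_measure_support by (metis atLeastAtMost_singleton insertI1 order_refl)

lemma Xi_borel [measurable]: "\<Xi> \<in> sets borel"
  using closed_Xi by (rule borel_closed)

lemma v_lipschitz:
  assumes "a \<in> \<Xi>" "s \<in> {0..1}" "t \<in> {0..1}"
  shows "\<bar>v (s, a) - v (t, a)\<bar> \<le> L * \<bar>s - t\<bar>"
proof -
  have "\<bar>v (s, a) - v (t, a)\<bar> \<le> L * norm ((s, a) - (t, a))"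
    using assms Xi_box
    by (intro C1_gradient_bounded_lipschitz[OF C1_v] convex_Times convex_closed_interval) auto
  then show ?thesis by simp
qed

lemma f_lipschitz:
  assumes "a \<in> \<Xi>" "u \<in> {0..ub}" "s \<in> {0..1}" "t \<in> {0..1}"
  shows "\<bar>f (s, a, u) - f (t, a, u)\<bar> \<le> L * \<bar>s - t\<bar>"
proof -
  have "\<bar>f (s, a, u) - f (t, a, u)\<bar> \<le> L * norm ((s, a, u) - (t, a, u))"
    using assms Xi_box
    by (intro C1_gradient_bounded_lipschitz[OF C1_f] convex_Times convex_closed_interval) auto
  then show ?thesis by simp
qed

lemma weight_measurable:
  assumes t: "t \<in> {0..1}"
  shows "(\<lambda>a. v (t, a) * indicator \<Xi> a) \<in> borel_measurable borel"
proof -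
  have "continuous_on \<Xi> (\<lambda>a. v (t, a))"
    by (rule continuous_on_compose2[OF C1_gradient_bounded_continuous[OF C1_v]])
       (use t Xi_box in \<open>auto intro!: continuous_intros\<close>)
  from borel_measurable_continuous_on_indicator[OF Xi_borel this]
  show ?thesis by (simp add: mult.commute)
qed

lemma reward_density_measurable:
  assumes t: "t \<in> {0..1}"
  shows "(\<lambda>z. f (t, z) * indicator (\<Xi> \<times> {0..ub}) z) \<in> borel_measurable borel"
proof -
  have m: "\<Xi> \<times> {0..ub} \<in> sets borel"
    by (intro borel_closed closed_Times closed_Xi) auto
  have "continuous_on (\<Xi> \<times> {0..ub}) (\<lambda>z. f (t, z))"
    by (rule continuous_on_compose2[OF C1_gradient_bounded_continuous[OF C1_f]])
       (use t Xi_box in \<open>auto intro!: continuous_intros\<close>)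
  from borel_measurable_continuous_on_indicator[OF m this]
  show ?thesis by (simp add: mult.commute)
qed

lemma ennreal_weight_measurable:
  assumes t: "t \<in> {0..1}"
  shows "(\<lambda>a. ennreal (v (t, a)) * indicator \<Xi> a) \<in> borel_measurable borel"
proof -
  note [measurable] = weight_measurable[OF t]
  have "(\<lambda>a. ennreal (v (t, a)) * indicator \<Xi> a) = (\<lambda>a. ennreal (v (t, a) * indicator \<Xi> a))"
    by (auto simp: indicator_def)
  then show ?thesis by simp
qed

lemma ennreal_density_measurable:
  assumes t: "t \<in> {0..1}"
  shows "(\<lambda>(a, u). ennreal (f (t, a, u)) * indicator \<Xi> a * indicator {0..ub} u)
    \<in> borel_measurable (borel \<Otimes>\<^sub>M borel)"
proof -
  have "(\<lambda>(a, u). ennreal (f (t, a, u)) * indicator \<Xi> a * indicator {0..ub} u)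
      = (\<lambda>z. ennreal (f (t, z) * indicator (\<Xi> \<times> {0..ub}) z))"
    by (auto simp: indicator_def)
  moreover have "(\<lambda>z. ennreal (f (t, z) * indicator (\<Xi> \<times> {0..ub}) z)) \<in> borel_measurable borel"
    using reward_density_measurable[OF t] by measurable
  ultimately show ?thesis by (simp add: borel_prod)
qed

lemma sets_nu: "sets \<nu> = sets borel"
  using nu_cases by (auto simp: counting_on_def lebesgue_on_support_def)

text \<open>
  A positive continuous weight is bounded away from 0 on the compact box, and it integrates to 1,
  so the reference measure of the support is finite (in the discrete case, the support is finite).
\<close>

lemma nu_finite: "emeasure \<nu> \<Xi> < \<infinity>"
proof -
  interpret P1: prob_space "P 1" by (rule prob_space_P) simp
  have [simp]: "(1 :: real) \<in> {0..1}" by simp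
  have mc: "(\<lambda>\<omega>. snd (\<omega> 1)) \<in> borel_measurable (P 1)"
    using measurable_coordinate[of 1 1] by measurable
  have "consumption_law \<nu> \<Xi> v 1 = distr (P 1) borel (\<lambda>\<omega>. snd (\<omega> 1))"
    using consumption_law[of 1 1] by simp
  then have "prob_space (consumption_law \<nu> \<Xi> v 1)"
    using P1.prob_space_distr[OF mc] by simp
  then have "emeasure (consumption_law \<nu> \<Xi> v 1) UNIV = 1"
    using prob_space.emeasure_space_1 sets_eq_imp_space_eq[OF sets_nu]
    by (fastforce simp: consumption_law_def)
  then have 1: "(\<integral>\<^sup>+a. ennreal (v (1, a)) * indicator \<Xi> a \<partial>\<nu>) = 1"
    using ennreal_weight_measurable[of 1] sets_nu unfolding consumption_law_def
    by (subst (asm) emeasure_density) (auto simp: measurable_cong_sets[OF sets_nu refl])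
  have "compact box" by (rule compact_cbox[of 0 "vec \<alpha>", unfolded cbox_interval])
  moreover have "0 \<in> box" using pos by (simp add: less_eq_vec_def)
  moreover have "continuous_on box (\<lambda>a. v (1, a))"
    by (rule continuous_on_compose2[OF C1_gradient_bounded_continuous[OF C1_v]])
       (auto intro!: continuous_intros)
  ultimately obtain a0 where a0: "a0 \<in> box" "\<forall>a\<in>box. v (1, a0) \<le> v (1, a)"
    using continuous_attains_inf[of box "\<lambda>a. v (1, a)"] by blast
  have v0: "0 < v (1, a0)" using v_bounds[of "(1, a0)"] a0 by simp
  have "ennreal (v (1, a0)) * emeasure \<nu> \<Xi> = (\<integral>\<^sup>+a. ennreal (v (1, a0)) * indicator \<Xi> a \<partial>\<nu>)"
    by (rule nn_integral_cmult_indicator[symmetric]) (simp add: sets_nu)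
  also have "\<dots> \<le> (\<integral>\<^sup>+a. ennreal (v (1, a)) * indicator \<Xi> a \<partial>\<nu>)"
    using a0 Xi_box by (intro nn_integral_mono) (auto simp: indicator_def intro!: ennreal_leI)
  also have "\<dots> = 1" by (rule 1)
  finally have "ennreal (v (1, a0)) * emeasure \<nu> \<Xi> \<le> 1" .
  then have "emeasure \<nu> \<Xi> \<noteq> \<infinity>"
    using v0 by (auto simp: ennreal_mult_top top_unique)
  then show ?thesis by (simp add: less_top)
qed

abbreviation V :: real where "V \<equiv> measure \<nu> \<Xi>"

lemma emeasure_nu: "emeasure \<nu> \<Xi> = ennreal V"
  using nu_finite by (simp add: emeasure_eq_ennreal_measure less_top)

section \<open>The limit surplus and its Lipschitz dependence on time\<close>

definition limit_surplus :: "real \<Rightarrow> real ^ 'm \<Rightarrow> real" where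
  "limit_surplus t p = (\<integral>(a, u). max 0 (u - a \<bullet> p) \<partial>pair_law (consumption_law \<nu> \<Xi> v t) \<Xi> ub f t)"

text \<open>Relative to the fixed reference measures \<open>\<nu>\<close> and \<open>lborel\<close>,
  time enters only through this function, so surpluses at two times can be compared
  pointwise.\<close>

definition integrand :: "real \<Rightarrow> real ^ 'm \<Rightarrow> real ^ 'm \<Rightarrow> real \<Rightarrow> real" where
  "integrand t p a u = v (t, a) * indicator \<Xi> a * (f (t, a, u) * indicator (\<Xi> \<times> {0..ub}) (a, u))
     * max 0 (u - a \<bullet> p)"

definition nn_surplus :: "real \<Rightarrow> real ^ 'm \<Rightarrow> ennreal" where
  "nn_surplus t p = (\<integral>\<^sup>+a. (\<integral>\<^sup>+u. ennreal (integrand t p a u) \<partial>lborel) \<partial>\<nu>)"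

lemma integrand_measurable:
  assumes t: "t \<in> {0..1}"
  shows "(\<lambda>(a, u). ennreal (integrand t p a u)) \<in> borel_measurable (\<nu> \<Otimes>\<^sub>M lborel)"
proof -
  have s: "sets (\<nu> \<Otimes>\<^sub>M lborel) = sets (borel \<Otimes>\<^sub>M borel)"
    by (intro sets_pair_measure_cong sets_nu) simp
  note [measurable] = weight_measurable[OF t] reward_density_measurable[OF t, folded borel_prod]
  show ?thesis
    unfolding measurable_cong_sets[OF s refl] integrand_def case_prod_beta prod.collapse by measurable
qed

lemma integrand_nonneg: "t \<in> {0..1} \<Longrightarrow> 0 \<le> integrand t p a u"
proof (cases "a \<in> \<Xi> \<and> u \<in> {0..ub}")
  case True
  assume "t \<in> {0..1}"
  then have "0 < v (t, a)" "0 < f (t, a, u)"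
    using v_bounds[of "(t, a)"] f_bounds[of "(t, a, u)"] Xi_box pos True by auto
  then show ?thesis using True by (simp add: integrand_def)
qed (auto simp: integrand_def)

lemma limit_surplus_eq:
  assumes t: "t \<in> {0..1}"
  shows "limit_surplus t p = enn2real (nn_surplus t p)"
proof -
  let ?Q = "consumption_law \<nu> \<Xi> v t"
  let ?D = "\<lambda>(a, u). ennreal (f (t, a, u)) * indicator \<Xi> a * indicator {0..ub} u"
  let ?h = "\<lambda>(a, u). ennreal (max 0 (u - a \<bullet> p))"
  have sQ: "sets ?Q = sets borel" by (simp add: consumption_law_def sets_nu)
  have sQl: "sets (?Q \<Otimes>\<^sub>M lborel) = sets (borel \<Otimes>\<^sub>M borel)"
    by (intro sets_pair_measure_cong sQ) simp
  have snl: "sets (\<nu> \<Otimes>\<^sub>M lborel) = sets (borel \<Otimes>\<^sub>M borel)"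
    by (intro sets_pair_measure_cong sets_nu) simp
  have D: "?D \<in> borel_measurable (?Q \<Otimes>\<^sub>M lborel)" "?D \<in> borel_measurable (\<nu> \<Otimes>\<^sub>M lborel)"
    unfolding measurable_cong_sets[OF sQl refl] measurable_cong_sets[OF snl refl]
    by (rule ennreal_density_measurable[OF t])+
  have h: "?h \<in> borel_measurable (?Q \<Otimes>\<^sub>M lborel)" "?h \<in> borel_measurable (\<nu> \<Otimes>\<^sub>M lborel)"
    unfolding measurable_cong_sets[OF sQl refl] measurable_cong_sets[OF snl refl] by measurable
  have hr: "(\<lambda>(a, u). max 0 (u - a \<bullet> p)) \<in> borel_measurable (pair_law ?Q \<Xi> ub f t)"
    unfolding pair_law_def measurable_density_eq1 measurable_cong_sets[OF sQl refl] by measurable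
  have inner: "(\<lambda>a. \<integral>\<^sup>+u. ?D (a, u) * ?h (a, u) \<partial>lborel) \<in> borel_measurable \<nu>"
    by (rule lborel.borel_measurable_nn_integral_fst[OF borel_measurable_times_ennreal[OF D(2) h(2)]])
  have w: "(\<lambda>a. ennreal (v (t, a)) * indicator \<Xi> a) \<in> borel_measurable \<nu>"
    unfolding measurable_cong_sets[OF sets_nu refl] by (rule ennreal_weight_measurable[OF t])
  have "limit_surplus t p = enn2real (\<integral>\<^sup>+z. ennreal (case z of (a, u) \<Rightarrow> max 0 (u - a \<bullet> p)) \<partial>pair_law ?Q \<Xi> ub f t)"
    unfolding limit_surplus_def
    by (rule integral_eq_nn_integral[OF hr]) (auto simp: case_prod_beta)
  also have "(\<integral>\<^sup>+z. ennreal (case z of (a, u) \<Rightarrow> max 0 (u - a \<bullet> p)) \<partial>pair_law ?Q \<Xi> ub f t)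
      = (\<integral>\<^sup>+z. ?h z \<partial>pair_law ?Q \<Xi> ub f t)"
    by (intro nn_integral_cong) (auto simp: case_prod_beta)
  also have "\<dots> = (\<integral>\<^sup>+z. ?D z * ?h z \<partial>(?Q \<Otimes>\<^sub>M lborel))"
    unfolding pair_law_def by (rule nn_integral_density[OF D(1) h(1)])
  also have "\<dots> = (\<integral>\<^sup>+a. (\<integral>\<^sup>+u. ?D (a, u) * ?h (a, u) \<partial>lborel) \<partial>?Q)"
    by (rule lborel.nn_integral_fst[symmetric, OF borel_measurable_times_ennreal[OF D(1) h(1)]])
  also have "\<dots> = (\<integral>\<^sup>+a. ennreal (v (t, a)) * indicator \<Xi> a * (\<integral>\<^sup>+u. ?D (a, u) * ?h (a, u) \<partial>lborel) \<partial>\<nu>)"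
    unfolding consumption_law_def by (rule nn_integral_density[OF w inner])
  also have "\<dots> = nn_surplus t p"
    unfolding nn_surplus_def
  proof (intro nn_integral_cong)
    fix a
    have "(\<lambda>u. ?D (a, u) * ?h (a, u)) \<in> borel_measurable lborel"
      using measurable_Pair1'[of a \<nu> lborel] 
      by (intro measurable_compose[OF _ borel_measurable_times_ennreal[OF D(2) h(2)]])
         (simp add: sets_eq_imp_space_eq[OF sets_nu])
    then have "ennreal (v (t, a)) * indicator \<Xi> a * (\<integral>\<^sup>+u. ?D (a, u) * ?h (a, u) \<partial>lborel)
        = (\<integral>\<^sup>+u. ennreal (v (t, a)) * indicator \<Xi> a * (?D (a, u) * ?h (a, u)) \<partial>lborel)"
      by (rule nn_integral_cmult[symmetric])
    also have "\<dots> = (\<integral>\<^sup>+u. ennreal (integrand t p a u) \<partial>lborel)"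
    proof (intro nn_integral_cong)
      fix u
      show "ennreal (v (t, a)) * indicator \<Xi> a * (?D (a, u) * ?h (a, u)) = ennreal (integrand t p a u)"
      proof (cases "a \<in> \<Xi> \<and> u \<in> {0..ub}")
        case True
        then have "0 < v (t, a)" "0 < f (t, a, u)"
          using v_bounds[of "(t, a)"] f_bounds[of "(t, a, u)"] Xi_box t pos by auto
        then show ?thesis using True
          by (simp add: integrand_def ennreal_mult mult.assoc)
      qed (auto simp: integrand_def)
    qed
    finally show "ennreal (v (t, a)) * indicator \<Xi> a * (\<integral>\<^sup>+u. ?D (a, u) * ?h (a, u) \<partial>lborel)
      = (\<integral>\<^sup>+u. ennreal (integrand t p a u) \<partial>lborel)" .
  qed
  finally show ?thesis .
qed

text \<open>The product of the densities \<open>v\<close> and \<open>f\<close> changes at rate at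
  most \<open>2 * mu_hi * L\<close>. One factor \<open>ub\<close> bounds the gain, the other is the
  length of the reward range, and \<open>V\<close> is the mass of the support.\<close>

definition time_rate :: real where "time_rate = 2 * ub\<^sup>2 * mu_hi * L * V"

lemma integrand_perturb:
  assumes s: "s \<in> {0..1}" and t: "t \<in> {0..1}" and p: "0 \<le> p"
  shows "integrand s p a u \<le> integrand t p a u
    + 2 * ub * mu_hi * L * \<bar>s - t\<bar> * indicator \<Xi> a * indicator {0..ub} u"
proof (cases "a \<in> \<Xi> \<and> u \<in> {0..ub}")
  case True
  then have a: "a \<in> box" "a \<in> \<Xi>" "u \<in> {0..ub}" using Xi_box by auto
  let ?g = "max 0 (u - a \<bullet> p)"
  have "0 \<le> a \<bullet> p" using a p by (intro inner_nonneg_vec) auto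
  then have g: "0 \<le> ?g" "?g \<le> ub" using a pos by auto
  have vb: "0 < v (t, a)" "v (t, a) \<le> mu_hi" using v_bounds[of "(t, a)"] a t by auto
  have fb: "0 \<le> f (s, a, u)" "f (s, a, u) \<le> mu_hi" using f_bounds[of "(s, a, u)"] a s pos by auto
  have "v (s, a) * f (s, a, u) - v (t, a) * f (t, a, u)
      = (v (s, a) - v (t, a)) * f (s, a, u) + v (t, a) * (f (s, a, u) - f (t, a, u))"
    by (simp add: algebra_simps)
  also have "\<dots> \<le> (L * \<bar>s - t\<bar>) * mu_hi + mu_hi * (L * \<bar>s - t\<bar>)"
    using v_lipschitz[OF a(2) s t] f_lipschitz[OF a(2,3) s t] vb fb pos
    by (intro add_mono order_trans[OF mult_right_mono mult_left_mono] order_trans[OF mult_left_mono mult_right_mono])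
       (auto simp: abs_le_iff)
  finally have "(v (s, a) * f (s, a, u) - v (t, a) * f (t, a, u)) * ?g
      \<le> ((L * \<bar>s - t\<bar>) * mu_hi + mu_hi * (L * \<bar>s - t\<bar>)) * ?g"
    using g by (intro mult_right_mono) auto
  also have "\<dots> \<le> ((L * \<bar>s - t\<bar>) * mu_hi + mu_hi * (L * \<bar>s - t\<bar>)) * ub"
    using g pos by (intro mult_left_mono) auto
  finally show ?thesis using True by (simp add: integrand_def algebra_simps)
qed (auto simp: integrand_def)

lemma nn_surplus_perturb:
  assumes s: "s \<in> {0..1}" and t: "t \<in> {0..1}" and p: "0 \<le> p"
  shows "nn_surplus s p \<le> nn_surplus t p + ennreal (time_rate * \<bar>s - t\<bar>)"
proof -
  define c where "c = 2 * ub * mu_hi * L * \<bar>s - t\<bar>"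
  have c: "0 \<le> c" unfolding c_def using pos by simp
  have mu: "(\<lambda>u. ennreal (integrand t p a u)) \<in> borel_measurable lborel" for a
    using measurable_compose[OF measurable_Pair1'[of a \<nu> lborel] integrand_measurable[OF t, of p]]
    by (simp add: sets_eq_imp_space_eq[OF sets_nu])
  have ma: "(\<lambda>a. \<integral>\<^sup>+u. ennreal (integrand t p a u) \<partial>lborel) \<in> borel_measurable \<nu>"
    using lborel.borel_measurable_nn_integral_fst[OF integrand_measurable[OF t, of p]] by simp
  have Xin: "\<Xi> \<in> sets \<nu>" by (simp add: sets_nu)
  have "nn_surplus s p \<le> (\<integral>\<^sup>+a. (\<integral>\<^sup>+u. ennreal (integrand t p a u)
      + ennreal c * indicator \<Xi> a * indicator {0..ub} u \<partial>lborel) \<partial>\<nu>)"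
    unfolding nn_surplus_def
  proof (intro nn_integral_mono)
    fix a u
    have "ennreal (integrand s p a u)
        \<le> ennreal (integrand t p a u + c * indicator \<Xi> a * indicator {0..ub} u)"
      using integrand_perturb[OF s t p, of a u] by (intro ennreal_leI) (simp add: c_def)
    also have "\<dots> = ennreal (integrand t p a u) + ennreal (c * indicator \<Xi> a * indicator {0..ub} u)"
      using integrand_nonneg[OF t] c by (intro ennreal_plus) auto
    also have "ennreal (c * indicator \<Xi> a * indicator {0..ub} u) = ennreal c * indicator \<Xi> a * indicator {0..ub} u"
      by (auto simp: indicator_def)
    finally show "ennreal (integrand s p a u)
        \<le> ennreal (integrand t p a u) + ennreal c * indicator \<Xi> a * indicator {0..ub} u" .
  qed
  also have "\<dots> = (\<integral>\<^sup>+a. (\<integral>\<^sup>+u. ennreal (integrand t p a u) \<partial>lborel) + ennreal (c * ub) * indicator \<Xi> a \<partial>\<nu>)"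
  proof (intro nn_integral_cong)
    fix a
    have "(\<integral>\<^sup>+u. ennreal (integrand t p a u) + ennreal c * indicator \<Xi> a * indicator {0..ub} u \<partial>lborel)
        = (\<integral>\<^sup>+u. ennreal (integrand t p a u) \<partial>lborel) + (\<integral>\<^sup>+u. ennreal c * indicator \<Xi> a * indicator {0..ub} u \<partial>lborel)"
      by (intro nn_integral_add mu) measurable
    also have "(\<integral>\<^sup>+u. ennreal c * indicator \<Xi> a * indicator {0..ub} u \<partial>lborel) = ennreal (c * ub) * indicator \<Xi> a"
      using pos c by (subst nn_integral_cmult_indicator) (auto simp: ennreal_mult mult_ac)
    finally show "(\<integral>\<^sup>+u. ennreal (integrand t p a u) + ennreal c * indicator \<Xi> a * indicator {0..ub} u \<partial>lborel)
        = (\<integral>\<^sup>+u. ennreal (integrand t p a u) \<partial>lborel) + ennreal (c * ub) * indicator \<Xi> a" .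
  qed
  also have "\<dots> = nn_surplus t p + (\<integral>\<^sup>+a. ennreal (c * ub) * indicator \<Xi> a \<partial>\<nu>)"
    unfolding nn_surplus_def using Xin by (intro nn_integral_add ma borel_measurable_times_ennreal borel_measurable_const
        borel_measurable_indicator)
  also have "(\<integral>\<^sup>+a. ennreal (c * ub) * indicator \<Xi> a \<partial>\<nu>) = ennreal (c * ub) * ennreal V"
    using Xin emeasure_nu by (simp add: nn_integral_cmult_indicator)
  also have "\<dots> = ennreal (time_rate * \<bar>s - t\<bar>)"
    using c pos by (simp add: ennreal_mult[symmetric] time_rate_def c_def power2_eq_square mult_ac)
  finally show ?thesis .
qed

lemma nn_surplus_finite:
  assumes t: "t \<in> {0..1}" and p: "0 \<le> p"
  shows "nn_surplus t p < \<infinity>"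
proof -
  define c where "c = mu_hi * mu_hi * ub"
  have c: "0 \<le> c" unfolding c_def using pos by simp
  have Xin: "\<Xi> \<in> sets \<nu>" by (simp add: sets_nu)
  have "nn_surplus t p \<le> (\<integral>\<^sup>+a. (\<integral>\<^sup>+u. ennreal c * indicator \<Xi> a * indicator {0..ub} u \<partial>lborel) \<partial>\<nu>)"
    unfolding nn_surplus_def
  proof (intro nn_integral_mono)
    fix a u
    show "ennreal (integrand t p a u) \<le> ennreal c * indicator \<Xi> a * indicator {0..ub} u"
    proof (cases "a \<in> \<Xi> \<and> u \<in> {0..ub}")
      case True
      then have a: "a \<in> box" "a \<in> \<Xi>" "u \<in> {0..ub}" using Xi_box by auto
      have "0 \<le> a \<bullet> p" using a p by (intro inner_nonneg_vec) auto
      then have "integrand t p a u \<le> c"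
        unfolding integrand_def c_def using True v_bounds[of "(t, a)"] f_bounds[of "(t, a, u)"] a t pos
        by (auto intro!: mult_mono)
      then show ?thesis using True by (auto intro: ennreal_leI)
    qed (auto simp: integrand_def)
  qed
  also have "\<dots> = (\<integral>\<^sup>+a. ennreal (c * ub) * indicator \<Xi> a \<partial>\<nu>)"
    using pos c by (intro nn_integral_cong, subst nn_integral_cmult_indicator) (auto simp: ennreal_mult mult_ac)
  also have "\<dots> = ennreal (c * ub) * ennreal V"
    using Xin emeasure_nu by (simp add: nn_integral_cmult_indicator)
  also have "\<dots> < \<infinity>" by (simp add: ennreal_mult_less_top)
  finally show ?thesis .
qed

lemma time_rate_nonneg: "0 \<le> time_rate"
  unfolding time_rate_def using pos by simp

lemma limit_surplus_lipschitz:
  assumes s: "s \<in> {0..1}" and t: "t \<in> {0..1}" and p: "0 \<le> p"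
  shows "\<bar>limit_surplus s p - limit_surplus t p\<bar> \<le> time_rate * \<bar>s - t\<bar>"
proof -
  have one: "limit_surplus s p \<le> limit_surplus t p + time_rate * \<bar>s - t\<bar>"
    if s: "s \<in> {0..1}" and t: "t \<in> {0..1}" for s t
  proof -
    have "enn2real (nn_surplus s p) \<le> enn2real (nn_surplus t p + ennreal (time_rate * \<bar>s - t\<bar>))"
      using nn_surplus_perturb[OF s t p] nn_surplus_finite[OF t p] by (intro enn2real_mono) auto
    also have "\<dots> = enn2real (nn_surplus t p) + time_rate * \<bar>s - t\<bar>"
      using nn_surplus_finite[OF t p] time_rate_nonneg by (subst enn2real_plus) auto
    finally show ?thesis using s t by (simp add: limit_surplus_eq)
  qed
  show ?thesis using one[OF s t] one[OF t s] by (simp add: abs_le_iff abs_minus_commute)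
qed

lemma riemann_surplus:
  assumes n: "1 \<le> n" and p: "0 \<le> p"
  shows "\<bar>real n * (limit_dual \<nu> \<Xi> ub v f p d - d \<bullet> p) - (\<Sum>k\<in>{1..n}. limit_surplus (real k / real n) p)\<bar> \<le> time_rate"
proof -
  have "limit_dual \<nu> \<Xi> ub v f p d - d \<bullet> p = (LBINT s:{0..1}. limit_surplus s p)"
    by (simp add: limit_dual_def limit_surplus_def)
  then show ?thesis
    using riemann_sum_lipschitz[OF _ n time_rate_nonneg, of "\<lambda>s. limit_surplus s p"]
      limit_surplus_lipschitz[OF _ _ p] by simp
qed

end

subsection \<open>Marginal laws of a regular sequence\<close>

context regular_sequence
begin

definition order_index :: "nat \<Rightarrow> nat \<Rightarrow> nat" where
  "order_index n k = (if k \<in> {1..n} then k else 1)"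

text \<open>Indices outside \<open>{1..n}\<close> are mapped to the first order, so that every index has a regular law.\<close>

definition marginal :: "nat \<Rightarrow> nat \<Rightarrow> 'm order measure" where
  "marginal n k = distr (P n) borel (\<lambda>\<omega>. \<omega> (order_index n k))"

lemma order_index: "1 \<le> n \<Longrightarrow> order_index n k \<in> {1..n}"
  by (auto simp: order_index_def)

lemma order_time:
  assumes "1 \<le> n" shows "real (order_index n k) / real n \<in> {0..1}"
  using order_index[OF assms, of k] assms by simp

text \<open>Independence identifies \<open>P n\<close> with the product of its marginals, the form
  in which the play was analysed.\<close>

lemma PiM_marginal:
  assumes n: "1 \<le> n" shows "PiM {1..n} (marginal n) = P n"
proof -
  interpret prob_space "P n" by (rule prob_space_P[OF n])
  have rv: "random_variable borel (\<lambda>\<omega>. \<omega> k)" if "k \<in> {1..n}" for k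
    using measurable_coordinate[OF n that] .
  have "distr (P n) (PiM {1..n} (\<lambda>_. borel)) (\<lambda>x. \<lambda>i\<in>{1..n}. x i) = (\<Pi>\<^sub>M i\<in>{1..n}. distr (P n) borel (\<lambda>\<omega>. \<omega> i))"
    using indep[OF n] n by (subst (asm) indep_vars_iff_distr_eq_PiM'[OF _ rv]) auto
  also have "\<dots> = PiM {1..n} (marginal n)"
    by (intro PiM_cong) (auto simp: marginal_def order_index_def)
  also have "distr (P n) (PiM {1..n} (\<lambda>_. borel)) (\<lambda>x. \<lambda>i\<in>{1..n}. x i) = distr (P n) (P n) (\<lambda>x. x)"
  proof (rule distr_cong)
    fix x assume "x \<in> space (P n)"
    then have "x \<in> space (path_space n)" using sets_eq_imp_space_eq[OF sets_P[OF n]] by simp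
    then show "(\<lambda>i\<in>{1..n}. x i) = x"
      by (auto simp: path_space_def space_PiM PiE_def extensional_restrict)
  qed (use sets_P[OF n] in \<open>simp_all add: path_space_def\<close>)
  finally show ?thesis by (simp add: distr_id)
qed

lemma marginal_density:
  assumes n: "1 \<le> n"
  shows "conditional_density (marginal n k) \<Xi> \<alpha> ub mu_lo mu_hi
    (\<lambda>a u. f (real (order_index n k) / real n, a, u))"
proof -
  let ?j = "order_index n k"
  let ?t = "real ?j / real n"
  interpret Pn: prob_space "P n" by (rule prob_space_P[OF n])
  have j: "?j \<in> {1..n}" by (rule order_index[OF n])
  have t: "?t \<in> {0..1}" by (rule order_time[OF n])
  note [measurable] = measurable_coordinate[OF n j]
  interpret q: prob_space "marginal n k"
    unfolding marginal_def by (intro Pn.prob_space_distr) measurable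
  show ?thesis
  proof (unfold_locales, goal_cases)
    case 4
    show ?case by (rule ennreal_density_measurable[OF t])
  next
    case 9
    have "distr (marginal n k) (borel \<Otimes>\<^sub>M borel) (\<lambda>y. (snd y, fst y))
        = distr (P n) (borel \<Otimes>\<^sub>M borel) (\<lambda>\<omega>. (snd (\<omega> ?j), fst (\<omega> ?j)))"
      unfolding marginal_def by (subst distr_distr) (auto simp: comp_def)
    moreover have "distr (marginal n k) borel snd = distr (P n) borel (\<lambda>\<omega>. snd (\<omega> ?j))"
      unfolding marginal_def by (subst distr_distr) (auto simp: comp_def)
    ultimately show ?case using pair_law[OF n j] by (simp add: pair_law_def)
  qed (use Xi_box pos t f_bounds in \<open>auto simp: marginal_def\<close>)
qed

lemma integral_marginal:
  assumes n: "1 \<le> n" and g: "g \<in> borel_measurable borel"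
  shows "(\<integral>y. g y \<partial>marginal n k) = (\<integral>\<omega>. (g (\<omega> (order_index n k)) :: real) \<partial>P n)"
  unfolding marginal_def
  by (rule integral_distr[OF measurable_coordinate[OF n order_index[OF n]] g])

lemma mean_marginal:
  assumes n: "1 \<le> n" shows "a_lo < (\<integral>y. snd y $ i \<partial>marginal n k)"
proof -
  have "(\<lambda>y :: 'm order. snd y $ i) \<in> borel_measurable borel" by measurable
  from integral_marginal[OF n this] mean[OF n order_index[OF n]] show ?thesis by simp
qed

lemma quad_marginal:
  assumes n: "1 \<le> n"
  shows "lam * (norm w)\<^sup>2 \<le> (\<integral>y. (snd y \<bullet> w)\<^sup>2 \<partial>marginal n k)"
proof -
  interpret c: conditional_density "marginal n k" \<Xi> \<alpha> ub mu_lo mu_hi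
    "\<lambda>a u. f (real (order_index n k) / real n, a, u)" by (rule marginal_density[OF n])
  let ?A = "second_moment_matrix (P n) (\<lambda>\<omega>. snd (\<omega> (order_index n k)))"
  have meas: "(\<lambda>y :: 'm order. snd y $ i * snd y $ j) \<in> borel_measurable borel" for i j by measurable
  have A: "?A $ i $ j = (\<integral>y. snd y $ i * snd y $ j \<partial>marginal n k)" for i j
    using integral_marginal[OF n meas] by (simp add: second_moment_matrix_def)
  have int: "integrable (marginal n k) (\<lambda>y. snd y $ i * snd y $ j)" for i j
  proof (rule c.integrable_const_bound[where B = "(\<alpha> * CARD('m)) * (\<alpha> * CARD('m))"])
    show "AE y in marginal n k. norm (snd y $ i * snd y $ j) \<le> (\<alpha> * CARD('m)) * (\<alpha> * CARD('m))"
      using c.AE_norm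
    proof eventually_elim
      case (elim y)
      then have "\<bar>snd y $ i\<bar> \<le> \<alpha> * CARD('m)" "\<bar>snd y $ j\<bar> \<le> \<alpha> * CARD('m)"
        using component_le_norm_cart order_trans by blast+
      then show ?case unfolding real_norm_def abs_mult by (intro mult_mono) auto
    qed
    show "(\<lambda>y. snd y $ i * snd y $ j) \<in> borel_measurable (marginal n k)"
      unfolding measurable_cong_sets[OF c.sets_eq refl] by (rule meas)
  qed
  have sym: "transpose ?A = ?A"
    by (simp add: vec_eq_iff transpose_def A mult.commute)
  have sq: "(snd y \<bullet> w)\<^sup>2 = (\<Sum>i\<in>UNIV. \<Sum>j\<in>UNIV. w $ i * w $ j * (snd y $ i * snd y $ j))" for y :: "'m order"
    by (simp add: inner_vec_def power2_eq_square sum_product mult_ac)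
  have "(\<integral>y. (snd y \<bullet> w)\<^sup>2 \<partial>marginal n k) = (\<Sum>i\<in>UNIV. \<Sum>j\<in>UNIV. w $ i * w $ j * ?A $ i $ j)"
    unfolding sq A using int by (simp add: Bochner_Integration.integral_sum)
  also have "\<dots> = w \<bullet> (?A *v w)"
    by (simp add: inner_vec_def matrix_vector_mult_def sum_distrib_left mult_ac)
  finally have q: "(\<integral>y. (snd y \<bullet> w)\<^sup>2 \<partial>marginal n k) = w \<bullet> (?A *v w)" .
  have "lam * (norm w)\<^sup>2 \<le> Min (eigenvalues ?A) * (norm w)\<^sup>2"
    using eigenvalue[OF n order_index[OF n]] by (intro mult_right_mono) (auto intro: less_imp_le)
  with quadratic_form_ge_Min_eigenvalue[OF sym, of w] q show ?thesis by simp
qed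

lemma surplus_marginal:
  assumes n: "1 \<le> n" and k: "k \<in> {1..n}"
  shows "surplus (marginal n k) p = limit_surplus (real k / real n) p"
proof -
  note [measurable] = measurable_coordinate[OF n k]
  have idx: "order_index n k = k" using k by (simp add: order_index_def)
  have "(\<lambda>y :: 'm order. max 0 (fst y - snd y \<bullet> p)) \<in> borel_measurable borel" by measurable
  from integral_marginal[OF n this]
  have "surplus (marginal n k) p = (\<integral>\<omega>. max 0 (fst (\<omega> k) - snd (\<omega> k) \<bullet> p) \<partial>P n)"
    by (simp add: surplus_def idx)
  also have "\<dots> = (\<integral>(a, u). max 0 (u - a \<bullet> p)
      \<partial>distr (P n) (borel \<Otimes>\<^sub>M borel) (\<lambda>\<omega>. (snd (\<omega> k), fst (\<omega> k))))"
    by (subst integral_distr) auto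
  also have "\<dots> = limit_surplus (real k / real n) p"
    unfolding limit_surplus_def pair_law[OF n k] consumption_law[OF n k] ..
  finally show ?thesis .
qed

text \<open>The limit price has margin \<open>e\<close>. Half of it leaves room for a ball of radius
  \<open>2 * \<delta>\<close> with \<open>\<delta> = e / (4 * M)\<close>; the other half keeps
  acceptance probabilities away from 0.\<close>

definition price_box :: "real \<Rightarrow> (real ^ 'm) set" where
  "price_box e = {p. 0 \<le> p \<and> (\<forall>a\<in>\<Xi>. a \<bullet> p \<le> ub - e / 2)}"

lemma Xi_nonneg: "a \<in> \<Xi> \<Longrightarrow> 0 \<le> a"
  using Xi_box by auto

text \<open>The expected cost of an order is at most \<open>ub\<close>, but at least
  \<open>a_lo\<close> times the sum of the prices.\<close>

lemma price_box_norm: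
  assumes p: "p \<in> price_box e" and e: "0 \<le> e"
  shows "norm p \<le> ub / a_lo"
proof -
  interpret c: conditional_density "marginal 1 1" \<Xi> \<alpha> ub mu_lo mu_hi
    "\<lambda>a u. f (real (order_index 1 1) / real 1, a, u)" by (rule marginal_density) simp
  have p0: "0 \<le> p $ i" for i using p by (simp add: price_box_def less_eq_vec_def)
  have int: "integrable (marginal 1 1) (\<lambda>y. snd y $ i)" for i
    using integrable_inner_left[OF c.integrable_resource, of "axis i 1"] by (simp add: inner_axis)
  have "a_lo * norm p \<le> a_lo * (\<Sum>i\<in>UNIV. \<bar>p $ i\<bar>)"
    using pos norm_le_l1_cart[of p] by (intro mult_left_mono) auto
  also have "\<dots> = (\<Sum>i\<in>UNIV. p $ i * a_lo)" using p0 by (simp add: sum_distrib_left mult.commute)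
  also have "\<dots> \<le> (\<Sum>i\<in>UNIV. p $ i * (\<integral>y. snd y $ i \<partial>marginal 1 1))"
    using p0 mean_marginal[of 1] by (intro sum_mono mult_left_mono) (auto intro: less_imp_le)
  also have "\<dots> = (\<integral>y. snd y \<bullet> p \<partial>marginal 1 1)"
    using int by (simp add: inner_vec_def Bochner_Integration.integral_sum mult.commute)
  also have "\<dots> \<le> (\<integral>y. ub \<partial>marginal 1 1)"
  proof (intro integral_mono_AE)
    show "AE y in marginal 1 1. snd y \<bullet> p \<le> ub"
      using c.AE_support by eventually_elim (use p e in \<open>fastforce simp: price_box_def\<close>)
  qed (use c.integrable_const integrable_inner_left[OF c.integrable_resource, of p]
    in \<open>simp_all del: One_nat_def\<close>)
  finally show ?thesis using pos by (simp add: c.prob_space field_simps del: One_nat_def)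
qed

text \<open>Strong convexity comes from the lower reward density together with the least eigenvalue;
  the consumption bound comes from the same density, the margin \<open>e / 2\<close> and the mean
  consumption.\<close>

lemma order_sequence_marginal:
  assumes n: "1 \<le> n" and e: "0 < e" "e \<le> ub"
  shows "order_sequence (marginal n) \<alpha> (\<alpha> * CARD('m)) ub (mu_lo / 2 * lam)
    (mu_hi / 2 * (\<alpha> * CARD('m))\<^sup>2) (mu_lo * (e / 2) * a_lo) (ub / a_lo) (price_box e)"
proof (rule order_sequence.intro, goal_cases)
  case (1 k)
  interpret c: conditional_density "marginal n k" \<Xi> \<alpha> ub mu_lo mu_hi
    "\<lambda>a u. f (real (order_index n k) / real n, a, u)" by (rule marginal_density[OF n])
  show ?case by (rule c.order_law_axioms)
next
  case 2
  have "price_box e = {p. 0 \<le> p} \<inter> (\<Inter>a\<in>\<Xi>. {p. a \<bullet> p \<le> ub - e / 2})"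
    by (auto simp: price_box_def)
  moreover have "convex {p :: real ^ 'm. 0 \<le> p}"
    by (auto simp: convex_def intro!: add_nonneg_nonneg scaleR_nonneg_nonneg)
  ultimately show ?case by (auto intro!: convex_Int convex_INT convex_halfspace_le)
next
  case 3
  have "price_box e = (\<Inter>i. {p. 0 \<le> p $ i}) \<inter> (\<Inter>a\<in>\<Xi>. {p. a \<bullet> p \<le> ub - e / 2})"
    by (auto simp: price_box_def less_eq_vec_def)
  then show ?case
    by (auto intro!: closed_Int closed_INT closed_halfspace_le closed_Collect_le continuous_intros)
next
  case (7 k p q)
  interpret c: conditional_density "marginal n k" \<Xi> \<alpha> ub mu_lo mu_hi
    "\<lambda>a u. f (real (order_index n k) / real n, a, u)" by (rule marginal_density[OF n])
  have "mu_lo / 2 * (lam * (norm (p - q))\<^sup>2) \<le> mu_lo / 2 * c.quad (p - q)"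
    using pos by (intro mult_left_mono quad_marginal[OF n]) auto
  also have "\<dots> \<le> divergence (marginal n k) q p"
  proof (rule c.divergence_ge)
    fix a assume "a \<in> \<Xi>"
    with 7 e show "0 \<le> a \<bullet> p \<and> a \<bullet> p \<le> ub" "0 \<le> a \<bullet> q \<and> a \<bullet> q \<le> ub"
      using inner_nonneg_vec[OF Xi_nonneg] by (force simp: price_box_def)+
  qed
  finally show ?case by (simp add: norm_minus_commute)
next
  case (8 k p q)
  interpret c: conditional_density "marginal n k" \<Xi> \<alpha> ub mu_lo mu_hi
    "\<lambda>a u. f (real (order_index n k) / real n, a, u)" by (rule marginal_density[OF n])
  show ?case by (rule c.divergence_upper_norm)
next
  case (9 k p i)
  interpret c: conditional_density "marginal n k" \<Xi> \<alpha> ub mu_lo mu_hi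
    "\<lambda>a u. f (real (order_index n k) / real n, a, u)" by (rule marginal_density[OF n])
  have "mu_lo * (e / 2) * a_lo \<le> mu_lo * (e / 2) * (\<integral>y. snd y $ i \<partial>marginal n k)"
    using pos e mean_marginal[OF n] by (intro mult_left_mono) (auto intro: less_imp_le)
  also have "\<dots> \<le> consumption (marginal n k) p $ i"
    using 9 e inner_nonneg_vec[OF Xi_nonneg] by (intro c.consumption_ge) (auto simp: price_box_def)
  finally show ?case .
qed (use e pos price_box_norm[of _ e] in \<open>auto simp: price_box_def zero_less_mult_iff\<close>)

end

subsection \<open>Interior prices and the regret bound\<close>

context regular_sequence
begin

definition finite_dual :: "nat \<Rightarrow> real ^ 'm \<Rightarrow> real ^ 'm \<Rightarrow> real" where
  "finite_dual n d p = (real n *\<^sub>R d) \<bullet> p + (\<Sum>k\<in>{1..n}. surplus (marginal n k) p)"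

text \<open>Each of the two prices incurs one Riemann error; their sum becomes
  \<open>C0\<close>.\<close>

lemma finite_dual_near_optimal:
  assumes n: "1 \<le> n" and p: "is_arg_min (\<lambda>q. limit_dual \<nu> \<Xi> ub v f q d) (\<lambda>q. 0 \<le> q) p" and q: "0 \<le> q"
  shows "finite_dual n d p \<le> finite_dual n d q + 2 * time_rate"
proof -
  have near: "\<bar>real n * limit_dual \<nu> \<Xi> ub v f r d - finite_dual n d r\<bar> \<le> time_rate" if "0 \<le> r" for r
    using riemann_surplus[OF n that, of d] surplus_marginal[OF n]
    by (simp add: finite_dual_def right_diff_distrib diff_diff_eq del: One_nat_def)
  have "0 \<le> p" "limit_dual \<nu> \<Xi> ub v f p d \<le> limit_dual \<nu> \<Xi> ub v f q d"
    using p q by (auto simp: is_arg_min_linorder)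
  moreover from this have "real n * limit_dual \<nu> \<Xi> ub v f p d \<le> real n * limit_dual \<nu> \<Xi> ub v f q d"
    by (intro mult_left_mono) auto
  ultimately show ?thesis using near[of p] near[OF q] by (simp add: abs_le_iff)
qed

lemma Xi_inner_le:
  assumes "a \<in> \<Xi>" shows "\<bar>a \<bullet> w\<bar> \<le> \<alpha> * CARD('m) * norm w"
proof -
  have "norm a \<le> \<alpha> * CARD('m)" using assms Xi_box by (intro norm_le_of_box) auto
  then have "norm a * norm w \<le> \<alpha> * CARD('m) * norm w" by (intro mult_right_mono) auto
  then show ?thesis using Cauchy_Schwarz_ineq2[of a w] by linarith
qed

text \<open>
  Compare the minimiser \<open>p\<close> with \<open>(1 - 1 / j) p\<close> in the problem with \<open>j\<^sup>2\<close> orders: the first-order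
  terms are of order \<open>j\<close>, the errors are bounded.
\<close>

lemma budget_expenditure:
  assumes arg: "is_arg_min (\<lambda>q. limit_dual \<nu> \<Xi> ub v f q d) (\<lambda>q. 0 \<le> q) p"
    and const: "\<And>a. a \<in> \<Xi> \<Longrightarrow> a \<bullet> p = c" and c: "0 \<le> c"
  shows "d \<bullet> p \<le> c * (mu_hi * max 0 (ub - c))"
proof (rule ccontr)
  let ?X = "c * (mu_hi * max 0 (ub - c))"
  define C1 where "C1 = mu_hi / 2 * (\<alpha> * CARD('m))\<^sup>2"
  define Y where "Y = C1 * (norm p)\<^sup>2 + 2 * time_rate"
  have p: "0 \<le> p" using arg by (simp add: is_arg_min_def)
  assume "\<not> ?thesis"
  then have gap: "0 < d \<bullet> p - ?X" by simp
  obtain j0 :: nat where j0: "Y / (d \<bullet> p - ?X) < real j0" using reals_Archimedean2 by blast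
  define j where "j = Suc j0"
  have j: "1 \<le> real j" "Y / (d \<bullet> p - ?X) < real j" using j0 by (auto simp: j_def)
  define n where "n = j * j"
  define \<theta> where "\<theta> = 1 / real j"
  define q where "q = (1 - \<theta>) *\<^sub>R p"
  have n: "1 \<le> n" using j by (simp add: n_def j_def)
  have \<theta>: "0 < \<theta>" "\<theta> \<le> 1" "real n * \<theta> = real j" "real n * \<theta>\<^sup>2 = 1"
    using j by (auto simp: \<theta>_def n_def power2_eq_square)
  have q: "0 \<le> q" using p \<theta> unfolding q_def by (intro scaleR_nonneg_nonneg) auto
  have pq: "p - q = \<theta> *\<^sub>R p" by (simp add: q_def algebra_simps)
  have "surplus (marginal n k) q \<le> surplus (marginal n k) p + \<theta> * ?X + C1 * \<theta>\<^sup>2 * (norm p)\<^sup>2" for k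
  proof -
    interpret c: conditional_density "marginal n k" \<Xi> \<alpha> ub mu_lo mu_hi
      "\<lambda>a u. f (real (order_index n k) / real n, a, u)" by (rule marginal_density[OF n])
    have "consumption (marginal n k) p \<bullet> (p - q) \<le> \<theta> * ?X"
      unfolding pq using c.expenditure_le[OF const c] \<theta> by (simp add: mult_left_mono)
    moreover have "divergence (marginal n k) q p \<le> C1 * (norm (q - p))\<^sup>2"
      unfolding C1_def by (rule c.divergence_upper_norm)
    moreover have "(norm (q - p))\<^sup>2 = \<theta>\<^sup>2 * (norm p)\<^sup>2"
      using \<theta> by (simp add: norm_minus_commute[of q p] pq power_mult_distrib)
    ultimately show ?thesis using c.surplus_expand[of q p] by (simp add: mult.assoc)
  qed
  then have "(\<Sum>k\<in>{1..n}. surplus (marginal n k) q)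
      \<le> (\<Sum>k\<in>{1..n}. surplus (marginal n k) p + \<theta> * ?X + C1 * \<theta>\<^sup>2 * (norm p)\<^sup>2)"
    by (intro sum_mono)
  also have "\<dots> = (\<Sum>k\<in>{1..n}. surplus (marginal n k) p) + (real n * \<theta>) * ?X + (real n * \<theta>\<^sup>2) * (C1 * (norm p)\<^sup>2)"
    by (simp add: sum.distrib mult_ac)
  finally have "(\<Sum>k\<in>{1..n}. surplus (marginal n k) q)
      \<le> (\<Sum>k\<in>{1..n}. surplus (marginal n k) p) + real j * ?X + C1 * (norm p)\<^sup>2"
    unfolding \<theta> by simp
  moreover have "(real n *\<^sub>R d) \<bullet> p - (real n *\<^sub>R d) \<bullet> q = (real n * \<theta>) * (d \<bullet> p)"
    by (simp add: q_def algebra_simps)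
  then have "(real n *\<^sub>R d) \<bullet> p - (real n *\<^sub>R d) \<bullet> q = real j * (d \<bullet> p)" unfolding \<theta> .
  ultimately have "real j * (d \<bullet> p) \<le> real j * ?X + Y"
    using finite_dual_near_optimal[OF n arg q] unfolding finite_dual_def Y_def by linarith
  then have "real j * (d \<bullet> p - ?X) \<le> Y" by (simp add: right_diff_distrib)
  moreover have "Y < real j * (d \<bullet> p - ?X)" using j(2) gap by (simp add: field_simps)
  ultimately show False by simp
qed

text \<open>If a \<bullet> p varies over the support, the open interval is nonempty and its right
  end is at most ub - \<epsilon>. If it is a constant c, the interval is empty and the budget takes
  over: dmin c \<le> \<alpha> (d \<bullet> p), while \<open>budget_expenditure\<close> bounds d
  \<bullet> p by c mu_hi times the positive part of ub - c. For c > 0 dividing by c gives the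
  margin; for c = 0 it is at most ub by the choice of the minimum.\<close>

lemma interior_price:
  assumes d: "\<And>i. dmin \<le> d $ i" "0 < dmin" and \<epsilon>: "0 < \<epsilon>"
    and arg: "is_arg_min (\<lambda>q. limit_dual \<nu> \<Xi> ub v f q d) (\<lambda>q. 0 \<le> q) p"
    and interval: "{(INF a\<in>\<Xi>. a \<bullet> p) <..< (SUP a\<in>\<Xi>. a \<bullet> p)} \<subseteq> {\<epsilon> <..< ub - \<epsilon>}"
    and a: "a \<in> \<Xi>"
  shows "a \<bullet> p \<le> ub - min \<epsilon> (min ub (dmin / (\<alpha> * mu_hi)))"
proof -
  let ?I = "INF a\<in>\<Xi>. a \<bullet> p" and ?S = "SUP a\<in>\<Xi>. a \<bullet> p"
  have p: "0 \<le> p" using arg by (simp add: is_arg_min_def)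
  have above: "bdd_above ((\<lambda>a. a \<bullet> p) ` \<Xi>)"
    by (rule bdd_aboveI2[where M = "\<alpha> * CARD('m) * norm p"]) (use Xi_inner_le in \<open>auto simp: abs_le_iff\<close>)
  have below: "bdd_below ((\<lambda>a. a \<bullet> p) ` \<Xi>)"
    by (rule bdd_belowI2[where m = 0]) (use Xi_nonneg p in \<open>auto intro: inner_nonneg_vec\<close>)
  have IS: "?I \<le> b \<bullet> p" "b \<bullet> p \<le> ?S" if "b \<in> \<Xi>" for b
    using that by (auto intro: cINF_lower[OF below] cSUP_upper[OF _ above])
  show ?thesis
  proof (cases "?I < ?S")
    case True
    have "?S \<le> ub - \<epsilon>"
    proof (rule ccontr)
      assume "\<not> ?S \<le> ub - \<epsilon>"
      then have "max ?I (ub - \<epsilon>) < ?S" using True by simp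
      then obtain x where "max ?I (ub - \<epsilon>) < x" "x < ?S" using dense by blast
      then show False using interval by force
    qed
    then show ?thesis using IS(2)[OF a] by linarith
  next
    case False
    define c where "c = a \<bullet> p"
    have const: "b \<bullet> p = c" if "b \<in> \<Xi>" for b
      using IS[OF that] IS[OF a] False unfolding c_def by linarith
    have c: "0 \<le> c" unfolding c_def using Xi_nonneg[OF a] p by (rule inner_nonneg_vec)
    show ?thesis
    proof (cases "c = 0")
      case True
      then show ?thesis unfolding c_def using \<epsilon> by simp
    next
      case False
      have p0: "0 \<le> p $ i" for i using p by (simp add: less_eq_vec_def)
      have "dmin * c = dmin * (\<Sum>i\<in>UNIV. a $ i * p $ i)" by (simp add: c_def inner_vec_def)
      also have "\<dots> \<le> dmin * (\<Sum>i\<in>UNIV. \<alpha> * p $ i)"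
        using d(2) p0 a Xi_box by (intro mult_left_mono sum_mono mult_right_mono) (auto simp: less_eq_vec_def)
      also have "\<dots> = \<alpha> * (\<Sum>i\<in>UNIV. dmin * p $ i)"
        by (simp add: sum_distrib_left mult_ac)
      also have "\<dots> \<le> \<alpha> * (\<Sum>i\<in>UNIV. d $ i * p $ i)"
        using pos p0 d(1) by (intro mult_left_mono sum_mono mult_right_mono) auto
      also have "\<dots> = \<alpha> * (d \<bullet> p)" by (simp add: inner_vec_def)
      also have "\<dots> \<le> \<alpha> * (c * (mu_hi * max 0 (ub - c)))"
        using pos budget_expenditure[OF arg const c] by (intro mult_left_mono) auto
      finally have "c * dmin \<le> c * (\<alpha> * mu_hi * max 0 (ub - c))" by (simp add: mult_ac)
      then have le: "dmin \<le> \<alpha> * mu_hi * max 0 (ub - c)" using False c by simp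
      then have "dmin / (\<alpha> * mu_hi) \<le> max 0 (ub - c)" using pos by (simp add: field_simps)
      moreover have "0 < dmin / (\<alpha> * mu_hi)" using pos d(2) by simp
      ultimately have "dmin / (\<alpha> * mu_hi) \<le> ub - c" by linarith
      then show ?thesis unfolding c_def by linarith
    qed
  qed
qed

lemma regret_regular:
  fixes d0 :: "real ^ 'm" and \<epsilon> dmin :: real
  defines "e \<equiv> min \<epsilon> (min ub (dmin / (\<alpha> * mu_hi)))" and "M \<equiv> \<alpha> * CARD('m)"
  assumes n: "3 \<le> n" and d: "\<And>i. dmin \<le> d0 $ i" "0 < dmin" and \<epsilon>: "0 < \<epsilon>"
    and interior: "interior_limit_price \<nu> \<Xi> ub v f d0 \<epsilon>" and alg: "single_sample_algorithm d0 pr"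
  shows "regret d0 pr n P \<le> (max 0 (play.regret_bound \<alpha> M ub (mu_lo / 2 * lam) (mu_hi / 2 * M\<^sup>2)
      (mu_lo * (e / 2) * a_lo) (e / (4 * M)) (2 * time_rate) (grid_rate M CARD('m)) (grid_error M CARD('m)))
    + ub * grid_size (ub / a_lo) CARD('m)) * (ln (real n))\<^sup>2"
proof -
  have n1: "1 \<le> n" using n by simp
  have e: "0 < e" "e \<le> ub" using \<epsilon> pos d(2) by (auto simp: e_def)
  have M: "0 < M" using pos by (simp add: M_def)
  interpret o: order_sequence n "marginal n" \<alpha> M ub "mu_lo / 2 * lam" "mu_hi / 2 * M\<^sup>2"
    "mu_lo * (e / 2) * a_lo" "ub / a_lo" "price_box e"
    unfolding M_def by (rule order_sequence_marginal[OF n1 e])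
  obtain p where p: "is_arg_min (\<lambda>q. limit_dual \<nu> \<Xi> ub v f q d0) (\<lambda>q. 0 \<le> q) p"
    "{(INF a\<in>\<Xi>. a \<bullet> p) <..< (SUP a\<in>\<Xi>. a \<bullet> p)} \<subseteq> {\<epsilon> <..< ub - \<epsilon>}"
    using interior by (auto simp: interior_limit_price_def)
  have p0: "0 \<le> p" using p(1) by (simp add: is_arg_min_def)
  have ap: "a \<bullet> p \<le> ub - e" if "a \<in> \<Xi>" for a
    unfolding e_def by (rule interior_price[OF d \<epsilon> p that])
  have room: "q \<in> price_box e" if q: "0 \<le> q" "norm (q - p) \<le> 2 * (e / (4 * M))" for q
    unfolding price_box_def
  proof (intro CollectI conjI ballI q(1))
    fix a assume a: "a \<in> \<Xi>"
    have "a \<bullet> (q - p) \<le> M * norm (q - p)"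
      using Xi_inner_le[OF a, of "q - p"] by (simp add: M_def abs_le_iff)
    also have "\<dots> \<le> M * (2 * (e / (4 * M)))" using M q(2) by (intro mult_left_mono) auto
    also have "\<dots> = e / 2" using M by simp
    finally show "a \<bullet> q \<le> ub - e / 2" using ap[OF a] by (simp add: inner_diff_right)
  qed
  have dual: "o.dual 0 (real n *\<^sub>R d0) q = finite_dual n d0 q" for q
    by (simp add: o.dual_def o.total_def finite_dual_def)
  show ?thesis
  proof (rule o.regret_le[OF n])
    show "0 \<le> d0" using d by (auto simp: less_eq_vec_def intro: order_trans less_imp_le)
    show "0 < e / (4 * M)" using e M by simp
    show "p \<in> price_box e" using p0 e M by (intro room) auto
    show "o.dual 0 (real n *\<^sub>R d0) p \<le> o.dual 0 (real n *\<^sub>R d0) q + 2 * time_rate" if "q \<in> price_box e" for q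
      unfolding dual using that by (intro finite_dual_near_optimal[OF n1 p(1)]) (simp add: price_box_def)
    show "P n = PiM {1..n} (marginal n)" by (rule PiM_marginal[OF n1, symmetric])
  qed (fact room alg)+
qed

end

theorem theorem3:
  fixes \<P> :: "('m::finite) dist_seq set"
    and d0 :: "real ^ 'm"
    and \<alpha> a_lo lam L ub mu_hi mu_lo \<epsilon> :: real
    and \<Xi> :: "(real ^ 'm) set"
    and \<nu> :: "(real ^ 'm) measure"
    and v :: "'m dist_seq \<Rightarrow> real \<times> (real ^ 'm) \<Rightarrow> real"
    and f :: "'m dist_seq \<Rightarrow> real \<times> (real ^ 'm) \<times> real \<Rightarrow> real"
    and pr :: "'m price_rule"
  assumes "\<forall>P\<in>\<P>. distribution_sequence P"
    and "\<forall>i. 0 < d0 $ i"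
    and "regular_family \<P> \<alpha> a_lo lam L ub mu_hi mu_lo \<Xi> \<nu> v f"
    and "0 < \<epsilon>"
    and "\<forall>P\<in>\<P>. interior_limit_price \<nu> \<Xi> ub (v P) (f P) d0 \<epsilon>"
    and "single_sample_algorithm d0 pr"
  shows "\<exists>C. \<forall>P\<in>\<P>. \<forall>\<^sub>F n in sequentially. regret d0 pr n P \<le> C * (ln (real n))\<^sup>2"
proof -
  define dmin where "dmin = Min (range (\<lambda>i. d0 $ i))"
  have d: "dmin \<le> d0 $ i" for i by (simp add: dmin_def)
  have "dmin \<in> range (\<lambda>i. d0 $ i)" unfolding dmin_def by (intro Min_in) auto
  then have d0: "0 < dmin" using assms(2) by auto
  define e where "e = min \<epsilon> (min ub (dmin / (\<alpha> * mu_hi)))"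
  define M where "M = \<alpha> * real CARD('m)"
  \<comment> \<open>Only parameters shared by the family occur, with \<open>2 * time_rate\<close>
    written out, so one \<open>C\<close> serves every member.\<close>
  define C where "C = max 0 (play.regret_bound \<alpha> M ub (mu_lo / 2 * lam) (mu_hi / 2 * M\<^sup>2)
      (mu_lo * (e / 2) * a_lo) (e / (4 * M)) (2 * (2 * ub\<^sup>2 * mu_hi * L * measure \<nu> \<Xi>))
      (grid_rate M CARD('m)) (grid_error M CARD('m)))
    + ub * grid_size (ub / a_lo) CARD('m)"
  have "\<forall>\<^sub>F n in sequentially. regret d0 pr n P \<le> C * (ln (real n))\<^sup>2" if P: "P \<in> \<P>" for P
  proof -
    interpret r: regular_sequence P \<alpha> a_lo lam L ub mu_hi mu_lo \<Xi> \<nu> "v P" "f P"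
    proof
      show "distribution_sequence P" using assms(1) P by blast
      show "regular_family {P} \<alpha> a_lo lam L ub mu_hi mu_lo \<Xi> \<nu> (\<lambda>_. v P) (\<lambda>_. f P)"
        using assms(3) unfolding regular_family_def
        by (elim conjE, intro conjI)
          (assumption | rule ballI, drule bspec[OF _ P], drule singletonD, hypsubst, assumption)+
    qed
    \<comment> \<open>From 3 on, \<open>ln n \<ge> 1\<close>, so constants and single logarithms are
      absorbed by the squared logarithm.\<close>
    have "regret d0 pr n P \<le> C * (ln (real n))\<^sup>2" if "3 \<le> n" for n
      using r.regret_regular[OF that d d0 assms(4) _ assms(6)] assms(5) P
      unfolding C_def M_def e_def r.time_rate_def by blast
    then show ?thesis unfolding eventually_sequentially by blast
  qed
  then show ?thesis by blast
qed

end
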